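(* Let $0 \leq \alpha < n$, $1 < u < \infty$, and let $q(\cdot) : \mathbb{R}^{n} \to (0,\infty)$ be a measurable function with $0 < q_{-} \leq q_{+} < \infty$. Let $\omega \in \mathcal{W}_{q(\cdot)}$ and define $p(\cdot)$ by $\frac{1}{p(\cdot)} := \frac{1}{q(\cdot)} + \frac{\alpha}{n}$. Then for every $r > s_{\omega,\,q(\cdot)} + \frac{\alpha}{n}$ there is a constant $C>0$ such that \[ \left\| \left( \sum_{j \in \mathbb{N}} (M_{\alpha/r} f_j)^{u} \right)^{1/u} \right\|_{L^{rq(\cdot)}_{\omega^{1/r}}} \leq C \left\| \left( \sum_{j \in \mathbb{N}} |f_j|^{u} \right)^{1/u} \right\|_{L^{rp(\cdot)}_{\omega^{1/r}}} \] for all sequences $\{f_j\}_{j=1}^{\infty}$ of bounded measurable functions with compact support.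
   Context: For a measurable $p(\cdot):\mathbb{R}^n\to(0,\infty)$, $p_-=\operatorname{ess\,inf} p$, $p_+=\operatorname{ess\,sup} p$. A weight is a locally integrable function $\omega$ with $0<\omega<\infty$ a.e. The weighted variable Lebesgue space $L^{p(\cdot)}_\omega$ consists of measurable $f$ with $\|f\|_{L^{p(\cdot)}_\omega}:=\|f\omega\|_{L^{p(\cdot)}}<\infty$, where $\|g\|_{L^{p(\cdot)}}=\inf\{\lambda>0:\int_{\mathbb{R}^n}|g(x)/\lambda|^{p(x)}dx\le 1\}$. For an exponent $t(\cdot)\ge 1$, $t'(\cdot)$ denotes the conjugate exponent, $1/t(x)+1/t'(x)=1$. $M$ is the Hardy–Littlewood maximal operator. For $0\le\beta<n$, $M_\beta f(x)=\sup_{Q\ni x}|Q|^{\beta/n-1}\int_Q|f(y)|dy$ (supremum over cubes), so $M_0=M$. $\mathcal{W}_{q(\cdot)}$ (for $0<q_-\le q_+<\infty$) is the set of weights $\omega$ such that: (i) there exists $0<q_\ast<\min\{1,q_-\}$ with $\|\chi_Q\|_{L^{q(\cdot)/q_\ast}_{\omega^{q_\ast}}}<\infty$ and $\|\chi_Q\|_{L^{(q(\cdot)/q_\ast)'}_{\omega^{-q_\ast}}}<\infty$ for every cube $Q$; (ii) there exist $\kappa>1$ and $s>1$ such that $M$ is bounded on $L^{(sq(\cdot))'/\kappa}_{\omega^{-\kappa/s}}$. $s_{\omega,\,q(\cdot)}:=\inf\{s\ge 1: M \text{ is bounded on } L^{(sq(\cdot))'}_{\omega^{-1/s}}\}$.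 *)

theory Defs
  imports "HOL-Analysis.Analysis"
begin

definition epow :: "ennreal \<Rightarrow> real \<Rightarrow> ennreal" where
  "epow x t = (if x = top then top else ennreal (enn2real x powr t))"

definition ess_inf_fun :: "('a::euclidean_space \<Rightarrow> real) \<Rightarrow> real" where
  "ess_inf_fun p = Sup {c. AE x in lebesgue. c \<le> p x}"

text \<open>Luxemburg norm of the variable Lebesgue space L^{p(.)} (value infinity if no admissible lambda).\<close>
definition var_norm :: "('a::euclidean_space \<Rightarrow> real) \<Rightarrow> ('a \<Rightarrow> ennreal) \<Rightarrow> ennreal" where
  "var_norm p g = Inf {ennreal l | l. l > 0 \<and>
      (\<integral>\<^sup>+ x. epow (g x / ennreal l) (p x) \<partial>lebesgue) \<le> 1}"

definition wvar_norm :: "('a::euclidean_space \<Rightarrow> real) \<Rightarrow> ('a \<Rightarrow> real) \<Rightarrow> ('a \<Rightarrow> ennreal) \<Rightarrow> ennreal" where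
  "wvar_norm p w g = var_norm p (\<lambda>x. g x * ennreal (w x))"

text \<open>Conjugate exponent t' with 1/t + 1/t' = 1 (used only where t > 1).\<close>
definition conj_exp :: "('a \<Rightarrow> real) \<Rightarrow> ('a \<Rightarrow> real)" where
  "conj_exp t = (\<lambda>x. t x / (t x - 1))"

definition is_cube :: "'a::euclidean_space set \<Rightarrow> bool" where
  "is_cube Q \<longleftrightarrow> (\<exists>a h. h > 0 \<and> Q = cbox a (a + h *\<^sub>R One))"

definition frac_max :: "real \<Rightarrow> ('a::euclidean_space \<Rightarrow> real) \<Rightarrow> 'a \<Rightarrow> ennreal" where
  "frac_max \<beta> f x = (SUP Q \<in> {Q. is_cube Q \<and> x \<in> Q}.
      ennreal (measure lebesgue Q powr (\<beta> / real DIM('a) - 1)) *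
      (\<integral>\<^sup>+ y \<in> Q. ennreal \<bar>f y\<bar> \<partial>lebesgue))"

definition hl_max :: "('a::euclidean_space \<Rightarrow> real) \<Rightarrow> 'a \<Rightarrow> ennreal" where
  "hl_max f = frac_max 0 f"

definition M_bounded :: "('a::euclidean_space \<Rightarrow> real) \<Rightarrow> ('a \<Rightarrow> real) \<Rightarrow> bool" where
  "M_bounded p w \<longleftrightarrow> (\<exists>C::real. C > 0 \<and> (\<forall>f \<in> borel_measurable lebesgue.
      wvar_norm p w (hl_max f) \<le> ennreal C * wvar_norm p w (\<lambda>x. ennreal \<bar>f x\<bar>)))"

definition is_weight :: "('a::euclidean_space \<Rightarrow> real) \<Rightarrow> bool" where
  "is_weight w \<longleftrightarrow> w \<in> borel_measurable lebesgue \<and> (AE x in lebesgue. 0 < w x) \<and>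
     (\<forall>a b. set_integrable lebesgue (cbox a b) w)"

text \<open>The class W_{q(.)}. The conjugate (s q)' is only meaningful when s q > 1,
  which is required explicitly.\<close>
definition W_class :: "('a::euclidean_space \<Rightarrow> real) \<Rightarrow> ('a \<Rightarrow> real) set" where
  "W_class q = {w. is_weight w \<and>
     (\<exists>qs. 0 < qs \<and> qs < min 1 (ess_inf_fun q) \<and>
        (\<forall>Q. is_cube Q \<longrightarrow>
           wvar_norm (\<lambda>x. q x / qs) (\<lambda>x. w x powr qs) (indicator Q) < top \<and>
           wvar_norm (conj_exp (\<lambda>x. q x / qs)) (\<lambda>x. w x powr (- qs)) (indicator Q) < top)) \<and>
     (\<exists>\<kappa> s. \<kappa> > 1 \<and> s > 1 \<and> (AE x in lebesgue. s * q x > 1) \<and>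
        M_bounded (\<lambda>x. conj_exp (\<lambda>y. s * q y) x / \<kappa>) (\<lambda>x. w x powr (- \<kappa> / s)))}"

text \<open>s_{w,q(.)} as an extended real (infinity if the set is empty).\<close>
definition s_index :: "('a::euclidean_space \<Rightarrow> real) \<Rightarrow> ('a \<Rightarrow> real) \<Rightarrow> ereal" where
  "s_index w q = Inf {ereal s | s. s \<ge> 1 \<and> (AE x in lebesgue. s * q x > 1) \<and>
        M_bounded (conj_exp (\<lambda>y. s * q y)) (\<lambda>x. w x powr (- 1 / s))}"

end

theory Submission
  imports Defs
begin

text \<open>
  Duality and the Rubio de Francia iteration in $L^{(sq)'}_{\omega^{-1/s}}$, where $M$ is bounded,
  reduce the inequality to one with constant exponents $q_0 = r/s$, $1/p_0 = 1/q_0 + \alpha/(rn)$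
  and a Muckenhoupt $A_1$ weight $v$; here $p_0 > 1$ is exactly $r > s + \alpha/n$.
  For $v \in A_1$ the averages over a ball with respect to Lebesgue measure are dominated by those
  with respect to $\nu = v\,dx$, so the weight is absorbed into a doubling measure, on which
  the maximal operator is bounded by the Vitali covering lemma and Marcinkiewicz interpolation.
  The vector-valued bound on $\nu$ starts from the trivial case $p = u$. For $p < u$ one divides
  by a power of an $A_1$ majorant of the $\ell^u$ norm of the data, the fractional case following
  from Hedberg's inequality and Hoelder's inequality in the index; for $p > u$ one tests against
  an $A_1$ majorant of a dual function, which is again absorbed into the measure.
\<close>

section \<open>Powers of extended nonnegative reals and integral inequalities\<close>

text \<open>The weights produced by the iteration depend on the data, so no estimate may see more of
  a weight than its A_1 constant. This dictates the form of the vector-valued bounds: one constant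
  serves all measures with the same doubling constant \<open>D\<close>. It is also why a weight is
  turned into a measure: an A_1 weight with constant \<open>K\<close> changes \<open>D\<close> into
  \<open>K * D\<close>, and an unweighted bound for the new measure is a weighted bound for the old
  one. Boundedness of M is given for norms, while the iteration and the duality run on modulars,
  that is on the integrals of |f|^{p(x)}, where a variable exponent can be treated point by point.
  Norms are translated at both ends by scaling. Each duality argument ends in m \<le> X m^\<gamma>
  with \<gamma> < 1 for the unknown modular m, and dividing by m^\<gamma> requires m < \<infinity>.
  This is what the truncations are for.\<close>

lemma epow_ennreal: "0 \<le> x \<Longrightarrow> epow (ennreal x) t = ennreal (x powr t)"
  by (simp add: epow_def)

lemma epow_top [simp]: "epow top t = top"
  by (simp add: epow_def)

text \<open>The value \<open>0 powr t\<close> is 0 for every real t, t = 0 included, so no condition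
  on the exponent appears. This is convenient where exponents are controlled only almost
  everywhere.\<close>

lemma epow_zero [simp]: "epow 0 t = 0"
  by (simp add: epow_def)

lemma epow_one [simp]: "epow x 1 = x"
  by (cases x) (auto simp: epow_def)

lemma epow_one_base [simp]: "epow 1 t = 1"
  by (simp add: epow_def)

lemma epow_mono: "x \<le> y \<Longrightarrow> 0 \<le> t \<Longrightarrow> epow x t \<le> epow y t"
  by (cases x; cases y) (auto simp: epow_def top_unique intro!: ennreal_leI powr_mono2)

lemma epow_mult: "0 < t \<Longrightarrow> epow (x * y) t = epow x t * epow y t"
proof (cases x; cases y)
  fix a b assume "0 < t" "x = ennreal a" "0 \<le> a" "y = ennreal b" "0 \<le> b"
  then show ?thesis by (simp add: epow_ennreal powr_mult flip: ennreal_mult)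
next
  fix a assume "0 < t" "x = ennreal a" "0 \<le> a" "y = top"
  then show ?thesis
    by (cases "a = 0") (auto simp: epow_ennreal ennreal_mult_top)
next
  fix a assume "0 < t" "x = top" "0 \<le> a" "y = ennreal a"
  then show ?thesis
    by (cases "a = 0") (auto simp: epow_ennreal ennreal_top_mult)
qed auto

lemma epow_epow: "0 < s \<Longrightarrow> epow (epow x s) t = epow x (s * t)"
  by (cases x) (auto simp: epow_ennreal powr_powr)

lemma epow_add: "0 < s \<Longrightarrow> 0 < t \<Longrightarrow> epow x (s + t) = epow x s * epow x t"
  by (cases x) (auto simp: epow_ennreal powr_add simp flip: ennreal_mult)

lemma epow_eq_0_iff [simp]: "epow x t = 0 \<longleftrightarrow> x = 0"
  by (cases x) (auto simp: epow_ennreal)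

lemma epow_eq_top_iff [simp]: "epow x t = top \<longleftrightarrow> x = top"
  by (simp add: epow_def)

lemma epow_measurable [measurable (raw)]:
  assumes [measurable]: "f \<in> borel_measurable M" "t \<in> borel_measurable M"
  shows "(\<lambda>x. epow (f x) (t x)) \<in> borel_measurable M"
  unfolding epow_def by measurable

lemma epow_le_iff: "0 < t \<Longrightarrow> epow x t \<le> epow y t \<longleftrightarrow> x \<le> y"
proof
  assume t: "0 < t" and le: "epow x t \<le> epow y t"
  have "epow (epow x t) (1 / t) \<le> epow (epow y t) (1 / t)"
    by (rule epow_mono) (use le t in auto)
  with t show "x \<le> y" by (simp add: epow_epow)
qed (auto intro: epow_mono)

text \<open>Replacing both arguments by the larger one makes the exponents add up to 1. The bound is
  cruder than the weighted mean below, but it has no coefficients depending on \<theta>, which will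
  vary with the point.\<close>

lemma epow_young:
  assumes "0 < \<theta>" "\<theta> < 1"
  shows "epow x \<theta> * epow y (1 - \<theta>) \<le> x + y"
proof -
  let ?m = "max x y"
  have "epow x \<theta> * epow y (1 - \<theta>) \<le> epow ?m \<theta> * epow ?m (1 - \<theta>)"
    using assms by (intro mult_mono epow_mono) auto
  also have "\<dots> = ?m" using assms by (simp flip: epow_add)
  also have "\<dots> \<le> x + y" by (simp add: max_def)
  finally show ?thesis .
qed

lemma epow_weighted_mean:
  assumes t: "0 < \<theta>" "\<theta> < 1"
  shows "epow x \<theta> * epow y (1 - \<theta>) \<le> ennreal \<theta> * x + ennreal (1 - \<theta>) * y"
proof (cases "x = 0 \<or> y = 0")
  case False
  show ?thesis
  proof (cases x; cases y)
    fix a b assume "x = ennreal a" "0 \<le> a" "y = ennreal b" "0 \<le> b"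
    moreover have "a powr \<theta> * b powr (1 - \<theta>) \<le> \<theta> * a + (1 - \<theta>) * b"
      using False t calculation by (intro Youngs_inequality_0) auto
    ultimately show ?thesis using t
      by (simp add: epow_ennreal ennreal_leI flip: ennreal_mult ennreal_plus)
  qed (use t in \<open>auto simp: ennreal_mult_top\<close>)
qed auto

text \<open>Here \<theta> and 1 - \<theta> are the reciprocals of conjugate exponents, the powers
  being absorbed into \<open>f\<close> and \<open>g\<close>. If one integral is 0, the product
  vanishes almost everywhere; if both are positive and finite, they are normalised to 1 and the
  weighted mean inequality is integrated.\<close>

lemma nn_integral_Holder:
  assumes [measurable]: "f \<in> borel_measurable M" "g \<in> borel_measurable M"
    and t: "0 < \<theta>" "\<theta> < 1"
  shows "(\<integral>\<^sup>+x. epow (f x) \<theta> * epow (g x) (1 - \<theta>) \<partial>M)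
     \<le> epow (\<integral>\<^sup>+x. f x \<partial>M) \<theta> * epow (\<integral>\<^sup>+x. g x \<partial>M) (1 - \<theta>)"
    (is "?L \<le> epow ?A \<theta> * epow ?B (1 - \<theta>)")
proof (cases "?A = 0 \<or> ?B = 0")
  case True
  then have "AE x in M. f x = 0 \<or> g x = 0"
    by (auto simp: nn_integral_0_iff_AE)
  then have "?L = (\<integral>\<^sup>+x. 0 \<partial>M)"
    by (intro nn_integral_cong_AE) auto
  then show ?thesis by simp
next
  case nz: False
  show ?thesis
  proof (cases "?A = top \<or> ?B = top")
    case True
    then have "epow ?A \<theta> * epow ?B (1 - \<theta>) = top"
      using nz by (auto simp: ennreal_mult_eq_top_iff)
    then show ?thesis by simp
  next
    case False
    then obtain a b where ab: "?A = ennreal a" "0 < a" "?B = ennreal b" "0 < b"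
      using nz by (cases ?A; cases ?B) (auto simp: less_le)
    define C where "C = ennreal (a powr \<theta> * b powr (1 - \<theta>))"
    have split: "epow (f x) \<theta> * epow (g x) (1 - \<theta>)
       \<le> C * (ennreal \<theta> * (f x * ennreal (1 / a)) + ennreal (1 - \<theta>) * (g x * ennreal (1 / b)))" for x
    proof -
      have 1: "ennreal (1 / c) * ennreal c = 1" if "0 < c" for c :: real
        using that by (simp flip: ennreal_mult)
      have fx: "f x = (f x * ennreal (1 / a)) * ennreal a" "g x = (g x * ennreal (1 / b)) * ennreal b"
        using 1 ab by (simp_all add: mult.assoc)
      have "epow (f x) \<theta> * epow (g x) (1 - \<theta>)
        = C * (epow (f x * ennreal (1 / a)) \<theta> * epow (g x * ennreal (1 / b)) (1 - \<theta>))"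
        using t ab
        by (subst fx(1), subst fx(2), subst (1 2) epow_mult)
          (auto simp: C_def epow_ennreal ennreal_mult mult_ac)
      also have "\<dots> \<le> C * (ennreal \<theta> * (f x * ennreal (1 / a)) + ennreal (1 - \<theta>) * (g x * ennreal (1 / b)))"
        by (intro mult_left_mono epow_weighted_mean t) auto
      finally show ?thesis .
    qed
    have "?L \<le> (\<integral>\<^sup>+x. C * (ennreal \<theta> * (f x * ennreal (1 / a)) + ennreal (1 - \<theta>) * (g x * ennreal (1 / b))) \<partial>M)"
      by (intro nn_integral_mono split)
    also have "\<dots> = C * (ennreal \<theta> * (?A * ennreal (1 / a)) + ennreal (1 - \<theta>) * (?B * ennreal (1 / b)))"
      by (simp add: nn_integral_cmult nn_integral_add nn_integral_multc)
    also have "\<dots> = C"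
      using ab t by (simp flip: ennreal_mult ennreal_plus)
    also have "\<dots> = epow ?A \<theta> * epow ?B (1 - \<theta>)"
      using ab by (simp add: C_def epow_ennreal ennreal_mult)
    finally show ?thesis .
  qed
qed

text \<open>Hoelder's inequality for the splitting f s = (f^t s)^{1/t} s^{1 - 1/t}, raised to the
  power t. The total mass of \<open>s\<close> stays on the right, so \<open>s\<close> need not be a
  probability density.\<close>

lemma nn_integral_Jensen:
  assumes [measurable]: "f \<in> borel_measurable M" "s \<in> borel_measurable M" and t: "1 < t"
  shows "epow (\<integral>\<^sup>+x. f x * s x \<partial>M) t \<le> epow (\<integral>\<^sup>+x. s x \<partial>M) (t - 1) * (\<integral>\<^sup>+x. epow (f x) t * s x \<partial>M)"
proof -
  have "(\<integral>\<^sup>+x. f x * s x \<partial>M) = (\<integral>\<^sup>+x. epow (epow (f x) t * s x) (1 / t) * epow (s x) (1 - 1 / t) \<partial>M)"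
  proof (intro nn_integral_cong)
    fix x
    have "epow (s x) (1 / t) * epow (s x) (1 - 1 / t) = s x"
      using t by (subst epow_add[symmetric]) auto
    then show "f x * s x = epow (epow (f x) t * s x) (1 / t) * epow (s x) (1 - 1 / t)"
      using t by (simp add: epow_mult epow_epow mult.assoc)
  qed
  also have "\<dots> \<le> epow (\<integral>\<^sup>+x. epow (f x) t * s x \<partial>M) (1 / t) * epow (\<integral>\<^sup>+x. s x \<partial>M) (1 - 1 / t)"
    using t by (intro nn_integral_Holder) auto
  finally have "epow (\<integral>\<^sup>+x. f x * s x \<partial>M) t
      \<le> epow (epow (\<integral>\<^sup>+x. epow (f x) t * s x \<partial>M) (1 / t) * epow (\<integral>\<^sup>+x. s x \<partial>M) (1 - 1 / t)) t"
    using t by (intro epow_mono) auto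
  also have "\<dots> = epow (\<integral>\<^sup>+x. s x \<partial>M) (t - 1) * (\<integral>\<^sup>+x. epow (f x) t * s x \<partial>M)"
    using t by (simp add: epow_mult epow_epow right_diff_distrib mult.commute)
  finally show ?thesis .
qed

section \<open>Inequalities for series and for mixed norms\<close>

lemma suminf_Holder:
  fixes f g :: "nat \<Rightarrow> ennreal"
  assumes "0 < \<theta>" "\<theta> < 1"
  shows "(\<Sum>j. epow (f j) \<theta> * epow (g j) (1 - \<theta>)) \<le> epow (\<Sum>j. f j) \<theta> * epow (\<Sum>j. g j) (1 - \<theta>)"
  using nn_integral_Holder[of f "count_space UNIV" g \<theta>] assms
  by (simp add: nn_integral_count_space_nat)

lemma suminf_Jensen:
  fixes a c :: "nat \<Rightarrow> ennreal"
  assumes "1 \<le> t" "(\<Sum>k. c k) = 1"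
  shows "epow (\<Sum>k. a k * c k) t \<le> (\<Sum>k. epow (a k) t * c k)"
proof (cases "t = 1")
  case False
  then show ?thesis
    using nn_integral_Jensen[of a "count_space UNIV" c t] assms
    by (simp add: nn_integral_count_space_nat)
qed simp

text \<open>No duality is used: with S the pointwise l^t norm of the \<open>h j\<close>, Jensen is
  applied to h_j / S with density S. The powers (h_j / S)^t sum to at most 1 at each point, which
  returns the integral of S to the power (t - 1) + 1.\<close>

lemma suminf_Minkowski_integral:
  fixes h :: "nat \<Rightarrow> 'b \<Rightarrow> ennreal"
  assumes [measurable]: "\<And>j. h j \<in> borel_measurable M" and t: "1 \<le> t"
  shows "(\<Sum>j. epow (\<integral>\<^sup>+x. h j x \<partial>M) t) \<le> epow (\<integral>\<^sup>+x. epow (\<Sum>j. epow (h j x) t) (1 / t) \<partial>M) t"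
proof (cases "t = 1")
  case True
  then show ?thesis by (simp add: nn_integral_suminf)
next
  case False
  then have t: "1 < t" using t by simp
  define S where "S x = epow (\<Sum>j. epow (h j x) t) (1 / t)" for x
  have [measurable]: "S \<in> borel_measurable M"
    unfolding S_def by measurable
  let ?N = "\<integral>\<^sup>+x. S x \<partial>M"
  show ?thesis
  proof (cases "?N = top")
    case True
    then show ?thesis by (simp add: S_def)
  next
    case False
    then have fin: "AE x in M. S x \<noteq> top"
      using nn_integral_noteq_infinite[of S M] by simp
    have St: "epow (S x) t = (\<Sum>j. epow (h j x) t)" for x
      using t by (simp add: S_def epow_epow)
    have le: "h j x \<le> S x" for j x
    proof -
      have "epow (h j x) t \<le> epow (S x) t"
        unfolding St using sum_le_suminf[of "\<lambda>j. epow (h j x) t" "{j}"] by simp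
      then show ?thesis using t by (simp add: epow_le_iff)
    qed
    have 1: "AE x in M. h j x = (h j x / S x) * S x" for j
      using fin
    proof eventually_elim
      case (elim x)
      then show ?case
      proof (cases "S x = 0")
        case True
        then show ?thesis using le[of j x] by simp
      next
        case False
        then have "inverse (S x) * S x = 1"
          using elim by (metis divide_ennreal_def ennreal_divide_self mult.commute top.not_eq_extremum)
        then show ?thesis by (simp add: divide_ennreal_def mult.assoc)
      qed
    qed
    have 2: "AE x in M. (\<Sum>j. epow (h j x / S x) t * S x) \<le> S x"
      using fin
    proof eventually_elim
      case (elim x)
      show ?case
      proof (cases "S x = 0")
        case False
        have "(\<Sum>j. epow (h j x / S x) t) = epow (S x) t * epow (inverse (S x)) t"
          using t by (simp add: St divide_ennreal_def epow_mult)
        also have "\<dots> = epow (S x * inverse (S x)) t"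
          using t by (simp add: epow_mult)
        also have "S x * inverse (S x) = 1"
          using False elim by (metis divide_ennreal_def ennreal_divide_self top.not_eq_extremum)
        finally show ?thesis by simp
      qed simp
    qed
    have "(\<Sum>j. epow (\<integral>\<^sup>+x. h j x \<partial>M) t) = (\<Sum>j. epow (\<integral>\<^sup>+x. (h j x / S x) * S x \<partial>M) t)"
      by (intro suminf_cong arg_cong2[where f = epow] nn_integral_cong_AE 1 refl)
    also have "\<dots> \<le> (\<Sum>j. epow ?N (t - 1) * (\<integral>\<^sup>+x. epow (h j x / S x) t * S x \<partial>M))"
      using t by (intro suminf_le nn_integral_Jensen) auto
    also have "\<dots> = epow ?N (t - 1) * (\<integral>\<^sup>+x. (\<Sum>j. epow (h j x / S x) t * S x) \<partial>M)"
      by (subst nn_integral_suminf) simp_all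
    also have "\<dots> \<le> epow ?N (t - 1) * ?N"
      by (intro mult_left_mono nn_integral_mono_AE 2) auto
    also have "\<dots> = epow ?N (t - 1) * epow ?N 1" by simp
    also have "\<dots> = epow ?N t" using t by (subst epow_add[symmetric]) auto
    finally show ?thesis by (simp add: S_def)
  qed
qed

section \<open>Dyadic level sums and Marcinkiewicz interpolation\<close>

lemma int_sum_powr_le:
  fixes s :: real and y :: ennreal
  assumes s: "0 < s"
  shows "(\<integral>\<^sup>+k. ennreal (2 powr (s * real_of_int k)) * indicator {k. ennreal (2 powr real_of_int k) < y} k \<partial>count_space UNIV)
     \<le> ennreal (1 / (1 - 2 powr (- s))) * epow y s"
    (is "?L \<le> ennreal ?C * _")
proof -
  have C: "0 < ?C" using s by (simp add: powr_less_one)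
  consider "y = top" | "y = 0" | z where "y = ennreal z" "0 < z"
    by (cases y) (auto simp: less_le)
  then show ?thesis
  proof cases
    case 1
    then show ?thesis using C s by (simp add: ennreal_mult_top)
  next
    case 2
    then show ?thesis by simp
  next
    case (3 z)
    \<comment> \<open>The largest k with 2^k < z. As the inequality is strict, this is the ceiling
      minus 1 even if log_2 z is an integer. Counting down from \<open>K\<close> gives a geometric
      series of ratio 2^{-s}.\<close>
    define K where "K = \<lceil>log 2 z\<rceil> - 1"
    have iff: "ennreal (2 powr real_of_int k) < y \<longleftrightarrow> k \<le> K" for k
    proof -
      have "ennreal (2 powr real_of_int k) < y \<longleftrightarrow> real_of_int k < log 2 z"
        using 3 by (simp add: ennreal_less_iff less_log_iff)
      also have "\<dots> \<longleftrightarrow> k \<le> K"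
        unfolding K_def by linarith
      finally show ?thesis .
    qed
    have bij: "bij_betw (\<lambda>n. K - int n) UNIV {..K}"
      by (rule bij_betwI[where g = "\<lambda>k. nat (K - k)"]) auto
    have "?L = (\<integral>\<^sup>+k. ennreal (2 powr (s * real_of_int k)) * indicator {..K} k \<partial>count_space UNIV)"
      by (intro nn_integral_cong) (auto simp: iff split: split_indicator)
    also have "\<dots> = (\<integral>\<^sup>+k. ennreal (2 powr (s * real_of_int k)) \<partial>count_space {..K})"
      by (subst nn_integral_count_space_indicator) auto
    also have "\<dots> = (\<integral>\<^sup>+n. ennreal (2 powr (s * real_of_int (K - int n))) \<partial>count_space UNIV)"
      by (rule nn_integral_bij_count_space[OF bij, symmetric])
    also have "\<dots> = (\<Sum>n. ennreal (2 powr (s * real_of_int K) * (2 powr (- s)) ^ n))"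
      by (subst nn_integral_count_space_nat)
        (simp add: right_diff_distrib powr_diff powr_minus powr_powr powr_realpow[symmetric] divide_inverse power_inverse mult.commute)
    also have "\<dots> = ennreal (2 powr (s * real_of_int K) * ?C)"
    proof (rule suminf_ennreal_eq)
      show "(\<lambda>n. 2 powr (s * real_of_int K) * (2 powr (- s)) ^ n) sums (2 powr (s * real_of_int K) * ?C)"
        using s by (intro sums_mult geometric_sums) (simp add: powr_less_one)
    qed simp
    also have "\<dots> \<le> ennreal (z powr s * ?C)"
    proof (intro ennreal_leI mult_right_mono)
      have "real_of_int K \<le> log 2 z" unfolding K_def by linarith
      then have "2 powr (s * real_of_int K) \<le> 2 powr (s * log 2 z)"
        using s by simp
      also have "\<dots> = z powr s" using 3 powr_powr[of 2 "log 2 z" s] by (simp add: mult.commute)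
      finally show "2 powr (s * real_of_int K) \<le> z powr s" .
    qed (use C in simp)
    also have "\<dots> = ennreal ?C * epow y s"
      using 3 C by (simp add: epow_ennreal mult.commute flip: ennreal_mult'')
    finally show ?thesis .
  qed
qed

text \<open>One term suffices: for 0 < y < \<infinity> there is k with 2 * 2^k < y \<le> 4 * 2^k,
  and its coefficient is (4 * 2^k)^t. For y = \<infinity> all terms are present and they are
  unbounded.\<close>

lemma epow_le_int_sum:
  fixes y :: ennreal
  assumes t: "0 < t"
  shows "epow y t \<le> (\<integral>\<^sup>+k. ennreal (2 powr ((real_of_int k + 2) * t)) * indicator {k. ennreal (2 * 2 powr real_of_int k) < y} k \<partial>count_space UNIV)"
    (is "_ \<le> (\<integral>\<^sup>+k. ?f k \<partial>_)")
proof -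
  have single: "?f k \<le> (\<integral>\<^sup>+k. ?f k \<partial>count_space UNIV)" for k
    by (rule nn_integral_ge_point) auto
  consider "y = top" | "y = 0" | z where "y = ennreal z" "0 < z"
    by (cases y) (auto simp: less_le)
  then show ?thesis
  proof cases
    case 1
    have "ennreal c \<le> (\<integral>\<^sup>+k. ?f k \<partial>count_space UNIV)" if "0 < c" for c
    proof -
      define k where "k = \<lceil>log 2 c / t\<rceil>"
      have "log 2 c / t \<le> real_of_int k + 2" unfolding k_def by linarith
      then have "log 2 c \<le> (real_of_int k + 2) * t" using t by (simp add: field_simps)
      then have "c \<le> 2 powr ((real_of_int k + 2) * t)"
        using that by (simp add: log_le_iff)
      then have "ennreal c \<le> ?f k" using 1 by (simp add: ennreal_leI)
      then show ?thesis using single[of k] by (rule order_trans)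
    qed
    then have le: "ennreal c \<le> (\<integral>\<^sup>+k. ?f k \<partial>count_space UNIV)" if "0 < c" for c
      using that by blast
    have "(\<integral>\<^sup>+k. ?f k \<partial>count_space UNIV) = top"
    proof (rule ccontr)
      assume "(\<integral>\<^sup>+k. ?f k \<partial>count_space UNIV) \<noteq> top"
      then obtain r where r: "0 \<le> r" "(\<integral>\<^sup>+k. ?f k \<partial>count_space UNIV) = ennreal r"
        by (cases "\<integral>\<^sup>+k. ?f k \<partial>count_space UNIV") auto
      show False using le[of "r + 1"] r unfolding r(2) by simp
    qed
    then show ?thesis by simp
  next
    case 2
    then show ?thesis by simp
  next
    case (3 z)
    define k where "k = \<lceil>log 2 z\<rceil> - 2"
    have k: "real_of_int k + 1 < log 2 z" "log 2 z \<le> real_of_int k + 2"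
      unfolding k_def by linarith+
    have "2 * 2 powr real_of_int k < z"
      using k(1) 3 by (simp add: less_log_iff powr_add)
    moreover have "z powr t \<le> 2 powr ((real_of_int k + 2) * t)"
    proof -
      have "z \<le> 2 powr (real_of_int k + 2)"
        using k(2) 3 by (simp add: log_le_iff)
      then have "z powr t \<le> (2 powr (real_of_int k + 2)) powr t"
        using 3 t by (intro powr_mono2) auto
      then show ?thesis by (simp add: powr_powr)
    qed
    ultimately have "epow y t \<le> ?f k"
      using 3 by (simp add: epow_ennreal ennreal_leI ennreal_less_iff)
    then show ?thesis using single[of k] by (rule order_trans)
  qed
qed

text \<open>The hypothesis is what a weak (1,1) bound together with a bound on L^\<infinity> yields
  for an operator after \<open>g\<close> has been cut at height l. The two dyadic lemmas stand in
  for the layer cake formula: the first bounds F^t by level sets at heights 2 * 2^k, the second sums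
  the weak bounds. Since 2^{(k+2)t} / 2^k = 4^t 2^{(t-1)k}, the sum over 2^k < g has order g^{t-1},
  and t > 1 makes it converge.\<close>

lemma Marcinkiewicz_weak_infty:
  fixes F g :: "'b \<Rightarrow> ennreal"
  assumes [measurable]: "F \<in> borel_measurable M" "g \<in> borel_measurable M"
    and t: "1 < t"
    and weak: "\<And>l. 0 < l \<Longrightarrow> ennreal l * emeasure M {x \<in> space M. ennreal (2 * l) < F x}
       \<le> A * (\<integral>\<^sup>+x. g x * indicator {x. ennreal l < g x} x \<partial>M)"
  shows "(\<integral>\<^sup>+x. epow (F x) t \<partial>M) \<le> ennreal (4 powr t / (1 - 2 powr (1 - t))) * A * (\<integral>\<^sup>+x. epow (g x) t \<partial>M)"
proof -
  let ?c = "\<lambda>k. ennreal (2 powr real_of_int k)"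
  have "(\<integral>\<^sup>+x. epow (F x) t \<partial>M)
     \<le> (\<integral>\<^sup>+x. \<integral>\<^sup>+k. ennreal (2 powr ((real_of_int k + 2) * t)) * indicator {k. ennreal (2 * 2 powr real_of_int k) < F x} k \<partial>count_space UNIV \<partial>M)"
    using t by (intro nn_integral_mono epow_le_int_sum) auto
  also have "\<dots> = (\<integral>\<^sup>+k. \<integral>\<^sup>+x. ennreal (2 powr ((real_of_int k + 2) * t)) * indicator {x \<in> space M. ennreal (2 * 2 powr real_of_int k) < F x} x \<partial>M \<partial>count_space UNIV)"
    by (subst nn_integral_count_space_nn_integral[symmetric])
      (auto intro!: nn_integral_cong split: split_indicator)
  also have "\<dots> = (\<integral>\<^sup>+k. ennreal (2 powr ((real_of_int k + 2) * t) / 2 powr real_of_int k) * (?c k * emeasure M {x \<in> space M. ennreal (2 * 2 powr real_of_int k) < F x}) \<partial>count_space UNIV)"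
    by (intro nn_integral_cong) (simp add: nn_integral_cmult_indicator mult.assoc[symmetric] flip: ennreal_mult)
  also have "\<dots> \<le> (\<integral>\<^sup>+k. ennreal (2 powr ((real_of_int k + 2) * t) / 2 powr real_of_int k) * (A * (\<integral>\<^sup>+x. g x * indicator {x. ?c k < g x} x \<partial>M)) \<partial>count_space UNIV)"
    by (intro nn_integral_mono mult_left_mono weak) auto
  also have "\<dots> = (\<integral>\<^sup>+k. \<integral>\<^sup>+x. ennreal (4 powr t) * A * (g x * (ennreal (2 powr ((t - 1) * real_of_int k)) * indicator {k. ?c k < g x} k)) \<partial>M \<partial>count_space UNIV)"
  proof (intro nn_integral_cong)
    fix k :: int
    have e: "2 powr ((real_of_int k + 2) * t) / 2 powr real_of_int k = 4 powr t * 2 powr ((t - 1) * real_of_int k)"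
      using powr_powr[of 2 2 t]
      by (simp add: powr_diff[symmetric] powr_add[symmetric] algebra_simps)
    show "ennreal (2 powr ((real_of_int k + 2) * t) / 2 powr real_of_int k) * (A * (\<integral>\<^sup>+x. g x * indicator {x. ?c k < g x} x \<partial>M))
      = (\<integral>\<^sup>+x. ennreal (4 powr t) * A * (g x * (ennreal (2 powr ((t - 1) * real_of_int k)) * indicator {k. ?c k < g x} k)) \<partial>M)"
      unfolding e
      by (subst nn_integral_cmult[symmetric], measurable, subst nn_integral_cmult[symmetric], measurable)
        (auto intro!: nn_integral_cong simp: ennreal_mult mult_ac split: split_indicator)
  qed
  also have "\<dots> = (\<integral>\<^sup>+x. \<integral>\<^sup>+k. ennreal (4 powr t) * A * (g x * (ennreal (2 powr ((t - 1) * real_of_int k)) * indicator {k. ?c k < g x} k)) \<partial>count_space UNIV \<partial>M)"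
    by (rule nn_integral_count_space_nn_integral[symmetric]) auto
  also have "\<dots> = (\<integral>\<^sup>+x. ennreal (4 powr t) * A * (g x * (\<integral>\<^sup>+k. ennreal (2 powr ((t - 1) * real_of_int k)) * indicator {k. ?c k < g x} k \<partial>count_space UNIV)) \<partial>M)"
    by (simp add: nn_integral_cmult)
  also have "\<dots> \<le> (\<integral>\<^sup>+x. ennreal (4 powr t) * A * (g x * (ennreal (1 / (1 - 2 powr (1 - t))) * epow (g x) (t - 1))) \<partial>M)"
    using int_sum_powr_le[of "t - 1"] t
    by (intro nn_integral_mono mult_left_mono) auto
  also have "\<dots> = (\<integral>\<^sup>+x. (ennreal (4 powr t) * ennreal (1 / (1 - 2 powr (1 - t))) * A) * epow (g x) t \<partial>M)"
  proof (intro nn_integral_cong)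
    fix x
    have "epow (g x) t = g x * epow (g x) (t - 1)"
      using epow_add[of 1 "t - 1" "g x"] t by simp
    then show "ennreal (4 powr t) * A * (g x * (ennreal (1 / (1 - 2 powr (1 - t))) * epow (g x) (t - 1)))
       = (ennreal (4 powr t) * ennreal (1 / (1 - 2 powr (1 - t))) * A) * epow (g x) t"
      by (simp add: mult_ac)
  qed
  also have "\<dots> = ennreal (4 powr t / (1 - 2 powr (1 - t))) * A * (\<integral>\<^sup>+x. epow (g x) t \<partial>M)"
    by (simp add: nn_integral_cmult flip: ennreal_mult')
  finally show ?thesis .
qed

section \<open>Maximal operators on doubling measures\<close>

text \<open>Choosing one countable dense set once and for all makes \<open>qballs\<close>, and with
  it \<open>mx\<close>, independent of any further parameter.\<close>

definition dense_pts :: "'a::euclidean_space set" where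
  "dense_pts = (SOME D. countable D \<and> (\<forall>X. open X \<longrightarrow> X \<noteq> {} \<longrightarrow> (\<exists>d\<in>D. d \<in> X)))"

lemma dense_pts: "countable (dense_pts :: 'a::euclidean_space set)"
  "open X \<Longrightarrow> X \<noteq> {} \<Longrightarrow> \<exists>d\<in>dense_pts. d \<in> (X :: 'a set)"
proof -
  have "countable (dense_pts :: 'a set) \<and> (\<forall>X::'a set. open X \<longrightarrow> X \<noteq> {} \<longrightarrow> (\<exists>d\<in>dense_pts. d \<in> X))"
    unfolding dense_pts_def by (rule someI_ex) (rule countable_dense_exists)
  then show "countable (dense_pts :: 'a set)"
    "open X \<Longrightarrow> X \<noteq> {} \<Longrightarrow> \<exists>d\<in>dense_pts. d \<in> (X :: 'a set)" by auto
qed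

text \<open>Restricting to countably many balls makes the maximal functions trivially measurable.\<close>
definition qballs :: "'a::euclidean_space set set" where
  "qballs = {ball a r | a r. a \<in> dense_pts \<and> r \<in> \<rat> \<and> 0 < r}"

lemma countable_qballs: "countable (qballs :: 'a::euclidean_space set set)"
proof -
  have "qballs = (\<lambda>(a, r). ball a r) ` (dense_pts \<times> {r \<in> \<rat>. 0 < r} :: ('a \<times> real) set)"
    unfolding qballs_def by auto
  moreover have "countable (dense_pts \<times> {r \<in> \<rat>. 0 < r} :: ('a \<times> real) set)"
    by (intro countable_SIGMA dense_pts countable_subset[OF _ countable_rat]) auto
  ultimately show ?thesis by (metis countable_image)
qed

lemma qballs_sets: "B \<in> qballs \<Longrightarrow> B \<in> sets lebesgue"
  unfolding qballs_def by auto

text \<open>Moving the centre by less than d costs at most d in the radius, so any rational radius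
  between 2 d and 3 d works. The bound 3 d keeps the volumes comparable when cubes are replaced by
  balls of the countable family.\<close>

lemma qball_containing_cball:
  fixes x :: "'a::euclidean_space"
  assumes "0 < d"
  obtains a r where "a \<in> dense_pts" "r \<in> \<rat>" "0 < r" "cball x d \<subseteq> ball a r" "r < 3 * d"
proof -
  obtain a where a: "a \<in> dense_pts" "a \<in> ball x d"
    using dense_pts(2)[of "ball x d"] assms by auto
  obtain r where r: "r \<in> \<rat>" "2 * d < r" "r < 3 * d"
    using Rats_dense_in_real[of "2 * d" "3 * d"] assms by auto
  have "cball x d \<subseteq> ball a r"
  proof
    fix y assume "y \<in> cball x d"
    then have "dist a y < r"
      using a r dist_triangle[of a y x] by (simp add: dist_commute)
    then show "y \<in> ball a r" by simp
  qed
  then show thesis using that a r assms by auto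
qed

text \<open>The uncentred fractional maximal operator of \<nu>; b = 0 is the Hardy-Littlewood case.
  Normalising by powers of \<nu>(B) instead of powers of the radius lets the operator be compared
  with that of V d\<nu>, with the same b.\<close>

definition mx :: "'a::euclidean_space measure \<Rightarrow> real \<Rightarrow> ('a \<Rightarrow> ennreal) \<Rightarrow> 'a \<Rightarrow> ennreal" where
  "mx \<nu> b g x = (SUP B \<in> {B \<in> qballs. x \<in> B}. ennreal (measure \<nu> B powr (b - 1)) * (\<integral>\<^sup>+y. g y * indicator B y \<partial>\<nu>))"

lemma mx_ge: "B \<in> qballs \<Longrightarrow> x \<in> B \<Longrightarrow>
   ennreal (measure \<nu> B powr (b - 1)) * (\<integral>\<^sup>+y. g y * indicator B y \<partial>\<nu>) \<le> mx \<nu> b g x"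
  unfolding mx_def by (rule SUP_upper) auto

lemma mx_le:
  "(\<And>B. B \<in> qballs \<Longrightarrow> x \<in> B \<Longrightarrow> ennreal (measure \<nu> B powr (b - 1)) * (\<integral>\<^sup>+y. g y * indicator B y \<partial>\<nu>) \<le> z)
   \<Longrightarrow> mx \<nu> b g x \<le> z"
  unfolding mx_def by (rule SUP_least) auto

lemma mx_measurable [measurable]:
  "mx \<nu> b g \<in> borel_measurable lebesgue"
proof -
  have "mx \<nu> b g x = (SUP B \<in> qballs. (ennreal (measure \<nu> B powr (b - 1)) * (\<integral>\<^sup>+y. g y * indicator B y \<partial>\<nu>)) * indicator B x)"
    (is "_ = (SUP B \<in> qballs. ?f B * indicator B x)") for x
  proof (rule antisym)
    show "mx \<nu> b g x \<le> (SUP B \<in> qballs. ?f B * indicator B x)"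
    proof (rule mx_le)
      fix B :: "'a set" assume "B \<in> qballs" "x \<in> B"
      then show "?f B \<le> (SUP B \<in> qballs. ?f B * indicator B x)"
        by (intro SUP_upper2[of B]) auto
    qed
    show "(SUP B \<in> qballs. ?f B * indicator B x) \<le> mx \<nu> b g x"
      by (rule SUP_least) (auto split: split_indicator intro: mx_ge)
  qed
  then have eq: "mx \<nu> b g = (\<lambda>x. SUP B \<in> qballs. ?f B * indicator B x)" by auto
  show ?thesis unfolding eq
    using countable_qballs qballs_sets
    by (intro borel_measurable_SUP borel_measurable_times_ennreal borel_measurable_indicator) auto
qed

lemma mx_cong_AE: "AE y in \<nu>. g y = h y \<Longrightarrow> mx \<nu> b g x = mx \<nu> b h x"
  unfolding mx_def by (intro SUP_cong refl arg_cong2[where f = "(*)"] nn_integral_cong_AE) auto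

lemma mx_cmult:
  assumes [measurable]: "g \<in> borel_measurable \<nu>" and s: "sets \<nu> = sets lebesgue"
  shows "mx \<nu> b (\<lambda>y. c * g y) x = c * mx \<nu> b g x"
proof -
  have [measurable]: "B \<in> qballs \<Longrightarrow> B \<in> sets \<nu>" for B
    by (simp add: s qballs_sets)
  show ?thesis
    unfolding mx_def SUP_mult_left_ennreal
    by (intro SUP_cong refl) (simp add: mult.assoc nn_integral_cmult mult.left_commute)
qed

lemma mx_suminf_le:
  assumes [measurable]: "\<And>k. g k \<in> borel_measurable \<nu>" and s: "sets \<nu> = sets lebesgue"
  shows "mx \<nu> b (\<lambda>y. \<Sum>k. g k y) x \<le> (\<Sum>k. mx \<nu> b (g k) x)"
proof (rule mx_le)
  fix B :: "'a set" assume B: "B \<in> qballs" "x \<in> B"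
  then have [measurable]: "B \<in> sets \<nu>"
    by (simp add: s qballs_sets)
  have "ennreal (measure \<nu> B powr (b - 1)) * (\<integral>\<^sup>+y. (\<Sum>k. g k y) * indicator B y \<partial>\<nu>)
    = (\<Sum>k. ennreal (measure \<nu> B powr (b - 1)) * (\<integral>\<^sup>+y. g k y * indicator B y \<partial>\<nu>))"
    by (simp add: nn_integral_suminf flip: ennreal_suminf_multc)
  also have "\<dots> \<le> (\<Sum>k. mx \<nu> b (g k) x)"
    by (intro suminf_le mx_ge B) auto
  finally show "ennreal (measure \<nu> B powr (b - 1)) * (\<integral>\<^sup>+y. (\<Sum>k. g k y) * indicator B y \<partial>\<nu>) \<le> (\<Sum>k. mx \<nu> b (g k) x)" .
qed

text \<open>The factor 5 is the enlargement in the Vitali covering lemma. Only members of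
  \<open>qballs\<close> are tested, and 5 r is rational whenever r is.\<close>

definition doubling :: "real \<Rightarrow> 'a::euclidean_space measure \<Rightarrow> bool" where
  "doubling D \<nu> \<longleftrightarrow> 0 < D \<and> sets \<nu> = sets lebesgue \<and>
     (\<forall>a\<in>dense_pts. \<forall>r\<in>\<rat>. 0 < r \<longrightarrow> 0 < emeasure \<nu> (ball a r) \<and> emeasure \<nu> (ball a r) < top \<and>
        emeasure \<nu> (ball a (5 * r)) \<le> ennreal D * emeasure \<nu> (ball a r))"

lemma doubling_sets: "doubling D \<nu> \<Longrightarrow> sets \<nu> = sets lebesgue"
  by (simp add: doubling_def)

lemma doubling_space: "doubling D \<nu> \<Longrightarrow> space \<nu> = UNIV"
  using sets_eq_imp_space_eq[of \<nu> lebesgue] by (simp add: doubling_def)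

lemma doubling_borel: "doubling D \<nu> \<Longrightarrow> borel_measurable \<nu> = borel_measurable lebesgue"
  by (intro measurable_cong_sets doubling_sets refl)

lemma doubling_qball:
  assumes "doubling D \<nu>" "B \<in> qballs"
  shows "emeasure \<nu> B = ennreal (measure \<nu> B)" "0 < measure \<nu> B" "B \<in> sets \<nu>"
proof -
  have *: "0 < emeasure \<nu> B" "emeasure \<nu> B < top"
    using assms by (auto simp: doubling_def qballs_def)
  then show "emeasure \<nu> B = ennreal (measure \<nu> B)"
    by (intro emeasure_eq_ennreal_measure) auto
  with * show "0 < measure \<nu> B" by simp
  show "B \<in> sets \<nu>" using assms qballs_sets doubling_sets by blast
qed

text \<open>The level set is covered by countably many balls whose averages exceed l. Every finite
  subfamily has a disjoint part whose fivefold enlargements cover it; doubling and disjointness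
  bound its union, and continuity from below passes to the whole family.\<close>

lemma mx_weak_type:
  assumes d: "doubling D \<nu>" and [measurable]: "g \<in> borel_measurable lebesgue" and l: "0 < l"
  shows "ennreal l * emeasure \<nu> {x. ennreal l < mx \<nu> 0 g x} \<le> ennreal D * (\<integral>\<^sup>+x. g x \<partial>\<nu>)"
proof -
  have [measurable]: "g \<in> borel_measurable \<nu>" by (simp add: doubling_borel[OF d])
  have ball_meas [measurable]: "ball a r \<in> sets \<nu>" for a r
    by (simp add: doubling_sets[OF d])
  have D: "0 < D" using d by (simp add: doubling_def)
  define K where "K = {(a, r). a \<in> dense_pts \<and> r \<in> \<rat> \<and> 0 < r \<and>
     ennreal l * emeasure \<nu> (ball a r) < (\<integral>\<^sup>+y. g y * indicator (ball a r) y \<partial>\<nu>)}"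
  have "countable K"
    by (rule countable_subset[of _ "dense_pts \<times> \<rat>"])
      (auto simp: K_def intro: countable_SIGMA dense_pts countable_rat)
  have E: "{x. ennreal l < mx \<nu> 0 g x} \<subseteq> (\<Union>(a, r)\<in>K. ball a r)"
  proof
    fix x assume "x \<in> {x. ennreal l < mx \<nu> 0 g x}"
    then obtain B where B: "B \<in> qballs" "x \<in> B"
       "ennreal l < ennreal (measure \<nu> B powr - 1) * (\<integral>\<^sup>+y. g y * indicator B y \<partial>\<nu>)"
      unfolding mx_def by (auto simp: less_SUP_iff)
    note m = doubling_qball[OF d B(1)]
    have "ennreal l * ennreal (measure \<nu> B) < ennreal (measure \<nu> B powr - 1) * (\<integral>\<^sup>+y. g y * indicator B y \<partial>\<nu>) * ennreal (measure \<nu> B)"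
      using B(3) m(2) by (intro ennreal_mult_strict_right_mono) auto
    also have "\<dots> = ennreal (measure \<nu> B powr - 1 * measure \<nu> B) * (\<integral>\<^sup>+y. g y * indicator B y \<partial>\<nu>)"
      by (subst ennreal_mult) (simp_all only: mult_ac powr_ge_zero measure_nonneg)
    also have "measure \<nu> B powr - 1 * measure \<nu> B = 1"
      using m(2) by (simp add: powr_minus)
    finally have "ennreal l * emeasure \<nu> B < (\<integral>\<^sup>+y. g y * indicator B y \<partial>\<nu>)"
      using m(1) by simp
    then show "x \<in> (\<Union>(a, r)\<in>K. ball a r)"
      using B unfolding K_def qballs_def by auto blast
  qed
  \<comment> \<open>Finiteness supplies the upper bound on the radii that the covering lemma asks
    for, and keeps all sums finite.\<close>
  have fin: "ennreal l * emeasure \<nu> (\<Union>(a, r)\<in>F. ball a r) \<le> ennreal D * (\<integral>\<^sup>+x. g x \<partial>\<nu>)"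
    if F: "finite F" "F \<subseteq> K" for F
  proof -
    have r: "0 < snd i \<and> snd i \<le> Max (snd ` F)" if "i \<in> F" for i
      using that F by (auto simp: K_def)
    have S: "(\<Union>(a, r)\<in>F. ball a r) \<subseteq> (\<Union>i\<in>F. ball (fst i) (snd i))"
      by (simp add: case_prod_beta)
    obtain C where C: "countable C" "C \<subseteq> F"
      "pairwise (\<lambda>i j. disjnt (ball (fst i) (snd i)) (ball (fst j) (snd j))) C"
      "(\<Union>(a, r)\<in>F. ball a r) \<subseteq> (\<Union>i\<in>C. ball (fst i) (5 * snd i))"
      by (rule Vitali_covering_lemma_balls[OF S r])
    have "finite C" using C F finite_subset by blast
    have "ennreal l * emeasure \<nu> (\<Union>(a, r)\<in>F. ball a r) \<le> ennreal l * (\<Sum>i\<in>C. emeasure \<nu> (ball (fst i) (5 * snd i)))"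
      using C \<open>finite C\<close>
      by (intro mult_left_mono order_trans[OF emeasure_mono[OF C(4)]] emeasure_subadditive_finite) auto
    also have "\<dots> \<le> ennreal l * (\<Sum>i\<in>C. ennreal D * emeasure \<nu> (ball (fst i) (snd i)))"
      using d C F by (intro mult_left_mono sum_mono) (auto simp: doubling_def K_def)
    also have "\<dots> = ennreal D * (\<Sum>i\<in>C. ennreal l * emeasure \<nu> (ball (fst i) (snd i)))"
      by (simp add: sum_distrib_left mult.left_commute)
    also have "\<dots> \<le> ennreal D * (\<Sum>i\<in>C. \<integral>\<^sup>+y. g y * indicator (ball (fst i) (snd i)) y \<partial>\<nu>)"
      using C F by (intro mult_left_mono sum_mono) (auto simp: K_def less_imp_le)
    also have "\<dots> = ennreal D * (\<integral>\<^sup>+y. (\<Sum>i\<in>C. g y * indicator (ball (fst i) (snd i)) y) \<partial>\<nu>)"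
      by (subst nn_integral_sum) auto
    also have "\<dots> \<le> ennreal D * (\<integral>\<^sup>+y. g y \<partial>\<nu>)"
    proof (intro mult_left_mono nn_integral_mono)
      fix y
      have "disjoint_family_on (\<lambda>i. ball (fst i) (snd i)) C"
        using C(3) unfolding disjoint_family_on_def pairwise_def disjnt_def by blast
      then have "(\<Sum>i\<in>C. indicator (ball (fst i) (snd i)) y) = (indicator (\<Union>i\<in>C. ball (fst i) (snd i)) y :: ennreal)"
        using \<open>finite C\<close> by (simp add: indicator_UN_disjoint)
      also have "\<dots> \<le> 1" by (simp add: indicator_def)
      finally have "g y * (\<Sum>i\<in>C. indicator (ball (fst i) (snd i)) y) \<le> g y * 1"
        by (rule mult_left_mono) simp
      then show "(\<Sum>i\<in>C. g y * indicator (ball (fst i) (snd i)) y) \<le> g y"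
        by (simp add: sum_distrib_left)
    qed simp
    finally show ?thesis .
  qed
  show ?thesis
  proof (cases "K = {}")
    case True
    then show ?thesis using E by simp
  next
    case False
    define U where "U n = (\<Union>(a, r)\<in>from_nat_into K ` {..<n}. ball a r)" for n
    have U: "U n \<in> sets \<nu>" "incseq U" for n
      unfolding U_def incseq_def by (auto simp: case_prod_beta) (meson lessThan_iff less_le_trans)
    have "(\<Union>(a, r)\<in>K. ball a r) \<subseteq> (\<Union>n. U n)"
    proof
      fix x assume "x \<in> (\<Union>(a, r)\<in>K. ball a r)"
      then obtain i where i: "i \<in> K" "x \<in> ball (fst i) (snd i)"
        by (auto simp: case_prod_beta)
      obtain n where "i = from_nat_into K n"
        using i(1) range_from_nat_into[OF False \<open>countable K\<close>] by blast
      then have "x \<in> U (Suc n)"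
        unfolding U_def using i(2) by (auto simp: case_prod_beta)
      then show "x \<in> (\<Union>n. U n)" by blast
    qed
    then have "emeasure \<nu> {x. ennreal l < mx \<nu> 0 g x} \<le> emeasure \<nu> (\<Union>n. U n)"
      using E U(1) by (intro emeasure_mono) auto
    also have "\<dots> = (SUP n. emeasure \<nu> (U n))"
      using U by (intro SUP_emeasure_incseq[symmetric]) auto
    finally have "ennreal l * emeasure \<nu> {x. ennreal l < mx \<nu> 0 g x} \<le> (SUP n. ennreal l * emeasure \<nu> (U n))"
      by (simp add: mult_left_mono flip: SUP_mult_left_ennreal)
    also have "\<dots> \<le> ennreal D * (\<integral>\<^sup>+x. g x \<partial>\<nu>)"
      unfolding U_def using from_nat_into[OF False]
      by (intro SUP_least fin) auto
    finally show ?thesis .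
  qed
qed

text \<open>Named because the A_1 constants built by iteration are expressed through it; they see
  the measure only through \<open>D\<close>.\<close>

definition strong_const :: "real \<Rightarrow> real \<Rightarrow> real" where
  "strong_const D t = 4 powr t / (1 - 2 powr (1 - t)) * D"

lemma strong_const_pos: "0 < D \<Longrightarrow> 1 < t \<Longrightarrow> 0 < strong_const D t"
  unfolding strong_const_def by (intro mult_pos_pos divide_pos_pos) (auto simp: powr_less_one)

text \<open>Cutting at height l gives g \<le> g 1_{g > l} + l, and averages of the constant l are l.
  Hence M g > 2 l forces M(g 1_{g > l}) > l, to which the weak type bound applies.\<close>

lemma mx_strong_type:
  assumes d: "doubling D \<nu>" and g [measurable]: "g \<in> borel_measurable lebesgue" and t: "1 < t"
  shows "(\<integral>\<^sup>+x. epow (mx \<nu> 0 g x) t \<partial>\<nu>) \<le> ennreal (strong_const D t) * (\<integral>\<^sup>+x. epow (g x) t \<partial>\<nu>)"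
proof -
  have D: "0 < D" using d by (simp add: doubling_def)
  note bm = doubling_borel[OF d]
  have "(\<integral>\<^sup>+x. epow (mx \<nu> 0 g x) t \<partial>\<nu>) \<le> ennreal (4 powr t / (1 - 2 powr (1 - t))) * ennreal D * (\<integral>\<^sup>+x. epow (g x) t \<partial>\<nu>)"
  proof (rule Marcinkiewicz_weak_infty[OF _ _ t])
    show "mx \<nu> 0 g \<in> borel_measurable \<nu>" "g \<in> borel_measurable \<nu>"
      unfolding bm by auto
    fix l :: real assume l: "0 < l"
    let ?h = "\<lambda>x. g x * indicator {x. ennreal l < g x} x"
    have h [measurable]: "?h \<in> borel_measurable lebesgue" by measurable
    have le: "mx \<nu> 0 g x \<le> mx \<nu> 0 ?h x + ennreal l" for x
    proof (rule mx_le)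
      fix B :: "'a set" assume B: "B \<in> qballs" "x \<in> B"
      note m = doubling_qball[OF d B(1)]
      have [measurable]: "B \<in> sets \<nu>" by fact
      have [measurable]: "?h \<in> borel_measurable \<nu>" using h by (simp add: bm)
      have "(\<integral>\<^sup>+y. g y * indicator B y \<partial>\<nu>) \<le> (\<integral>\<^sup>+y. ?h y * indicator B y + ennreal l * indicator B y \<partial>\<nu>)"
        by (intro nn_integral_mono) (auto split: split_indicator)
      also have "\<dots> = (\<integral>\<^sup>+y. ?h y * indicator B y \<partial>\<nu>) + ennreal l * ennreal (measure \<nu> B)"
        by (subst nn_integral_add) (auto simp: nn_integral_cmult_indicator m(1))
      finally have "ennreal (measure \<nu> B powr (0 - 1)) * (\<integral>\<^sup>+y. g y * indicator B y \<partial>\<nu>)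
         \<le> ennreal (measure \<nu> B powr (0 - 1)) * ((\<integral>\<^sup>+y. ?h y * indicator B y \<partial>\<nu>) + ennreal l * ennreal (measure \<nu> B))"
        by (intro mult_left_mono) auto
      also have "\<dots> = ennreal (measure \<nu> B powr (0 - 1)) * (\<integral>\<^sup>+y. ?h y * indicator B y \<partial>\<nu>)
          + ennreal (measure \<nu> B powr (0 - 1) * (l * measure \<nu> B))"
        using l
        by (subst ennreal_mult) (simp_all only: distrib_left ennreal_mult measure_nonneg less_imp_le powr_ge_zero mult_nonneg_nonneg)
      also have "measure \<nu> B powr (0 - 1) * (l * measure \<nu> B) = l"
        using m(2) by (simp add: powr_minus)
      also have "ennreal (measure \<nu> B powr (0 - 1)) * (\<integral>\<^sup>+y. ?h y * indicator B y \<partial>\<nu>) + ennreal l \<le> mx \<nu> 0 ?h x + ennreal l"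
        by (intro add_right_mono mx_ge B)
      finally show "ennreal (measure \<nu> B powr (0 - 1)) * (\<integral>\<^sup>+y. g y * indicator B y \<partial>\<nu>) \<le> mx \<nu> 0 ?h x + ennreal l" .
    qed
    have "{x \<in> space \<nu>. ennreal (2 * l) < mx \<nu> 0 g x} \<subseteq> {x. ennreal l < mx \<nu> 0 ?h x}"
    proof clarify
      fix x assume "ennreal (2 * l) < mx \<nu> 0 g x"
      then have "ennreal l + ennreal l < mx \<nu> 0 ?h x + ennreal l"
        using le[of x] l by (simp flip: ennreal_plus)
      then show "ennreal l < mx \<nu> 0 ?h x"
        by (meson add_right_mono linorder_not_less)
    qed
    moreover have "{x. ennreal l < mx \<nu> 0 ?h x} \<in> sets \<nu>"
      unfolding doubling_sets[OF d] by (rule borel_measurable_less[of "\<lambda>_. ennreal l" lebesgue, simplified]) auto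
    ultimately have "ennreal l * emeasure \<nu> {x \<in> space \<nu>. ennreal (2 * l) < mx \<nu> 0 g x} \<le> ennreal l * emeasure \<nu> {x. ennreal l < mx \<nu> 0 ?h x}"
      by (intro mult_left_mono emeasure_mono) auto
    also have "\<dots> \<le> ennreal D * (\<integral>\<^sup>+x. ?h x \<partial>\<nu>)"
      by (rule mx_weak_type[OF d h l])
    finally show "ennreal l * emeasure \<nu> {x \<in> space \<nu>. ennreal (2 * l) < mx \<nu> 0 g x} \<le> ennreal D * (\<integral>\<^sup>+x. ?h x \<partial>\<nu>)" .
  qed
  also have "ennreal (4 powr t / (1 - 2 powr (1 - t))) * ennreal D = ennreal (strong_const D t)"
    unfolding strong_const_def using D by (simp flip: ennreal_mult'')
  finally show ?thesis .
qed

section \<open>Muckenhoupt weights and the Rubio de Francia iteration\<close>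

lemma qballsI: "a \<in> dense_pts \<Longrightarrow> r \<in> \<rat> \<Longrightarrow> 0 < r \<Longrightarrow> ball a r \<in> qballs"
  unfolding qballs_def by blast

text \<open>The majorant is G = \<Sum> 2^{-k} T^k g with T = M / C. Half of it is a convex
  combination of the iterates, with weights 2^{-k-1}, so Jensen at each point (exponents at least 1)
  keeps its modular at most 1. Applying M shifts the series by one index: M G \<le> 2 C \<Sum>
  2^{-k-1} T^{k+1} g \<le> 2 C G.\<close>

lemma Rubio_de_Francia:
  fixes \<nu> \<kappa> :: "'a::euclidean_space measure" and w g :: "'a \<Rightarrow> ennreal" and p :: "'a \<Rightarrow> real"
  assumes s: "sets \<nu> = sets lebesgue" and s': "sets \<kappa> = sets lebesgue"
    and w: "w \<in> borel_measurable lebesgue" and p: "p \<in> borel_measurable lebesgue"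
    and p1: "AE x in \<kappa>. 1 \<le> p x" and C: "0 < C"
    and bound: "\<And>h. h \<in> borel_measurable lebesgue \<Longrightarrow> (\<integral>\<^sup>+x. epow (h x * w x) (p x) \<partial>\<kappa>) \<le> 1 \<Longrightarrow>
       (\<integral>\<^sup>+x. epow (mx \<nu> 0 h x * ennreal (1 / C) * w x) (p x) \<partial>\<kappa>) \<le> 1"
    and g: "g \<in> borel_measurable lebesgue" "(\<integral>\<^sup>+x. epow (g x * w x) (p x) \<partial>\<kappa>) \<le> 1"
  shows "\<exists>G\<in>borel_measurable lebesgue. (\<forall>x. g x \<le> G x) \<and>
     (\<integral>\<^sup>+x. epow (G x * ennreal (1 / 2) * w x) (p x) \<partial>\<kappa>) \<le> 1 \<and>
     (\<forall>x. mx \<nu> 0 G x \<le> ennreal (2 * C) * G x)"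
proof -
  have bm: "borel_measurable \<nu> = borel_measurable lebesgue" "borel_measurable \<kappa> = borel_measurable lebesgue"
    using s s' by (auto intro!: measurable_cong_sets)
  define T where "T h = (\<lambda>x. mx \<nu> 0 h x * ennreal (1 / C))" for h
  define it where "it k = (T ^^ k) g" for k
  have it_Suc: "it (Suc k) = T (it k)" for k by (simp add: it_def)
  have it: "it k \<in> borel_measurable lebesgue \<and> (\<integral>\<^sup>+x. epow (it k x * w x) (p x) \<partial>\<kappa>) \<le> 1" for k
  proof (induction k)
    case 0
    then show ?case using g by (simp add: it_def)
  next
    case (Suc k)
    then show ?case using bound[of "it k"] by (auto simp: it_Suc T_def)
  qed
  have itm [measurable]: "it k \<in> borel_measurable lebesgue" for k using it by simp
  have itm' [measurable]: "it k \<in> borel_measurable \<nu>" for k using it by (simp add: bm)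
  have itm'' [measurable]: "it k \<in> borel_measurable \<kappa>" for k using it by (simp add: bm)
  have [measurable]: "w \<in> borel_measurable \<kappa>" "p \<in> borel_measurable \<kappa>" using w p by (simp_all add: bm)
  define G where "G x = (\<Sum>k. it k x * ennreal ((1 / 2) ^ k))" for x
  have half: "ennreal ((1 / 2) ^ k) * ennreal (1 / 2) = ennreal ((1 / 2) ^ Suc k)" for k
    by (subst ennreal_mult[symmetric]) (simp_all add: mult.commute)
  have "(\<Sum>k. ennreal ((1 / 2) ^ Suc k)) = ennreal 1"
    by (rule suminf_ennreal_eq[OF _ power_half_series]) simp
  then have sum1: "(\<Sum>k. ennreal ((1 / 2) ^ Suc k)) = 1"
    by (simp only: ennreal_1)
  show ?thesis
  proof (intro bexI[of _ G] conjI allI)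
    show "G \<in> borel_measurable lebesgue" unfolding G_def by measurable
    show "g x \<le> G x" for x
      using sum_le_suminf[of "\<lambda>k. it k x * ennreal ((1 / 2) ^ k)" "{0}"] by (simp add: G_def it_def)
    have "(\<integral>\<^sup>+x. epow (G x * ennreal (1 / 2) * w x) (p x) \<partial>\<kappa>)
       \<le> (\<integral>\<^sup>+x. (\<Sum>k. epow (it k x * w x) (p x) * ennreal ((1 / 2) ^ Suc k)) \<partial>\<kappa>)"
    proof (rule nn_integral_mono_AE, use p1 in eventually_elim)
      fix x assume "1 \<le> p x"
      have "G x * ennreal (1 / 2) * w x = (\<Sum>k. it k x * ennreal ((1 / 2) ^ k) * (ennreal (1 / 2) * w x))"
        by (simp only: G_def ennreal_suminf_multc mult.assoc[of _ "ennreal (1 / 2)" "w x"])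
      also have "\<dots> = (\<Sum>k. (it k x * w x) * ennreal ((1 / 2) ^ Suc k))"
        by (simp only: half[symmetric] mult_ac)
      finally show "epow (G x * ennreal (1 / 2) * w x) (p x) \<le> (\<Sum>k. epow (it k x * w x) (p x) * ennreal ((1 / 2) ^ Suc k))"
        using suminf_Jensen[OF \<open>1 \<le> p x\<close> sum1] by simp
    qed
    also have "\<dots> = (\<Sum>k. (\<integral>\<^sup>+x. epow (it k x * w x) (p x) \<partial>\<kappa>) * ennreal ((1 / 2) ^ Suc k))"
      by (subst nn_integral_suminf) (auto simp: nn_integral_multc)
    also have "\<dots> \<le> (\<Sum>k. 1 * ennreal ((1 / 2) ^ Suc k))"
      using it by (intro suminf_le mult_right_mono) auto
    also have "\<dots> = 1" using sum1 by simp
    finally show "(\<integral>\<^sup>+x. epow (G x * ennreal (1 / 2) * w x) (p x) \<partial>\<kappa>) \<le> 1" .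
    fix x
    have CC: "ennreal (1 / C) * ennreal C = 1"
      using C by (simp flip: ennreal_mult)
    have "mx \<nu> 0 G x \<le> (\<Sum>k. mx \<nu> 0 (\<lambda>y. ennreal ((1 / 2) ^ k) * it k y) x)"
      unfolding G_def by (subst mult.commute, rule mx_suminf_le) (auto simp: s)
    also have "\<dots> = (\<Sum>k. ennreal ((1 / 2) ^ k) * mx \<nu> 0 (it k) x)"
      by (simp add: mx_cmult s)
    also have "\<dots> = (\<Sum>k. ennreal (2 * C) * (it (Suc k) x * ennreal ((1 / 2) ^ Suc k)))"
    proof (intro suminf_cong)
      fix k
      have "mx \<nu> 0 (it k) x = it (Suc k) x * ennreal C"
        by (simp add: it_Suc T_def mult.assoc CC)
      moreover have "ennreal ((1 / 2) ^ k) * ennreal C = ennreal (2 * C) * ennreal ((1 / 2) ^ Suc k)"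
        using C by (simp flip: ennreal_mult)
      ultimately show "ennreal ((1 / 2) ^ k) * mx \<nu> 0 (it k) x = ennreal (2 * C) * (it (Suc k) x * ennreal ((1 / 2) ^ Suc k))"
        by (metis mult.assoc mult.commute)
    qed
    also have "\<dots> = ennreal (2 * C) * (\<Sum>k. it (Suc k) x * ennreal ((1 / 2) ^ Suc k))"
      by (rule ennreal_suminf_cmult)
    also have "\<dots> \<le> ennreal (2 * C) * G x"
    proof (rule mult_left_mono)
      show "(\<Sum>k. it (Suc k) x * ennreal ((1 / 2) ^ Suc k)) \<le> G x"
      proof (rule suminf_le_const)
        fix n
        have "(\<Sum>k<n. it (Suc k) x * ennreal ((1 / 2) ^ Suc k)) \<le> (\<Sum>k<Suc n. it k x * ennreal ((1 / 2) ^ k))"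
          unfolding sum.lessThan_Suc_shift by simp
        also have "\<dots> \<le> G x"
          unfolding G_def by (intro sum_le_suminf) auto
        finally show "(\<Sum>k<n. it (Suc k) x * ennreal ((1 / 2) ^ Suc k)) \<le> G x" .
      qed simp
    qed simp
    finally show "mx \<nu> 0 G x \<le> ennreal (2 * C) * G x" .
  qed
qed

text \<open>The Muckenhoupt condition M V \<le> K V almost everywhere, multiplied out; the
  exceptional set serves all balls at once. \<open>V\<close> is real and positive at every point so
  that it can be a density and carry negative powers.\<close>

definition A1 :: "real \<Rightarrow> 'a::euclidean_space measure \<Rightarrow> ('a \<Rightarrow> real) \<Rightarrow> bool" where
  "A1 K \<nu> V \<longleftrightarrow> 0 < K \<and> V \<in> borel_measurable lebesgue \<and> (\<forall>x. 0 < V x) \<and>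
     (AE x in \<nu>. \<forall>B\<in>qballs. x \<in> B \<longrightarrow>
        (\<integral>\<^sup>+y. ennreal (V y) * indicator B y \<partial>\<nu>) \<le> ennreal (K * measure \<nu> B * V x))"

lemma qballs_cover: "\<exists>B\<in>qballs. x \<in> B \<and> y \<in> B"
proof -
  obtain a r where "a \<in> dense_pts" "r \<in> \<rat>" "0 < r" "cball x (dist x y + 1) \<subseteq> ball a r"
    using qball_containing_cball[of "dist x y + 1" x] by (metis add_nonneg_pos zero_le_dist zero_less_one)
  then show ?thesis
    by (intro bexI[of _ "ball a r"]) (auto simp: qballs_def subset_iff)
qed

text \<open>If G vanished at a single point x, then so would M G, hence G = 0 almost everywhere on
  each ball around x. Countably many such balls cover the space, contradicting \<open>nz\<close>. So
  G is positive everywhere.\<close>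

lemma A1_of_mx_bound:
  fixes G :: "'a::euclidean_space \<Rightarrow> ennreal"
  assumes d: "doubling D \<nu>" and G [measurable]: "G \<in> borel_measurable lebesgue"
    and fin: "AE x in \<nu>. G x < top" and nz: "\<not> (AE x in \<nu>. G x = 0)" and K: "0 < K"
    and le: "\<And>x. mx \<nu> 0 G x \<le> ennreal K * G x"
  shows "\<exists>V. A1 K \<nu> V \<and> (AE x in \<nu>. G x = ennreal (V x))"
proof -
  have [measurable]: "G \<in> borel_measurable \<nu>" by (simp add: doubling_borel[OF d])
  have pos: "G x \<noteq> 0" for x
  proof
    assume "G x = 0"
    have "AE y in \<nu>. \<forall>B\<in>{B\<in>qballs. x \<in> B}. y \<in> B \<longrightarrow> G y = 0"
    proof (rule AE_ball_countable')
      show "countable {B \<in> qballs. x \<in> B}"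
        by (rule countable_subset[OF _ countable_qballs]) auto
      fix B assume "B \<in> {B \<in> qballs. x \<in> B}"
      then have B: "B \<in> qballs" "x \<in> B" by auto
      note m = doubling_qball[OF d B(1)]
      have [measurable]: "B \<in> sets \<nu>" by fact
      have "ennreal (measure \<nu> B powr (0 - 1)) * (\<integral>\<^sup>+y. G y * indicator B y \<partial>\<nu>) = 0"
        using mx_ge[OF B, of \<nu> 0 G] le[of x] \<open>G x = 0\<close> by simp
      then have "(\<integral>\<^sup>+y. G y * indicator B y \<partial>\<nu>) = 0"
        using m(2) by (simp add: powr_minus)
      then have "AE y in \<nu>. G y * indicator B y = 0"
        by (subst (asm) nn_integral_0_iff_AE) auto
      then show "AE y in \<nu>. y \<in> B \<longrightarrow> G y = 0"
        by eventually_elim (auto split: split_indicator_asm)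
    qed
    then have "AE y in \<nu>. G y = 0"
    proof eventually_elim
      case (elim y)
      then show ?case using qballs_cover[of x y] by blast
    qed
    with nz show False by simp
  qed
  \<comment> \<open>The value 1 is a positive filler on the null set where \<open>G\<close> is
    infinite; \<open>enn2real\<close> alone would give 0 there.\<close>
  define V where "V x = (if G x = top then 1 else enn2real (G x))" for x
  have GV: "AE x in \<nu>. G x = ennreal (V x)"
    using fin by eventually_elim (auto simp: V_def)
  have "A1 K \<nu> V" unfolding A1_def
  proof (intro conjI allI K)
    show "V \<in> borel_measurable lebesgue" unfolding V_def by measurable
    show "0 < V x" for x
      using pos[of x] by (auto simp: V_def enn2real_positive_iff less_top zero_less_iff_neq_zero)
    show "AE x in \<nu>. \<forall>B\<in>qballs. x \<in> B \<longrightarrow> (\<integral>\<^sup>+y. ennreal (V y) * indicator B y \<partial>\<nu>) \<le> ennreal (K * measure \<nu> B * V x)"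
      using GV
    proof eventually_elim
      case (elim x)
      show ?case
      proof (intro ballI impI)
        fix B assume B: "B \<in> qballs" "x \<in> B"
        note m = doubling_qball[OF d B(1)]
        have "(\<integral>\<^sup>+y. ennreal (V y) * indicator B y \<partial>\<nu>) = (\<integral>\<^sup>+y. G y * indicator B y \<partial>\<nu>)"
          using GV by (intro nn_integral_cong_AE) (auto elim!: eventually_mono)
        also have "\<dots> = ennreal (measure \<nu> B * measure \<nu> B powr (0 - 1)) * (\<integral>\<^sup>+y. G y * indicator B y \<partial>\<nu>)"
          using m(2) by (simp add: powr_minus)
        also have "\<dots> = ennreal (measure \<nu> B) * (ennreal (measure \<nu> B powr (0 - 1)) * (\<integral>\<^sup>+y. G y * indicator B y \<partial>\<nu>))"
          by (subst ennreal_mult) (simp_all only: mult.assoc measure_nonneg powr_ge_zero)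
        also have "\<dots> \<le> ennreal (measure \<nu> B) * (ennreal K * G x)"
          by (intro mult_left_mono order_trans[OF mx_ge[OF B] le]) simp
        also have "\<dots> = ennreal (K * measure \<nu> B * V x)"
          using K elim \<open>0 < V x\<close> by (simp add: ennreal_mult mult_ac)
        finally show "(\<integral>\<^sup>+y. ennreal (V y) * indicator B y \<partial>\<nu>) \<le> ennreal (K * measure \<nu> B * V x)" .
      qed
    qed
  qed
  with GV show ?thesis by blast
qed

section \<open>Change of measure by an A_1 weight\<close>

lemma A1_D:
  assumes d: "doubling D \<nu>" and A: "A1 K \<nu> V"
  shows "0 < K" "V \<in> borel_measurable lebesgue" "V \<in> borel_measurable \<nu>" "0 < V x"
    and "AE x in \<nu>. \<forall>B\<in>qballs. x \<in> B \<longrightarrow>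
        (\<integral>\<^sup>+y. ennreal (V y) * indicator B y \<partial>\<nu>) \<le> ennreal (K * measure \<nu> B * V x)"
  using A unfolding A1_def by (simp_all add: doubling_borel[OF d])

lemma doubling_AE_notin:
  assumes "doubling D \<nu>" "B \<in> qballs"
  shows "\<not> (AE x in \<nu>. x \<notin> B)"
  using doubling_qball[OF assms] AE_iff_measurable[of B \<nu> "\<lambda>x. x \<notin> B"]
  by (simp add: doubling_space[OF assms(1)])

text \<open>Write V(B) for the integral of V over B. It is finite because the A_1 inequality holds
  at some point of B, as B is not null. Integrating the A_1 inequality for 5B over the smaller ball
  B gives V(5B) \<nu>(B) \<le> K \<nu>(5B) V(B) \<le> K D \<nu>(B) V(B), and \<nu>(B)
  cancels.\<close>

lemma A1_density:
  assumes d: "doubling D \<nu>" and A: "A1 K \<nu> V"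
  shows "doubling (K * D) (density \<nu> V)"
    and "B \<in> qballs \<Longrightarrow> emeasure (density \<nu> V) B = (\<integral>\<^sup>+y. ennreal (V y) * indicator B y \<partial>\<nu>)"
    and "B \<in> qballs \<Longrightarrow> (\<integral>\<^sup>+y. ennreal (V y) * indicator B y \<partial>\<nu>) = ennreal (measure (density \<nu> V) B)"
proof -
  note [measurable] = A1_D(3)[OF d A]
  have D: "0 < D" using d by (simp add: doubling_def)
  have K: "0 < K" and V: "0 < V x" for x using A1_D[OF d A] by auto
  have em: "emeasure (density \<nu> V) B = (\<integral>\<^sup>+y. ennreal (V y) * indicator B y \<partial>\<nu>)" if "B \<in> qballs" for B
    using doubling_qball[OF d that] by (intro emeasure_density) auto
  then show "B \<in> qballs \<Longrightarrow> emeasure (density \<nu> V) B = (\<integral>\<^sup>+y. ennreal (V y) * indicator B y \<partial>\<nu>)" .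
  have fin: "(\<integral>\<^sup>+y. ennreal (V y) * indicator B y \<partial>\<nu>) < top" if B: "B \<in> qballs" for B
  proof (rule ccontr)
    assume inf: "\<not> ?thesis"
    from A1_D(5)[OF d A] have "AE x in \<nu>. x \<notin> B"
    proof eventually_elim
      case (elim x)
      show ?case
      proof
        assume "x \<in> B"
        with elim B have "(\<integral>\<^sup>+y. ennreal (V y) * indicator B y \<partial>\<nu>) \<le> ennreal (K * measure \<nu> B * V x)"
          by blast
        with inf show False by (meson ennreal_less_top le_less_trans)
      qed
    qed
    then show False using doubling_AE_notin[OF d B] by simp
  qed
  have pos: "0 < (\<integral>\<^sup>+y. ennreal (V y) * indicator B y \<partial>\<nu>)" if B: "B \<in> qballs" for B
  proof (rule ccontr)
    have [measurable]: "B \<in> sets \<nu>" using doubling_qball[OF d B] by simp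
    assume "\<not> ?thesis"
    then have "(\<integral>\<^sup>+y. ennreal (V y) * indicator B y \<partial>\<nu>) = 0" by simp
    then have "AE y in \<nu>. ennreal (V y) * indicator B y = 0"
      by (subst (asm) nn_integral_0_iff_AE) auto
    then have "AE y in \<nu>. y \<notin> B"
    proof eventually_elim
      case (elim y)
      then show ?case using V[of y] by (auto simp: indicator_def ennreal_eq_0_iff)
    qed
    then show False using doubling_AE_notin[OF d B] by simp
  qed
  show "doubling (K * D) (density \<nu> V)"
    unfolding doubling_def
  proof (intro conjI ballI impI)
    show "0 < K * D" using K D by simp
    show "sets (density \<nu> V) = sets lebesgue" using doubling_sets[OF d] by simp
    fix a :: 'a and r :: real assume ar: "a \<in> dense_pts" "r \<in> \<rat>" "0 < r"
    have B: "ball a r \<in> qballs" "ball a (5 * r) \<in> qballs"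
      using ar by (auto intro!: qballsI)
    show "0 < emeasure (density \<nu> V) (ball a r)" "emeasure (density \<nu> V) (ball a r) < top"
      using pos fin em B by auto
    note m = doubling_qball[OF d B(1)]
    note m5 = doubling_qball[OF d B(2)]
    have [measurable]: "ball a r \<in> sets \<nu>" by fact
    let ?I = "\<lambda>B. (\<integral>\<^sup>+y. ennreal (V y) * indicator B y \<partial>\<nu>)"
    have "?I (ball a (5 * r)) * ennreal (measure \<nu> (ball a r)) = (\<integral>\<^sup>+x. ?I (ball a (5 * r)) * indicator (ball a r) x \<partial>\<nu>)"
      using m by (simp add: nn_integral_cmult_indicator)
    also have "\<dots> \<le> (\<integral>\<^sup>+x. ennreal (K * measure \<nu> (ball a (5 * r))) * (ennreal (V x) * indicator (ball a r) x) \<partial>\<nu>)"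
    proof (rule nn_integral_mono_AE, use A1_D(5)[OF d A] in eventually_elim)
      case (elim x)
      have "x \<in> ball a r \<Longrightarrow> x \<in> ball a (5 * r)" using ar by auto
      then show ?case
        using elim B(2) K V[of x] by (auto split: split_indicator simp: ennreal_mult')
    qed
    also have "\<dots> = ennreal (K * measure \<nu> (ball a (5 * r))) * ?I (ball a r)"
      by (rule nn_integral_cmult) auto
    also have "\<dots> \<le> ennreal (K * (D * measure \<nu> (ball a r))) * ?I (ball a r)"
    proof (intro mult_right_mono ennreal_leI mult_left_mono)
      have "emeasure \<nu> (ball a (5 * r)) \<le> ennreal D * emeasure \<nu> (ball a r)"
        using d ar by (simp add: doubling_def)
      then have "ennreal (measure \<nu> (ball a (5 * r))) \<le> ennreal (D * measure \<nu> (ball a r))"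
        using D unfolding m(1) m5(1) by (simp add: ennreal_mult')
      then show "measure \<nu> (ball a (5 * r)) \<le> D * measure \<nu> (ball a r)"
        using D by simp
    qed (use K in auto)
    also have "\<dots> = ennreal (K * D) * ?I (ball a r) * ennreal (measure \<nu> (ball a r))"
      using K D by (simp add: ennreal_mult mult_ac)
    finally have "?I (ball a (5 * r)) * ennreal (measure \<nu> (ball a r)) \<le> ennreal (K * D) * ?I (ball a r) * ennreal (measure \<nu> (ball a r))" .
    then have "?I (ball a (5 * r)) \<le> ennreal (K * D) * ?I (ball a r)"
      using m(2) ennreal_mult_le_mult_iff[of "ennreal (measure \<nu> (ball a r))"] by (simp add: mult.commute)
    then show "emeasure (density \<nu> V) (ball a (5 * r)) \<le> ennreal (K * D) * emeasure (density \<nu> V) (ball a r)"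
      by (simp add: em B)
  qed
  then show "B \<in> qballs \<Longrightarrow> (\<integral>\<^sup>+y. ennreal (V y) * indicator B y \<partial>\<nu>) = ennreal (measure (density \<nu> V) B)"
    using doubling_qball(1) em by metis
qed

text \<open>By Hoelder the average of V^\<theta> is at most the average of V to the power \<theta>,
  which the A_1 inequality bounds by K^\<theta> V^\<theta>.\<close>

lemma A1_powr:
  assumes d: "doubling D \<nu>" and A: "A1 K \<nu> V" and \<theta>: "0 < \<theta>" "\<theta> < 1"
  shows "A1 (K powr \<theta>) \<nu> (\<lambda>x. V x powr \<theta>)"
  unfolding A1_def
proof (intro conjI allI)
  note [measurable] = A1_D(2,3)[OF d A]
  have K: "0 < K" and V: "0 < V x" for x using A1_D[OF d A] by auto
  show "0 < K powr \<theta>" "\<And>x. 0 < V x powr \<theta>" using K V by (auto simp: less_le)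
  show "(\<lambda>x. V x powr \<theta>) \<in> borel_measurable lebesgue" by measurable
  show "AE x in \<nu>. \<forall>B\<in>qballs. x \<in> B \<longrightarrow>
     (\<integral>\<^sup>+y. ennreal (V y powr \<theta>) * indicator B y \<partial>\<nu>) \<le> ennreal (K powr \<theta> * measure \<nu> B * V x powr \<theta>)"
    using A1_D(5)[OF d A]
  proof eventually_elim
    case (elim x)
    show ?case
    proof (intro ballI impI)
      fix B assume B: "B \<in> qballs" "x \<in> B"
      note m = doubling_qball[OF d B(1)]
      have [measurable]: "B \<in> sets \<nu>" by fact
      have "(\<integral>\<^sup>+y. ennreal (V y powr \<theta>) * indicator B y \<partial>\<nu>)
        = (\<integral>\<^sup>+y. epow (ennreal (V y) * indicator B y) \<theta> * epow (indicator B y) (1 - \<theta>) \<partial>\<nu>)"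
        using V by (intro nn_integral_cong) (auto split: split_indicator simp: epow_ennreal less_imp_le)
      also have "\<dots> \<le> epow (\<integral>\<^sup>+y. ennreal (V y) * indicator B y \<partial>\<nu>) \<theta> * epow (\<integral>\<^sup>+y. indicator B y \<partial>\<nu>) (1 - \<theta>)"
        using \<theta> by (intro nn_integral_Holder) auto
      also have "\<dots> \<le> epow (ennreal (K * measure \<nu> B * V x)) \<theta> * epow (ennreal (measure \<nu> B)) (1 - \<theta>)"
        using elim B \<theta> m(1) by (intro mult_mono epow_mono) auto
      also have "\<dots> = ennreal (K powr \<theta> * (measure \<nu> B powr \<theta> * measure \<nu> B powr (1 - \<theta>)) * V x powr \<theta>)"
        using K V[of x] m(2) by (simp add: epow_ennreal powr_mult mult_ac flip: ennreal_mult)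
      also have "measure \<nu> B powr \<theta> * measure \<nu> B powr (1 - \<theta>) = measure \<nu> B"
        using m(2) by (simp flip: powr_add)
      finally show "(\<integral>\<^sup>+y. ennreal (V y powr \<theta>) * indicator B y \<partial>\<nu>) \<le> ennreal (K powr \<theta> * measure \<nu> B * V x powr \<theta>)" .
    qed
  qed
qed

text \<open>The A_1 inequality is used at the integration variable y: V(y) is at least V(B) / (K
  \<nu>(B)) on B, where V(B) is the integral of V over B. As b - 1 \<le> 0, V^{b-1} is at most the
  same power of this quotient, so inserting V V^{-b} V^{b-1} = 1 into the integral trades
  \<nu>(B)^{b-1} for V(B)^{b-1}.\<close>

lemma mx_le_mx_density:
  fixes h :: "'a::euclidean_space \<Rightarrow> ennreal"
  assumes d: "doubling D \<nu>" and A: "A1 K \<nu> V" and h: "h \<in> borel_measurable lebesgue"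
    and b: "0 \<le> b" "b \<le> 1"
  shows "mx \<nu> b h x \<le> ennreal (K powr (1 - b)) * mx (density \<nu> V) b (\<lambda>y. h y * ennreal (V y powr (- b))) x"
proof (rule mx_le)
  note [measurable] = A1_D(3)[OF d A]
  have [measurable]: "h \<in> borel_measurable \<nu>" using h by (simp add: doubling_borel[OF d])
  have K: "0 < K" and V: "0 < V x" for x using A1_D[OF d A] by auto
  fix B assume B: "B \<in> qballs" "x \<in> B"
  note m = doubling_qball[OF d B(1)]
  note m' = doubling_qball[OF A1_density(1)[OF d A] B(1)]
  note I = A1_density(3)[OF d A B(1)]
  have [measurable]: "B \<in> sets \<nu>" by fact
  define M where "M = measure (density \<nu> V) B"
  let ?h = "\<lambda>y. h y * ennreal (V y powr (- b))"
  have "(\<integral>\<^sup>+y. h y * indicator B y \<partial>\<nu>) \<le> (\<integral>\<^sup>+y. ennreal ((M / (K * measure \<nu> B)) powr (b - 1)) * (ennreal (V y) * (?h y * indicator B y)) \<partial>\<nu>)"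
  proof (rule nn_integral_mono_AE, use A1_D(5)[OF d A] in eventually_elim)
    case (elim y)
    show ?case
    proof (cases "y \<in> B")
      case True
      then have "M \<le> K * measure \<nu> B * V y"
        using elim B(1) I K V[of y] by (auto simp: M_def)
      then have "M / (K * measure \<nu> B) \<le> V y"
        using K m(2) by (simp add: field_simps)
      then have "V y powr (b - 1) \<le> (M / (K * measure \<nu> B)) powr (b - 1)"
        using b K m(2) m'(2) by (intro powr_mono2') (auto simp: M_def)
      then have 1: "1 \<le> (M / (K * measure \<nu> B)) powr (b - 1) * (V y * V y powr (- b))"
        using V[of y] powr_add[of "V y" "b - 1" "1 - b"] powr_add[of "V y" 1 "- b"]
        by (smt (verit, best) mult_right_mono powr_ge_zero powr_gt_zero powr_one powr_zero_eq_one)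
      have "h y \<le> ennreal ((M / (K * measure \<nu> B)) powr (b - 1) * (V y * V y powr (- b))) * h y"
        using mult_right_mono[of 1 "ennreal ((M / (K * measure \<nu> B)) powr (b - 1) * (V y * V y powr (- b)))" "h y"] 1
        by (simp add: ennreal_ge_1)
      then show ?thesis using True V[of y] by (simp add: ennreal_mult mult_ac)
    qed simp
  qed
  also have "\<dots> = ennreal ((M / (K * measure \<nu> B)) powr (b - 1)) * (\<integral>\<^sup>+y. ?h y * indicator B y \<partial>density \<nu> V)"
    by (subst nn_integral_density) (auto intro!: nn_integral_cmult)
  finally have "ennreal (measure \<nu> B powr (b - 1)) * (\<integral>\<^sup>+y. h y * indicator B y \<partial>\<nu>)
     \<le> ennreal (measure \<nu> B powr (b - 1)) * (ennreal ((M / (K * measure \<nu> B)) powr (b - 1)) * (\<integral>\<^sup>+y. ?h y * indicator B y \<partial>density \<nu> V))"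
    by (intro mult_left_mono) auto
  also have "\<dots> = ennreal (measure \<nu> B powr (b - 1) * (M / (K * measure \<nu> B)) powr (b - 1)) * (\<integral>\<^sup>+y. ?h y * indicator B y \<partial>density \<nu> V)"
    by (subst ennreal_mult) (simp_all only: mult.assoc powr_ge_zero)
  also have "measure \<nu> B powr (b - 1) * (M / (K * measure \<nu> B)) powr (b - 1) = K powr (1 - b) * M powr (b - 1)"
    using K m(2) m'(2) powr_minus[of K "b - 1"]
    by (simp add: M_def powr_divide powr_mult field_simps)
  also have "ennreal (K powr (1 - b) * M powr (b - 1)) * (\<integral>\<^sup>+y. ?h y * indicator B y \<partial>density \<nu> V)
     = ennreal (K powr (1 - b)) * (ennreal (M powr (b - 1)) * (\<integral>\<^sup>+y. ?h y * indicator B y \<partial>density \<nu> V))"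
    by (subst ennreal_mult) (simp_all only: mult.assoc powr_ge_zero)
  also have "\<dots> \<le> ennreal (K powr (1 - b)) * mx (density \<nu> V) b ?h x"
    unfolding M_def by (intro mult_left_mono mx_ge B) auto
  finally show "ennreal (measure \<nu> B powr (b - 1)) * (\<integral>\<^sup>+y. h y * indicator B y \<partial>\<nu>) \<le> ennreal (K powr (1 - b)) * mx (density \<nu> V) b ?h x" .
qed

text \<open>The counterpart of the previous lemma with the A_1 inequality used at x instead of y: it
  gives 1 / \<nu>(B) \<le> K V(x) / V(B), so the weight comes out of the operator as a
  factor.\<close>

lemma mx_le_weight_mx_density:
  fixes h :: "'a::euclidean_space \<Rightarrow> ennreal"
  assumes d: "doubling D \<nu>" and A: "A1 K \<nu> V" and h: "h \<in> borel_measurable lebesgue"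
  shows "AE x in \<nu>. mx \<nu> 0 h x \<le> ennreal (K * V x) * mx (density \<nu> V) 0 (\<lambda>y. h y * ennreal (1 / V y)) x"
  using A1_D(5)[OF d A]
proof eventually_elim
  case (elim x)
  note [measurable] = A1_D(3)[OF d A]
  have [measurable]: "h \<in> borel_measurable \<nu>" using h by (simp add: doubling_borel[OF d])
  have K: "0 < K" and V: "0 < V x" for x using A1_D[OF d A] by auto
  let ?h = "\<lambda>y. h y * ennreal (1 / V y)"
  show ?case
  proof (rule mx_le)
    fix B assume B: "B \<in> qballs" "x \<in> B"
    note m = doubling_qball[OF d B(1)]
    note m' = doubling_qball[OF A1_density(1)[OF d A] B(1)]
    note I = A1_density(3)[OF d A B(1)]
    have [measurable]: "B \<in> sets \<nu>" by fact
    define M where "M = measure (density \<nu> V) B"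
    have "M \<le> K * measure \<nu> B * V x"
      using elim B I K V[of x] by (auto simp: M_def)
    then have c: "measure \<nu> B powr - 1 \<le> K * V x * M powr - 1"
      using m(2) m'(2) by (simp add: powr_minus M_def field_simps)
    have "(\<integral>\<^sup>+y. h y * indicator B y \<partial>\<nu>) = (\<integral>\<^sup>+y. ennreal (V y) * (?h y * indicator B y) \<partial>\<nu>)"
    proof (intro nn_integral_cong)
      fix y
      have "ennreal (V y) * ennreal (1 / V y) = 1"
        using V[of y] by (simp flip: ennreal_mult)
      then show "h y * indicator B y = ennreal (V y) * (?h y * indicator B y)"
        by (metis mult.assoc mult.commute mult_1)
    qed
    also have "\<dots> = (\<integral>\<^sup>+y. ?h y * indicator B y \<partial>density \<nu> V)"
      by (subst nn_integral_density) auto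
    finally have "ennreal (measure \<nu> B powr (0 - 1)) * (\<integral>\<^sup>+y. h y * indicator B y \<partial>\<nu>)
       \<le> ennreal (K * V x * M powr - 1) * (\<integral>\<^sup>+y. ?h y * indicator B y \<partial>density \<nu> V)"
      using c by (auto intro!: mult_right_mono ennreal_leI)
    also have "\<dots> = ennreal (K * V x) * (ennreal (M powr (0 - 1)) * (\<integral>\<^sup>+y. ?h y * indicator B y \<partial>density \<nu> V))"
      using K V[of x] by (subst ennreal_mult) (simp_all add: mult.assoc)
    also have "\<dots> \<le> ennreal (K * V x) * mx (density \<nu> V) 0 ?h x"
      unfolding M_def by (intro mult_left_mono mx_ge B) auto
    finally show "ennreal (measure \<nu> B powr (0 - 1)) * (\<integral>\<^sup>+y. h y * indicator B y \<partial>\<nu>) \<le> ennreal (K * V x) * mx (density \<nu> V) 0 ?h x" .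
  qed
qed

text \<open>On each ball the integral of h is split into its powers 1 - p b and p b. The first, with
  its share of \<nu>(B), is a power of the average; Hoelder bounds the second by the L^p
  norm.\<close>

lemma mx_Hedberg:
  fixes h :: "'a::euclidean_space \<Rightarrow> ennreal"
  assumes d: "doubling D \<nu>" and h: "h \<in> borel_measurable lebesgue"
    and p: "1 < p" and b: "0 < b" "p * b < 1"
  shows "mx \<nu> b h x \<le> epow (mx \<nu> 0 h x) (1 - p * b) * epow (\<integral>\<^sup>+y. epow (h y) p \<partial>\<nu>) b"
proof (rule mx_le)
  fix B assume B: "B \<in> qballs" "x \<in> B"
  note m = doubling_qball[OF d B(1)]
  have [measurable]: "B \<in> sets \<nu>" by fact
  have [measurable]: "h \<in> borel_measurable \<nu>" using h by (simp add: doubling_borel[OF d])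
  let ?m = "measure \<nu> B"
  let ?I = "\<integral>\<^sup>+y. h y * indicator B y \<partial>\<nu>"
  let ?N = "\<integral>\<^sup>+y. epow (h y) p \<partial>\<nu>"
  have pb: "0 < p * b" using p b by simp
  have "?I = (\<integral>\<^sup>+y. epow (epow (h y) p) (1 / p) * epow (indicator B y) (1 - 1 / p) \<partial>\<nu>)"
    using p by (intro nn_integral_cong) (auto simp: epow_epow split: split_indicator)
  also have "\<dots> \<le> epow ?N (1 / p) * epow (\<integral>\<^sup>+y. indicator B y \<partial>\<nu>) (1 - 1 / p)"
    using p by (intro nn_integral_Holder) auto
  also have "\<dots> = epow ?N (1 / p) * ennreal (?m powr (1 - 1 / p))"
    using m by (simp add: epow_ennreal)
  finally have I: "?I \<le> epow ?N (1 / p) * ennreal (?m powr (1 - 1 / p))" .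
  have "ennreal (?m powr (b - 1)) * ?I = ennreal (?m powr (b - 1)) * epow ?I ((1 - p * b) + p * b)"
    by simp
  also have "\<dots> = ennreal (?m powr (b - 1)) * (epow ?I (1 - p * b) * epow ?I (p * b))"
    using b pb by (subst epow_add) auto
  also have "\<dots> \<le> ennreal (?m powr (b - 1)) * (epow ?I (1 - p * b) * epow (epow ?N (1 / p) * ennreal (?m powr (1 - 1 / p))) (p * b))"
    using pb by (intro mult_left_mono epow_mono I) auto
  also have "\<dots> = ennreal (?m powr (b - 1) * ?m powr ((1 - 1 / p) * (p * b))) * (epow ?I (1 - p * b) * epow ?N b)"
    using pb p by (subst epow_mult) (simp_all add: epow_epow epow_ennreal powr_powr ennreal_mult mult_ac)
  \<comment> \<open>The exponents balance: (b - 1) + (p b - b) = - (1 - p b), which is the power of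
    \<nu>(B) that turns the remaining integral into an average.\<close>
  also have "?m powr (b - 1) * ?m powr ((1 - 1 / p) * (p * b)) = (?m powr (0 - 1)) powr (1 - p * b)"
  proof -
    have "?m powr (b - 1) * ?m powr ((1 - 1 / p) * (p * b)) = ?m powr ((0 - 1) * (1 - p * b))"
      using p by (subst powr_add[symmetric], intro arg_cong2[where f = "(powr)"] refl)
        (simp add: field_simps)
    then show ?thesis by (simp only: powr_powr)
  qed
  also have "ennreal ((?m powr (0 - 1)) powr (1 - p * b)) * (epow ?I (1 - p * b) * epow ?N b)
     = epow (ennreal (?m powr (0 - 1)) * ?I) (1 - p * b) * epow ?N b"
    using b by (subst epow_mult) (simp_all only: epow_ennreal powr_ge_zero mult_ac diff_gt_0_iff_gt)
  also have "\<dots> \<le> epow (mx \<nu> 0 h x) (1 - p * b) * epow ?N b"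
    using b by (intro mult_right_mono epow_mono mx_ge B) auto
  finally show "ennreal (?m powr (b - 1)) * ?I \<le> epow (mx \<nu> 0 h x) (1 - p * b) * epow ?N b" .
qed

section \<open>Vector-valued inequalities on doubling measures\<close>

text \<open>The iteration with constant exponent and no weight; the required bound is the strong
  type inequality, so the A_1 constant depends only on \<open>D\<close> and t. The factor 2^t undoes
  the 1/2 in the modular bound.\<close>

lemma Rubio_de_Francia_Lp:
  fixes g :: "'a::euclidean_space \<Rightarrow> ennreal"
  assumes d: "doubling D \<nu>" and t: "1 < t" and g [measurable]: "g \<in> borel_measurable lebesgue"
    and fin: "(\<integral>\<^sup>+x. epow (g x) t \<partial>\<nu>) < top" and nz: "\<not> (AE x in \<nu>. g x = 0)"
  shows "\<exists>V. A1 (2 * strong_const D t powr (1 / t)) \<nu> V \<and> (AE x in \<nu>. g x \<le> ennreal (V x)) \<and>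
     (\<integral>\<^sup>+x. ennreal (V x powr t) \<partial>\<nu>) \<le> ennreal (2 powr t) * (\<integral>\<^sup>+x. epow (g x) t \<partial>\<nu>)"
proof -
  have [measurable]: "g \<in> borel_measurable \<nu>" by (simp add: doubling_borel[OF d])
  have D: "0 < D" using d by (simp add: doubling_def)
  define S where "S = strong_const D t"
  have S: "0 < S" unfolding S_def using strong_const_pos[OF D t] .
  define C where "C = S powr (1 / t)"
  have C: "0 < C" using S by (simp add: C_def)
  have "(\<integral>\<^sup>+x. epow (g x) t \<partial>\<nu>) \<noteq> 0"
    using nz by (subst nn_integral_0_iff_AE) auto
  then obtain m where m: "(\<integral>\<^sup>+x. epow (g x) t \<partial>\<nu>) = ennreal m" "0 < m"
    using fin by (cases "\<integral>\<^sup>+x. epow (g x) t \<partial>\<nu>") (auto simp: less_le)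
  \<comment> \<open>The L^t norm of \<open>g\<close>; the iteration is run on g / c, whose modular
    is 1, and its result is multiplied by c.\<close>
  define c where "c = m powr (1 / t)"
  have c: "0 < c" "c powr t = m" "(1 / c) powr t = 1 / m"
    using m t by (auto simp: c_def powr_powr powr_divide)
  have "\<exists>G\<in>borel_measurable lebesgue. (\<forall>x. g x * ennreal (1 / c) \<le> G x) \<and>
     (\<integral>\<^sup>+x. epow (G x * ennreal (1 / 2) * 1) t \<partial>\<nu>) \<le> 1 \<and>
     (\<forall>x. mx \<nu> 0 G x \<le> ennreal (2 * C) * G x)"
  proof (rule Rubio_de_Francia[OF doubling_sets[OF d] doubling_sets[OF d] _ _ _ C, where w = "\<lambda>_. 1"])
    fix h :: "'a \<Rightarrow> ennreal" assume h [measurable]: "h \<in> borel_measurable lebesgue" and le: "(\<integral>\<^sup>+x. epow (h x * 1) t \<partial>\<nu>) \<le> 1"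
    have [measurable]: "mx \<nu> 0 h \<in> borel_measurable \<nu>" by (simp add: doubling_borel[OF d])
    have "(\<integral>\<^sup>+x. epow (mx \<nu> 0 h x * ennreal (1 / C) * 1) t \<partial>\<nu>) = (\<integral>\<^sup>+x. epow (mx \<nu> 0 h x) t \<partial>\<nu>) * ennreal ((1 / C) powr t)"
      using t C by (simp add: epow_mult epow_ennreal nn_integral_multc)
    also have "\<dots> \<le> (ennreal S * (\<integral>\<^sup>+x. epow (h x) t \<partial>\<nu>)) * ennreal ((1 / C) powr t)"
      unfolding S_def by (intro mult_right_mono mx_strong_type d h t) simp
    also have "\<dots> \<le> (ennreal S * 1) * ennreal ((1 / C) powr t)"
      using le by (intro mult_right_mono mult_left_mono) auto
    also have "\<dots> = 1"
      using S t by (simp add: C_def powr_divide powr_powr flip: ennreal_mult)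
    finally show "(\<integral>\<^sup>+x. epow (mx \<nu> 0 h x * ennreal (1 / C) * 1) t \<partial>\<nu>) \<le> 1" .
  next
    show "(\<integral>\<^sup>+x. epow (g x * ennreal (1 / c) * 1) t \<partial>\<nu>) \<le> 1"
      using t c m by (simp add: epow_mult epow_ennreal nn_integral_multc flip: ennreal_mult)
  qed (use t in auto)
  then obtain G where G [measurable]: "G \<in> borel_measurable lebesgue" and gG: "\<And>x. g x * ennreal (1 / c) \<le> G x"
    and G1: "(\<integral>\<^sup>+x. epow (G x * ennreal (1 / 2)) t \<partial>\<nu>) \<le> 1" and GA: "\<And>x. mx \<nu> 0 G x \<le> ennreal (2 * C) * G x"
    by auto
  have [measurable]: "G \<in> borel_measurable \<nu>" by (simp add: doubling_borel[OF d])
  define G2 where "G2 x = ennreal c * G x" for x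
  have G2 [measurable]: "G2 \<in> borel_measurable lebesgue" unfolding G2_def by measurable
  have [measurable]: "G2 \<in> borel_measurable \<nu>" by (simp add: doubling_borel[OF d])
  have gG2: "g x \<le> G2 x" for x
  proof -
    have "ennreal c * ennreal (1 / c) = 1" using c by (simp flip: ennreal_mult)
    then have "g x = ennreal c * (g x * ennreal (1 / c))"
      by (metis mult.assoc mult.commute mult.right_neutral)
    also have "\<dots> \<le> G2 x" unfolding G2_def by (intro mult_left_mono gG) simp
    finally show ?thesis .
  qed
  have "(\<integral>\<^sup>+x. epow (G2 x) t \<partial>\<nu>) = (\<integral>\<^sup>+x. ennreal (2 powr t * m) * epow (G x * ennreal (1 / 2)) t \<partial>\<nu>)"
  proof (intro nn_integral_cong)
    fix x
    have "ennreal (2 powr t * m) * epow (G x * ennreal (1 / 2)) t = (ennreal (2 powr t * m) * ennreal ((1 / 2) powr t)) * epow (G x) t"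
    proof -
      have "epow (G x * ennreal (1 / 2)) t = epow (G x) t * ennreal ((1 / 2) powr t)"
        using t epow_ennreal[of "1 / 2" t] by (simp only: epow_mult less_trans[OF zero_less_one])
      then show ?thesis by (simp only: mult_ac)
    qed
    also have "ennreal (2 powr t * m) * ennreal ((1 / 2) powr t) = ennreal m"
      using m by (simp add: powr_divide flip: ennreal_mult)
    finally show "epow (G2 x) t = ennreal (2 powr t * m) * epow (G x * ennreal (1 / 2)) t"
      using t c by (simp add: G2_def epow_mult epow_ennreal)
  qed
  also have "\<dots> = ennreal (2 powr t * m) * (\<integral>\<^sup>+x. epow (G x * ennreal (1 / 2)) t \<partial>\<nu>)"
    by (rule nn_integral_cmult) measurable
  also have "\<dots> \<le> ennreal (2 powr t * m) * 1"
    by (intro mult_left_mono G1) simp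
  finally have int: "(\<integral>\<^sup>+x. epow (G2 x) t \<partial>\<nu>) \<le> ennreal (2 powr t) * ennreal m"
    using m by (simp add: ennreal_mult)
  have G2fin: "AE x in \<nu>. G2 x < top"
  proof -
    have "(\<integral>\<^sup>+x. epow (G2 x) t \<partial>\<nu>) \<noteq> \<infinity>"
      using int by (metis ennreal_mult_eq_top_iff ennreal_neq_top infinity_ennreal_def top_unique)
    then have "AE x in \<nu>. epow (G2 x) t \<noteq> \<infinity>"
      by (intro nn_integral_noteq_infinite) auto
    then show ?thesis by eventually_elim (simp add: less_top)
  qed
  have "\<exists>V. A1 (2 * C) \<nu> V \<and> (AE x in \<nu>. G2 x = ennreal (V x))"
  proof (rule A1_of_mx_bound[OF d G2 G2fin])
    show "\<not> (AE x in \<nu>. G2 x = 0)"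
      using nz gG2 by (auto elim!: eventually_mono simp: le_zero_eq) (metis (mono_tags, lifting) eventually_mono le_zero_eq)
    show "mx \<nu> 0 G2 x \<le> ennreal (2 * C) * G2 x" for x
    proof -
      have "mx \<nu> 0 G2 x = ennreal c * mx \<nu> 0 G x"
        unfolding G2_def by (intro mx_cmult doubling_sets[OF d]) simp
      also have "\<dots> \<le> ennreal c * (ennreal (2 * C) * G x)" by (intro mult_left_mono GA) simp
      finally show ?thesis by (simp add: G2_def mult_ac)
    qed
  qed (use C in simp)
  then obtain V where V: "A1 (2 * C) \<nu> V" "AE x in \<nu>. G2 x = ennreal (V x)" by blast
  have "(\<integral>\<^sup>+x. ennreal (V x powr t) \<partial>\<nu>) = (\<integral>\<^sup>+x. epow (G2 x) t \<partial>\<nu>)"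
    using V(2)
  proof (intro nn_integral_cong_AE, eventually_elim)
    case (elim x)
    then show ?case using A1_D(4)[OF d V(1), of x] by (simp add: epow_ennreal)
  qed
  moreover have "AE x in \<nu>. g x \<le> ennreal (V x)"
    using V(2) gG2 by (auto elim!: eventually_mono) metis
  ultimately show ?thesis
    using V(1) int by (auto simp: C_def S_def m)
qed

text \<open>For p = u sum and integral commute. For p < u let H be the l^u norm of the data, W an
  A_1 majorant of H in L^p, and V = W^\<theta>. Pulling V out of the operator leaves the scalar L^u
  bound on V d\<nu> for h_j / V, whose right side is the integral of H^u V^{1-u} = H^u W^{p-u} \<le>
  H^p. Hoelder with exponent p/u returns from L^u to L^p.\<close>

lemma mx_vector_strong_diag:
  assumes D: "0 < D" and p: "1 < p" "p \<le> u"
  shows "\<exists>C>0. \<forall>\<nu> (h :: nat \<Rightarrow> 'a::euclidean_space \<Rightarrow> ennreal). doubling D \<nu> \<longrightarrow> (\<forall>j. h j \<in> borel_measurable lebesgue) \<longrightarrow>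
     (\<integral>\<^sup>+x. epow (\<Sum>j. epow (mx \<nu> 0 (h j) x) u) (p / u) \<partial>\<nu>) \<le> ennreal C * (\<integral>\<^sup>+x. epow (\<Sum>j. epow (h j x) u) (p / u) \<partial>\<nu>)"
proof (cases "p = u")
  case True
  show ?thesis
  proof (intro exI[of _ "strong_const D u"] conjI allI impI)
    show "0 < strong_const D u" using strong_const_pos[OF D] p True by simp
    fix \<nu> :: "'a measure" and h :: "nat \<Rightarrow> 'a \<Rightarrow> ennreal"
    assume d: "doubling D \<nu>" and h: "\<forall>j. h j \<in> borel_measurable lebesgue"
    have [measurable]: "h j \<in> borel_measurable \<nu>" "mx \<nu> 0 (h j) \<in> borel_measurable \<nu>" for j using h by (simp_all add: doubling_borel[OF d])
    have "(\<integral>\<^sup>+x. (\<Sum>j. epow (mx \<nu> 0 (h j) x) u) \<partial>\<nu>) = (\<Sum>j. \<integral>\<^sup>+x. epow (mx \<nu> 0 (h j) x) u \<partial>\<nu>)"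
      by (rule nn_integral_suminf) measurable
    also have "\<dots> \<le> (\<Sum>j. ennreal (strong_const D u) * (\<integral>\<^sup>+x. epow (h j x) u \<partial>\<nu>))"
      using h p True by (intro suminf_le mx_strong_type[OF d]) auto
    also have "\<dots> = ennreal (strong_const D u) * (\<integral>\<^sup>+x. (\<Sum>j. epow (h j x) u) \<partial>\<nu>)"
      by (simp add: nn_integral_suminf)
    finally show "(\<integral>\<^sup>+x. epow (\<Sum>j. epow (mx \<nu> 0 (h j) x) u) (p / u) \<partial>\<nu>) \<le> ennreal (strong_const D u) * (\<integral>\<^sup>+x. epow (\<Sum>j. epow (h j x) u) (p / u) \<partial>\<nu>)"
      using True p by simp
  qed
next
  case False
  then have pu: "p < u" "1 < u" using p by auto
  \<comment> \<open>Determined by \<theta> (u - 1) = u - p, so that V^{1-u} = W^{p-u}. It is below 1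
    because p > 1, as \<open>A1_powr\<close> demands.\<close>
  define \<theta> where "\<theta> = (u - p) / (u - 1)"
  have \<theta>: "0 < \<theta>" "\<theta> < 1" using p pu by (auto simp: \<theta>_def)
  define K where "K = (2 * strong_const D p powr (1 / p)) powr \<theta>"
  have K: "0 < K" using strong_const_pos[OF D p(1)] by (simp add: K_def)
  define S where "S = strong_const (K * D) u"
  have S: "0 < S" unfolding S_def using K D pu by (intro strong_const_pos) auto
  define C where "C = K powr p * (S powr (p / u) * (2 powr p) powr (1 - p / u))"
  have C: "0 < C" unfolding C_def using K S by simp
  have pu1: "0 < p / u" "p / u < 1" using p pu by auto
  show ?thesis
  proof (intro exI[of _ C] conjI allI impI C)
    fix \<nu> :: "'a measure" and h :: "nat \<Rightarrow> 'a \<Rightarrow> ennreal"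
    assume d: "doubling D \<nu>" and h: "\<forall>j. h j \<in> borel_measurable lebesgue"
    note bm = doubling_borel[OF d]
    have h1 [measurable]: "h j \<in> borel_measurable \<nu>" for j using h by (simp add: bm)
    have h2 [measurable]: "h j \<in> borel_measurable lebesgue" for j using h by simp
    define H where "H x = epow (\<Sum>j. epow (h j x) u) (1 / u)" for x
    have H [measurable]: "H \<in> borel_measurable lebesgue" "H \<in> borel_measurable \<nu>"
      unfolding H_def by measurable
    have Hp: "epow (\<Sum>j. epow (h j x) u) (p / u) = epow (H x) p" for x
      using pu by (simp add: H_def epow_epow)
    have Hu: "(\<Sum>j. epow (h j x) u) = epow (H x) u" for x
      using pu by (simp add: H_def epow_epow)
    let ?m = "\<integral>\<^sup>+x. epow (H x) p \<partial>\<nu>"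
    show "(\<integral>\<^sup>+x. epow (\<Sum>j. epow (mx \<nu> 0 (h j) x) u) (p / u) \<partial>\<nu>) \<le> ennreal C * (\<integral>\<^sup>+x. epow (\<Sum>j. epow (h j x) u) (p / u) \<partial>\<nu>)"
      unfolding Hp
    \<comment> \<open>If the right side is infinite there is nothing to prove. If \<open>H\<close>
      vanishes almost everywhere there is no positive majorant to build, but then all maximal
      functions are 0, since they ignore null sets.\<close>
    proof (cases "?m = top \<or> (AE x in \<nu>. H x = 0)")
      case True
      then show "(\<integral>\<^sup>+x. epow (\<Sum>j. epow (mx \<nu> 0 (h j) x) u) (p / u) \<partial>\<nu>) \<le> ennreal C * ?m"
      proof
        assume "?m = top"
        then show ?thesis using C by (simp add: ennreal_mult_top)
      next
        assume "AE x in \<nu>. H x = 0"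
        then have "AE x in \<nu>. h j x = 0" for j
        proof eventually_elim
          case (elim x)
          have "epow (h j x) u \<le> (\<Sum>j. epow (h j x) u)"
            using sum_le_suminf[of "\<lambda>j. epow (h j x) u" "{j}"] by simp
          also have "\<dots> = 0" using Hu[of x] elim by simp
          finally show ?case by simp
        qed
        then have "mx \<nu> 0 (h j) x = mx \<nu> 0 (\<lambda>_. 0) x" for j x
          by (rule mx_cong_AE)
        moreover have "mx \<nu> 0 (\<lambda>_. 0) x = 0" for x
          by (intro antisym mx_le) auto
        ultimately show ?thesis by simp
      qed
    next
      case False
      then have "\<exists>V. A1 (2 * strong_const D p powr (1 / p)) \<nu> V \<and> (AE x in \<nu>. H x \<le> ennreal (V x)) \<and>
         (\<integral>\<^sup>+x. ennreal (V x powr p) \<partial>\<nu>) \<le> ennreal (2 powr p) * ?m"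
        using p by (intro Rubio_de_Francia_Lp[OF d]) (auto simp: less_top)
      then obtain W where W: "A1 (2 * strong_const D p powr (1 / p)) \<nu> W" "AE x in \<nu>. H x \<le> ennreal (W x)"
         "(\<integral>\<^sup>+x. ennreal (W x powr p) \<partial>\<nu>) \<le> ennreal (2 powr p) * ?m"
        by blast
      have Wpos: "0 < W x" for x using A1_D(4)[OF d W(1)] .
      define V where "V x = W x powr \<theta>" for x
      have A: "A1 K \<nu> V"
        unfolding V_def K_def by (rule A1_powr[OF d W(1) \<theta>])
      note dV = A1_density(1)[OF d A]
      have [measurable]: "W \<in> borel_measurable \<nu>" "V \<in> borel_measurable \<nu>" "V \<in> borel_measurable lebesgue"
        using A1_D(3)[OF d W(1)] A1_D(2,3)[OF d A] by auto
      have V: "0 < V x" for x using A1_D(4)[OF d A] .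
      define k where "k j x = h j x * ennreal (1 / V x)" for j x
      have k [measurable]: "k j \<in> borel_measurable lebesgue" "k j \<in> borel_measurable \<nu>" for j
        unfolding k_def by measurable
      have [measurable]: "mx (density \<nu> V) 0 (k j) \<in> borel_measurable \<nu>" for j by (simp add: bm)
      define G where "G x = (\<Sum>j. epow (mx (density \<nu> V) 0 (k j) x) u)" for x
      have [measurable]: "G \<in> borel_measurable \<nu>" unfolding G_def by measurable
      have "AE x in \<nu>. \<forall>j. mx \<nu> 0 (h j) x \<le> ennreal (K * V x) * mx (density \<nu> V) 0 (k j) x"
        unfolding AE_all_countable k_def using mx_le_weight_mx_density[OF d A] h by auto
      then have 1: "AE x in \<nu>. epow (\<Sum>j. epow (mx \<nu> 0 (h j) x) u) (p / u)
         \<le> ennreal (K powr p) * (epow (G x * ennreal (V x)) (p / u) * epow (ennreal (W x powr p)) (1 - p / u))"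
      proof eventually_elim
        case (elim x)
        have "(\<Sum>j. epow (mx \<nu> 0 (h j) x) u) \<le> (\<Sum>j. epow (ennreal (K * V x) * mx (density \<nu> V) 0 (k j) x) u)"
          using elim pu by (intro suminf_le epow_mono) auto
        also have "\<dots> = ennreal ((K * V x) powr u) * G x"
          using K V[of x] pu by (simp add: epow_mult epow_ennreal G_def)
        finally have "epow (\<Sum>j. epow (mx \<nu> 0 (h j) x) u) (p / u) \<le> epow (ennreal ((K * V x) powr u) * G x) (p / u)"
          using pu1 by (intro epow_mono) auto
        also have "\<dots> = ennreal ((K * V x) powr p) * epow (G x) (p / u)"
          using pu1 pu by (simp add: epow_mult epow_ennreal powr_powr)
        also have "(K * V x) powr p = K powr p * (V x powr (p / u) * (W x powr p) powr (1 - p / u))"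
        proof -
          \<comment> \<open>Of the factor V^p, the part V^{p/u} joins G to form (G V)^{p/u}; what is
            left is exactly (W^p)^{1 - p/u}, the other Hoelder factor.\<close>
          have "\<theta> * p = \<theta> * (p / u) + p * (1 - p / u)"
            using pu by (simp add: \<theta>_def field_simps)
          then have "V x powr p = V x powr (p / u) * (W x powr p) powr (1 - p / u)"
            by (simp add: V_def powr_powr flip: powr_add)
          then show ?thesis using K V[of x] by (simp add: powr_mult)
        qed
        also have "ennreal \<dots> * epow (G x) (p / u)
          = ennreal (K powr p) * (epow (G x * ennreal (V x)) (p / u) * epow (ennreal (W x powr p)) (1 - p / u))"
          using pu1 V[of x] by (simp add: epow_mult epow_ennreal ennreal_mult mult_ac)
        finally show ?case .
      qed
      have GV: "(\<integral>\<^sup>+x. G x * ennreal (V x) \<partial>\<nu>) \<le> ennreal S * ?m"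
      proof -
        have "(\<integral>\<^sup>+x. G x * ennreal (V x) \<partial>\<nu>) = (\<integral>\<^sup>+x. G x \<partial>density \<nu> V)"
          by (subst nn_integral_density) (auto simp: mult.commute)
        also have "\<dots> = (\<Sum>j. \<integral>\<^sup>+x. epow (mx (density \<nu> V) 0 (k j) x) u \<partial>density \<nu> V)"
          unfolding G_def by (rule nn_integral_suminf) measurable
        also have "\<dots> \<le> (\<Sum>j. ennreal S * (\<integral>\<^sup>+x. epow (k j x) u \<partial>density \<nu> V))"
          unfolding S_def using pu by (intro suminf_le mx_strong_type[OF dV]) auto
        also have "\<dots> = ennreal S * (\<integral>\<^sup>+x. (\<Sum>j. epow (k j x) u) \<partial>density \<nu> V)"
          by (simp add: nn_integral_suminf)
        also have "(\<integral>\<^sup>+x. (\<Sum>j. epow (k j x) u) \<partial>density \<nu> V) = (\<integral>\<^sup>+x. epow (H x) u * ennreal (W x powr (p - u)) \<partial>\<nu>)"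
        proof (subst nn_integral_density, measurable, intro nn_integral_cong)
          fix x
          have e: "\<theta> * (1 - u) = p - u" using pu by (simp add: \<theta>_def field_simps)
          have "(\<Sum>j. epow (k j x) u) = epow (H x) u * ennreal ((1 / V x) powr u)"
            using pu V[of x] by (simp add: k_def epow_mult epow_ennreal flip: Hu)
          moreover have WV: "V x * (1 / V x) powr u = W x powr (p - u)"
          proof -
            have "V x * (1 / V x) powr u = V x powr 1 * V x powr (- u)"
              using V[of x] by (simp add: powr_divide powr_minus_divide)
            also have "\<dots> = V x powr (1 - u)" by (subst powr_add[symmetric]) simp
            finally show ?thesis by (simp add: V_def powr_powr e)
          qed
          ultimately have "ennreal (V x) * (\<Sum>j. epow (k j x) u) = epow (H x) u * (ennreal (V x) * ennreal ((1 / V x) powr u))"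
            by (simp only: mult_ac)
          also have "ennreal (V x) * ennreal ((1 / V x) powr u) = ennreal (W x powr (p - u))"
            using V[of x] by (subst ennreal_mult[symmetric]) (simp_all only: WV less_imp_le powr_ge_zero)
          finally show "ennreal (V x) * (\<Sum>j. epow (k j x) u) = epow (H x) u * ennreal (W x powr (p - u))" .
        qed
        also have "\<dots> \<le> ?m"
        proof (rule nn_integral_mono_AE, use W(2) in eventually_elim)
          case (elim x)
          have "epow (H x) (u - p) * ennreal (W x powr (p - u)) \<le> epow (ennreal (W x)) (u - p) * ennreal (W x powr (p - u))"
            using elim pu by (intro mult_right_mono epow_mono) auto
          also have "\<dots> = 1"
            using Wpos[of x] by (simp add: epow_ennreal flip: ennreal_mult powr_add)
          finally have "epow (H x) p * (epow (H x) (u - p) * ennreal (W x powr (p - u))) \<le> epow (H x) p * 1"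
            by (intro mult_left_mono) auto
          moreover have "epow (H x) u = epow (H x) p * epow (H x) (u - p)"
            using p pu by (simp flip: epow_add)
          ultimately show "epow (H x) u * ennreal (W x powr (p - u)) \<le> epow (H x) p"
            by (simp add: mult.assoc)
        qed
        finally show ?thesis by (simp add: mult_left_mono)
      qed
      have "(\<integral>\<^sup>+x. epow (\<Sum>j. epow (mx \<nu> 0 (h j) x) u) (p / u) \<partial>\<nu>)
        \<le> (\<integral>\<^sup>+x. ennreal (K powr p) * (epow (G x * ennreal (V x)) (p / u) * epow (ennreal (W x powr p)) (1 - p / u)) \<partial>\<nu>)"
        by (rule nn_integral_mono_AE[OF 1])
      also have "\<dots> = ennreal (K powr p) * (\<integral>\<^sup>+x. epow (G x * ennreal (V x)) (p / u) * epow (ennreal (W x powr p)) (1 - p / u) \<partial>\<nu>)"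
        by (rule nn_integral_cmult) measurable
      also have "\<dots> \<le> ennreal (K powr p) * (epow (\<integral>\<^sup>+x. G x * ennreal (V x) \<partial>\<nu>) (p / u) * epow (\<integral>\<^sup>+x. ennreal (W x powr p) \<partial>\<nu>) (1 - p / u))"
        using pu1 by (intro mult_left_mono nn_integral_Holder) auto
      also have "\<dots> \<le> ennreal (K powr p) * (epow (ennreal S * ?m) (p / u) * epow (ennreal (2 powr p) * ?m) (1 - p / u))"
        using pu1 by (intro mult_left_mono mult_mono epow_mono GV W(3)) auto
      also have "\<dots> = ennreal C * (epow ?m (p / u) * epow ?m (1 - p / u))"
        using pu1 S unfolding C_def by (simp add: epow_mult epow_ennreal ennreal_mult mult_ac)
      also have "epow ?m (p / u) * epow ?m (1 - p / u) = ?m"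
        using pu1 by (simp flip: epow_add)
      finally show "(\<integral>\<^sup>+x. epow (\<Sum>j. epow (mx \<nu> 0 (h j) x) u) (p / u) \<partial>\<nu>) \<le> ennreal C * ?m" .
    qed
  qed
qed

text \<open>Hedberg's inequality is applied to each \<open>h j\<close>, and Hoelder in j separates
  the maximal functions from the norms of the h_j. The choice of q makes the power of the maximal
  functions equal to p, which is the case b = 0 already proved.\<close>

lemma mx_vector_strong_le:
  assumes D: "0 < D" and p: "1 < p" "p \<le> u" and b: "0 \<le> b" "p * b < 1" and q: "q = p / (1 - p * b)"
  shows "\<exists>C>0. \<forall>\<nu> (h :: nat \<Rightarrow> 'a::euclidean_space \<Rightarrow> ennreal). doubling D \<nu> \<longrightarrow> (\<forall>j. h j \<in> borel_measurable lebesgue) \<longrightarrow>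
     (\<integral>\<^sup>+x. epow (\<Sum>j. epow (mx \<nu> b (h j) x) u) (q / u) \<partial>\<nu>) \<le> ennreal C * epow (\<integral>\<^sup>+x. epow (\<Sum>j. epow (h j x) u) (p / u) \<partial>\<nu>) (q / p)"
proof (cases "b = 0")
  case True
  then show ?thesis using mx_vector_strong_diag[OF D p] p q by simp
next
  case False
  then have b: "0 < b" "p * b < 1" using b by auto
  have pb: "0 < p * b" using b p by simp
  have u: "0 < u" using p by simp
  have q0: "0 < q" using q b p by simp
  have qb: "(1 - p * b) * q = p" "q / p = 1 + b * q"
    using q b p by (auto simp: field_simps)
  obtain C where C: "0 < C" "\<And>\<nu> (h :: nat \<Rightarrow> 'a \<Rightarrow> ennreal). doubling D \<nu> \<Longrightarrow> (\<forall>j. h j \<in> borel_measurable lebesgue) \<Longrightarrow>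
     (\<integral>\<^sup>+x. epow (\<Sum>j. epow (mx \<nu> 0 (h j) x) u) (p / u) \<partial>\<nu>) \<le> ennreal C * (\<integral>\<^sup>+x. epow (\<Sum>j. epow (h j x) u) (p / u) \<partial>\<nu>)"
    using mx_vector_strong_diag[OF D p] by blast
  show ?thesis
  proof (intro exI[of _ C] conjI allI impI C(1))
    fix \<nu> :: "'a measure" and h :: "nat \<Rightarrow> 'a \<Rightarrow> ennreal"
    assume d: "doubling D \<nu>" and h: "\<forall>j. h j \<in> borel_measurable lebesgue"
    note bm = doubling_borel[OF d]
    have h1 [measurable]: "h j \<in> borel_measurable \<nu>" for j using h by (simp add: bm)
    have mm [measurable]: "mx \<nu> 0 (h j) \<in> borel_measurable \<nu>" for j by (simp add: bm)
    define N where "N j = (\<integral>\<^sup>+x. epow (h j x) p \<partial>\<nu>)" for j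
    define M where "M = (\<integral>\<^sup>+x. epow (\<Sum>j. epow (h j x) u) (p / u) \<partial>\<nu>)"
    \<comment> \<open>Minkowski with exponent u / p; this is where p \<le> u enters.\<close>
    have N: "(\<Sum>j. epow (N j) (u / p)) \<le> epow M (u / p)"
      using suminf_Minkowski_integral[of "\<lambda>j x. epow (h j x) p" \<nu> "u / p"] p
      by (simp add: N_def M_def epow_epow)
    have pt: "epow (\<Sum>j. epow (mx \<nu> b (h j) x) u) (q / u) \<le> epow (\<Sum>j. epow (mx \<nu> 0 (h j) x) u) (p / u) * epow M (b * q)" for x
    proof -
      have "(\<Sum>j. epow (mx \<nu> b (h j) x) u) \<le> (\<Sum>j. epow (epow (mx \<nu> 0 (h j) x) u) (1 - p * b) * epow (epow (N j) (u / p)) (1 - (1 - p * b)))"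
      proof (intro suminf_le)
        fix j
        have "epow (mx \<nu> b (h j) x) u \<le> epow (epow (mx \<nu> 0 (h j) x) (1 - p * b) * epow (N j) b) u"
          unfolding N_def using u h p b by (intro epow_mono mx_Hedberg[OF d]) auto
        also have "\<dots> = epow (epow (mx \<nu> 0 (h j) x) u) (1 - p * b) * epow (epow (N j) (u / p)) (1 - (1 - p * b))"
          using u p b by (simp add: epow_mult epow_epow mult.commute)
        finally show "epow (mx \<nu> b (h j) x) u \<le> epow (epow (mx \<nu> 0 (h j) x) u) (1 - p * b) * epow (epow (N j) (u / p)) (1 - (1 - p * b))" .
      qed auto
      also have "\<dots> \<le> epow (\<Sum>j. epow (mx \<nu> 0 (h j) x) u) (1 - p * b) * epow (\<Sum>j. epow (N j) (u / p)) (1 - (1 - p * b))"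
        using b pb by (intro suminf_Holder) auto
      also have "\<dots> \<le> epow (\<Sum>j. epow (mx \<nu> 0 (h j) x) u) (1 - p * b) * epow (epow M (u / p)) (1 - (1 - p * b))"
        using pb by (intro mult_left_mono epow_mono N) auto
      finally have "epow (\<Sum>j. epow (mx \<nu> b (h j) x) u) (q / u)
         \<le> epow (epow (\<Sum>j. epow (mx \<nu> 0 (h j) x) u) (1 - p * b) * epow (epow M (u / p)) (p * b)) (q / u)"
        using q0 u by (intro epow_mono) auto
      also have "\<dots> = epow (\<Sum>j. epow (mx \<nu> 0 (h j) x) u) ((1 - p * b) * (q / u)) * epow M (u / p * (p * b) * (q / u))"
        using q0 u p b pb by (simp add: epow_mult epow_epow)
      also have "(1 - p * b) * (q / u) = p / u" using qb(1) by simp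
      also have "u / p * (p * b) * (q / u) = b * q" using u p by simp
      finally show ?thesis .
    qed
    have "(\<integral>\<^sup>+x. epow (\<Sum>j. epow (mx \<nu> b (h j) x) u) (q / u) \<partial>\<nu>) \<le> (\<integral>\<^sup>+x. epow (\<Sum>j. epow (mx \<nu> 0 (h j) x) u) (p / u) * epow M (b * q) \<partial>\<nu>)"
      by (intro nn_integral_mono pt)
    also have "\<dots> = (\<integral>\<^sup>+x. epow (\<Sum>j. epow (mx \<nu> 0 (h j) x) u) (p / u) \<partial>\<nu>) * epow M (b * q)"
      by (rule nn_integral_multc) measurable
    also have "\<dots> \<le> (ennreal C * M) * epow M (b * q)"
      unfolding M_def by (intro mult_right_mono C(2) d h) auto
    also have "\<dots> = ennreal C * epow M (q / p)"
      using epow_add[of 1 "b * q" M] b q0 by (simp add: qb mult.assoc)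
    finally show "(\<integral>\<^sup>+x. epow (\<Sum>j. epow (mx \<nu> b (h j) x) u) (q / u) \<partial>\<nu>) \<le> ennreal C * epow (\<integral>\<^sup>+x. epow (\<Sum>j. epow (h j x) u) (p / u) \<partial>\<nu>) (q / p)"
      by (simp add: M_def)
  qed
qed

text \<open>Allows an a priori finite modular to be estimated instead of the given one:
  \<open>F\<close> is capped at N and restricted to \<open>A N\<close>. Where F = \<infinity> and W
  > 0 the capped integrands grow without bound because the exponent is positive, so nothing is lost
  in the limit.\<close>

lemma nn_integral_epow_le_truncation:
  fixes F W :: "'b \<Rightarrow> ennreal" and q :: "'b \<Rightarrow> real" and A :: "nat \<Rightarrow> 'b set"
  assumes [measurable]: "F \<in> borel_measurable M" "W \<in> borel_measurable M" "q \<in> borel_measurable M"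
    "\<And>N. A N \<in> sets M"
    and A: "incseq A" "AE x in M. \<exists>N. x \<in> A N" and q: "AE x in M. 0 < q x"
    and le: "\<And>N. (\<integral>\<^sup>+x. epow (min (F x) (of_nat N)) (q x) * W x * indicator (A N) x \<partial>M) \<le> X"
  shows "(\<integral>\<^sup>+x. epow (F x) (q x) * W x \<partial>M) \<le> X"
proof -
  \<comment> \<open>The exponent is positive only almost everywhere; \<open>max 0\<close> makes the
    sequence monotone at every point, as the convergence theorem asks.\<close>
  let ?f = "\<lambda>N x. epow (min (F x) (of_nat N)) (max 0 (q x)) * W x * indicator (A N) x"
  have "(\<integral>\<^sup>+x. epow (F x) (q x) * W x \<partial>M) \<le> (\<integral>\<^sup>+x. (SUP N. ?f N x) \<partial>M)"
  proof (rule nn_integral_mono_AE, use A(2) q in eventually_elim)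
    case (elim x)
    then obtain N0 where N0: "x \<in> A N0" by blast
    have in_A: "x \<in> A N" if "N0 \<le> N" for N using A(1) N0 that by (auto simp: incseq_def)
    have up: "epow (min (F x) (of_nat N)) (q x) * W x \<le> (SUP N. ?f N x)" if "N0 \<le> N" for N
      using in_A[OF that] elim by (intro SUP_upper2[of N]) auto
    show "epow (F x) (q x) * W x \<le> (SUP N. ?f N x)"
    proof (cases "F x = top")
      case False
      then obtain N where "F x \<le> of_nat N"
        by (metis ennreal_Ex_less_of_nat less_imp_le top.not_eq_extremum)
      then have "F x \<le> of_nat (max N N0)"
        by (meson max.cobounded1 of_nat_mono order_trans)
      then show ?thesis using up[of "max N N0"] by (simp add: min_absorb1)
    next
      case True
      show ?thesis
      proof (cases "W x = 0 \<or> (SUP N. ?f N x) = top")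
        case False
        then obtain s where s: "(SUP N. ?f N x) = ennreal s" "0 \<le> s"
          by (cases "SUP N. ?f N x") auto
        have up': "ennreal (real N powr q x) * W x \<le> ennreal s" if "N0 \<le> N" for N
          using up[OF that] True unfolding s(1) by (simp add: epow_ennreal flip: ennreal_of_nat_eq_real_of_nat)
            (simp add: ennreal_of_nat_eq_real_of_nat epow_ennreal)
        have "W x \<noteq> top"
          using up'[of "Suc N0"] by (auto simp: ennreal_mult_top top_unique)
        then obtain w where w: "W x = ennreal w" "0 < w"
          using False by (cases "W x") (auto simp: less_le)
        define N where "N = max N0 (nat \<lceil>((s + 1) / w) powr (1 / q x)\<rceil>)"
        have "((s + 1) / w) powr (1 / q x) \<le> real N" unfolding N_def by linarith
        then have "(((s + 1) / w) powr (1 / q x)) powr q x \<le> real N powr q x"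
          using elim by (intro powr_mono2) auto
        then have "(s + 1) / w \<le> real N powr q x"
          using elim s w by (simp add: powr_powr)
        then have "s + 1 \<le> real N powr q x * w" using w by (simp add: field_simps)
        moreover have "real N powr q x * w \<le> s"
          using up'[of N] w s by (simp add: N_def flip: ennreal_mult)
        ultimately show ?thesis by simp
      next
        case True
        then show ?thesis by (elim disjE) (simp, simp only: top_greatest)
      qed
    qed
  qed
  also have "\<dots> = (SUP N. \<integral>\<^sup>+x. ?f N x \<partial>M)"
  proof (rule nn_integral_monotone_convergence_SUP)
    show "incseq ?f"
      using A(1) by (auto simp: incseq_def le_fun_def split: split_indicator intro!: mult_right_mono epow_mono min.mono)
  qed measurable
  also have "\<dots> \<le> X"
  proof (rule SUP_least)
    fix N
    have "(\<integral>\<^sup>+x. ?f N x \<partial>M) = (\<integral>\<^sup>+x. epow (min (F x) (of_nat N)) (q x) * W x * indicator (A N) x \<partial>M)"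
      by (intro nn_integral_cong_AE) (use q in eventually_elim, simp)
    then show "(\<integral>\<^sup>+x. ?f N x \<partial>M) \<le> X" using le[of N] by simp
  qed
  finally show ?thesis .
qed

text \<open>The hypothesis \<open>strong\<close> is the unweighted inequality on V d\<nu>. Applied
  to h_j V^{-b} it becomes a weighted inequality on \<nu>: on the right the density V and the factor
  V^{-bp} combine to V^{1 - pb}. The power of \<open>K\<close> is the loss in
  \<open>mx_le_mx_density\<close>.\<close>

lemma mx_vector_weighted:
  fixes h :: "nat \<Rightarrow> 'a::euclidean_space \<Rightarrow> ennreal"
  assumes d: "doubling D \<nu>" and A: "A1 K \<nu> V" and h: "\<forall>j. h j \<in> borel_measurable lebesgue"
    and b: "0 \<le> b" "b \<le> 1" and u: "0 < u" and p: "0 < p" and q: "0 < q"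
    and strong: "\<And>k :: nat \<Rightarrow> 'a \<Rightarrow> ennreal. (\<forall>j. k j \<in> borel_measurable lebesgue) \<Longrightarrow>
      (\<integral>\<^sup>+x. epow (\<Sum>j. epow (mx (density \<nu> V) b (k j) x) u) (q / u) \<partial>density \<nu> V)
        \<le> ennreal C * epow (\<integral>\<^sup>+x. epow (\<Sum>j. epow (k j x) u) (p / u) \<partial>density \<nu> V) (q / p)"
  shows "(\<integral>\<^sup>+x. epow (\<Sum>j. epow (mx \<nu> b (h j) x) u) (q / u) * ennreal (V x) \<partial>\<nu>)
    \<le> ennreal (K powr ((1 - b) * q)) * (ennreal C *
        epow (\<integral>\<^sup>+x. epow (\<Sum>j. epow (h j x) u) (p / u) * ennreal (V x powr (1 - p * b)) \<partial>\<nu>) (q / p))"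
proof -
  note bm = doubling_borel[OF d]
  have K: "0 < K" and V: "0 < V x" for x using A1_D[OF d A] by auto
  have [measurable]: "V \<in> borel_measurable \<nu>" "V \<in> borel_measurable lebesgue"
    using A1_D(2,3)[OF d A] by auto
  have hm [measurable]: "h j \<in> borel_measurable \<nu>" "h j \<in> borel_measurable lebesgue" for j using h by (simp_all add: bm)
  define k where "k j x = h j x * ennreal (V x powr (- b))" for j x
  have k [measurable]: "k j \<in> borel_measurable lebesgue" "k j \<in> borel_measurable \<nu>" for j
    unfolding k_def by measurable
  have [measurable]: "mx (density \<nu> V) b (k j) \<in> borel_measurable \<nu>" for j by (simp add: bm)
  let ?c = "ennreal (K powr ((1 - b) * q))"
  have "(\<integral>\<^sup>+x. epow (\<Sum>j. epow (mx \<nu> b (h j) x) u) (q / u) * ennreal (V x) \<partial>\<nu>)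
    \<le> (\<integral>\<^sup>+x. ?c * (ennreal (V x) * epow (\<Sum>j. epow (mx (density \<nu> V) b (k j) x) u) (q / u)) \<partial>\<nu>)"
  proof (rule nn_integral_mono)
    fix x
    have "(\<Sum>j. epow (mx \<nu> b (h j) x) u) \<le> (\<Sum>j. epow (ennreal (K powr (1 - b)) * mx (density \<nu> V) b (k j) x) u)"
      unfolding k_def using u b h by (intro suminf_le epow_mono mx_le_mx_density[OF d A]) auto
    also have "\<dots> = ennreal (K powr ((1 - b) * u)) * (\<Sum>j. epow (mx (density \<nu> V) b (k j) x) u)"
      using u by (simp add: epow_mult epow_ennreal powr_powr)
    finally have "epow (\<Sum>j. epow (mx \<nu> b (h j) x) u) (q / u)
      \<le> epow (ennreal (K powr ((1 - b) * u)) * (\<Sum>j. epow (mx (density \<nu> V) b (k j) x) u)) (q / u)"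
      using u q by (intro epow_mono) auto
    also have "\<dots> = ?c * epow (\<Sum>j. epow (mx (density \<nu> V) b (k j) x) u) (q / u)"
      using u q by (simp add: epow_mult epow_ennreal powr_powr)
    finally have "epow (\<Sum>j. epow (mx \<nu> b (h j) x) u) (q / u) * ennreal (V x)
       \<le> ?c * epow (\<Sum>j. epow (mx (density \<nu> V) b (k j) x) u) (q / u) * ennreal (V x)"
      by (rule mult_right_mono) simp
    then show "epow (\<Sum>j. epow (mx \<nu> b (h j) x) u) (q / u) * ennreal (V x)
       \<le> ?c * (ennreal (V x) * epow (\<Sum>j. epow (mx (density \<nu> V) b (k j) x) u) (q / u))"
      by (simp only: mult_ac)
  qed
  also have "\<dots> = ?c * (\<integral>\<^sup>+x. ennreal (V x) * epow (\<Sum>j. epow (mx (density \<nu> V) b (k j) x) u) (q / u) \<partial>\<nu>)"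
    by (rule nn_integral_cmult) measurable
  also have "(\<integral>\<^sup>+x. ennreal (V x) * epow (\<Sum>j. epow (mx (density \<nu> V) b (k j) x) u) (q / u) \<partial>\<nu>)
    = (\<integral>\<^sup>+x. epow (\<Sum>j. epow (mx (density \<nu> V) b (k j) x) u) (q / u) \<partial>density \<nu> V)"
    by (subst nn_integral_density) auto
  also have "\<dots> \<le> ennreal C * epow (\<integral>\<^sup>+x. epow (\<Sum>j. epow (k j x) u) (p / u) \<partial>density \<nu> V) (q / p)"
    by (rule strong) (simp add: k)
  also have "(\<integral>\<^sup>+x. epow (\<Sum>j. epow (k j x) u) (p / u) \<partial>density \<nu> V)
     = (\<integral>\<^sup>+x. ennreal (V x) * epow (\<Sum>j. epow (k j x) u) (p / u) \<partial>\<nu>)"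
    by (subst nn_integral_density) auto
  also have "\<dots> = (\<integral>\<^sup>+x. epow (\<Sum>j. epow (h j x) u) (p / u) * ennreal (V x powr (1 - p * b)) \<partial>\<nu>)"
  proof (rule nn_integral_cong)
    fix x
    have "(\<Sum>j. epow (k j x) u) = (\<Sum>j. epow (h j x) u) * ennreal (V x powr (- b * u))"
      using u V[of x] by (simp add: k_def epow_mult epow_ennreal powr_powr)
    then have "ennreal (V x) * epow (\<Sum>j. epow (k j x) u) (p / u) = epow (\<Sum>j. epow (h j x) u) (p / u) * (ennreal (V x) * ennreal (V x powr (- b * p)))"
      using u p by (simp add: epow_mult epow_ennreal powr_powr mult_ac)
    also have "ennreal (V x) * ennreal (V x powr (- b * p)) = ennreal (V x powr (1 - p * b))"
      using V[of x] powr_add[of "V x" 1 "- b * p"] by (simp add: mult.commute flip: ennreal_mult)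
    finally show "ennreal (V x) * epow (\<Sum>j. epow (k j x) u) (p / u) = epow (\<Sum>j. epow (h j x) u) (p / u) * ennreal (V x powr (1 - p * b))" .
  qed
  finally show ?thesis by (simp add: mult_left_mono)
qed

text \<open>Keep b and let q1 be the target exponent belonging to p = u, so 1/q1 = 1/u - b. With F
  the l^u norm of the maximal functions, F^q = F^{q1} F^{q - q1}; the second factor is replaced by
  an A_1 majorant V, and the inequality for p = u on V d\<nu> bounds the integral of F^{q1} V.
  Hoelder splits the result into the data and a power of the very integral being estimated.\<close>

lemma mx_vector_strong_gt:
  assumes D: "0 < D" and u: "1 < u" "u < p" and b: "0 \<le> b" "p * b < 1" and q: "q = p / (1 - p * b)"
  shows "\<exists>C>0. \<forall>\<nu> (h :: nat \<Rightarrow> 'a::euclidean_space \<Rightarrow> ennreal). doubling D \<nu> \<longrightarrow> (\<forall>j. h j \<in> borel_measurable lebesgue) \<longrightarrow>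
     (\<integral>\<^sup>+x. epow (\<Sum>j. epow (mx \<nu> b (h j) x) u) (q / u) \<partial>\<nu>) \<le> ennreal C * epow (\<integral>\<^sup>+x. epow (\<Sum>j. epow (h j x) u) (p / u) \<partial>\<nu>) (q / p)"
proof -
  have p: "1 < p" using u by simp
  have ub: "u * b < 1" using b u by (smt (verit) mult_right_mono)
  have b1: "b \<le> 1" using b p by (smt (verit) mult_le_cancel_right1)
  define q1 where "q1 = u / (1 - u * b)"
  have q1i: "1 / q1 = 1 / u - b" using u ub by (simp add: q1_def field_simps)
  have qi: "1 / q = 1 / p - b" unfolding q using p by (simp add: diff_divide_distrib)
  have q1: "0 < q1" using u ub by (simp add: q1_def)
  have q0: "0 < q" using p b q by simp
  have "1 / q < 1 / q1" unfolding qi q1i using u p by (simp add: field_simps)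
  then have qq: "q1 < q" using q0 q1 by (simp add: field_simps)
  have q1u: "u / q1 = 1 - u * b" using u ub by (simp add: q1_def)
  \<comment> \<open>The conjugate exponent of q / q1, so that (F^{q - q1})^t = F^q.\<close>
  define t where "t = q / (q - q1)"
  have t: "1 < t" using qq q1 by (simp add: t_def field_simps)
  have up: "0 < u / p" "u / p < 1" using u p by auto
  \<comment> \<open>This identity makes V^{1 - ub} equal to (V^t)^{1 - u/p}, so that Hoelder with
    exponent p/u lands on the controlled integral of V^t.\<close>
  have t1: "t * (1 - u / p) = 1 - u * b"
  proof -
    have "(1 - q1 / q) * (1 - u * b) = 1 - u / p"
    proof -
      have "q1 / q = q1 * (1 / q)" by simp
      also have "\<dots> = q1 * (1 / p - b)" using qi by simp
      finally show ?thesis using u p ub by (simp add: q1_def field_simps)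
    qed
    moreover have "t * (1 - q1 / q) = 1" using q0 qq by (simp add: t_def field_simps)
    ultimately show ?thesis by (metis mult.assoc mult_1)
  qed
  define K where "K = 2 * strong_const D t powr (1 / t)"
  have K: "0 < K" using strong_const_pos[OF D t] by (simp add: K_def)
  obtain C1 where C1: "0 < C1" "\<And>\<nu> (h :: nat \<Rightarrow> 'a \<Rightarrow> ennreal). doubling (K * D) \<nu> \<Longrightarrow> (\<forall>j. h j \<in> borel_measurable lebesgue) \<Longrightarrow>
     (\<integral>\<^sup>+x. epow (\<Sum>j. epow (mx \<nu> b (h j) x) u) (q1 / u) \<partial>\<nu>) \<le> ennreal C1 * epow (\<integral>\<^sup>+x. epow (\<Sum>j. epow (h j x) u) (u / u) \<partial>\<nu>) (q1 / u)"
    using mx_vector_strong_le[of "K * D" u u b q1] K D u b ub q1_def by (metis mult_pos_pos order_refl)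
  define C2 where "C2 = K powr ((1 - b) * q1) * C1 * (2 powr t) powr ((1 - u / p) * (q1 / u))"
  have C2: "0 < C2" using K C1 by (simp add: C2_def)
  define C where "C = C2 powr (q / q1)"
  show ?thesis
  proof (intro exI[of _ C] conjI allI impI)
    show "0 < C" using C2 by (simp add: C_def)
    fix \<nu> :: "'a measure" and h :: "nat \<Rightarrow> 'a \<Rightarrow> ennreal"
    assume d: "doubling D \<nu>" and h: "\<forall>j. h j \<in> borel_measurable lebesgue"
    note bm = doubling_borel[OF d]
    have h1 [measurable]: "h j \<in> borel_measurable \<nu>" "h j \<in> borel_measurable lebesgue" for j using h by (simp_all add: bm)
    have mm [measurable]: "mx \<nu> b (h j) \<in> borel_measurable \<nu>" for j by (simp add: bm)
    define M where "M = (\<integral>\<^sup>+x. epow (\<Sum>j. epow (h j x) u) (p / u) \<partial>\<nu>)"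
    define F where "F x = epow (\<Sum>j. epow (mx \<nu> b (h j) x) u) (1 / u)" for x
    have F [measurable]: "F \<in> borel_measurable \<nu>" "F \<in> borel_measurable lebesgue" unfolding F_def by measurable
    have Fq: "epow (\<Sum>j. epow (mx \<nu> b (h j) x) u) (s / u) = epow (F x) s" for s x
      using u by (simp add: F_def epow_epow)
    show "(\<integral>\<^sup>+x. epow (\<Sum>j. epow (mx \<nu> b (h j) x) u) (q / u) \<partial>\<nu>) \<le> ennreal C * epow (\<integral>\<^sup>+x. epow (\<Sum>j. epow (h j x) u) (p / u) \<partial>\<nu>) (q / p)"
      unfolding Fq M_def[symmetric]
    proof (cases "M = top")
      case True
      then show "(\<integral>\<^sup>+x. epow (F x) q \<partial>\<nu>) \<le> ennreal C * epow M (q / p)"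
        using C2 by (simp add: C_def ennreal_mult_top)
    next
      case Mfin: False
      have "(\<integral>\<^sup>+x. epow (F x) q * 1 \<partial>\<nu>) \<le> ennreal C * epow M (q / p)"
      proof (rule nn_integral_epow_le_truncation[where A = "\<lambda>N. ball 0 (real N)"])
        show "incseq (\<lambda>N. ball (0::'a) (real N))" by (auto simp: incseq_def)
        show "AE x in \<nu>. \<exists>N. x \<in> ball (0::'a) (real N)"
          by (intro AE_I2) (use reals_Archimedean2 in auto)
        show "ball (0::'a) (real N) \<in> sets \<nu>" for N by (simp add: doubling_sets[OF d])
        fix N :: nat
        have [measurable]: "ball (0::'a) (real N) \<in> sets \<nu>" by (simp add: doubling_sets[OF d])
        define FN where "FN x = min (F x) (of_nat N) * indicator (ball 0 (real N)) x" for x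
        have FN [measurable]: "FN \<in> borel_measurable lebesgue"
          unfolding FN_def
          by (intro borel_measurable_times_ennreal borel_measurable_min borel_measurable_indicator F borel_measurable_const) simp
        then have [measurable]: "FN \<in> borel_measurable \<nu>" by (simp add: bm)
        have FNq: "epow (min (F x) (of_nat N)) s * 1 * indicator (ball 0 (real N)) x = epow (FN x) s" for s x
          by (auto simp: FN_def split: split_indicator)
        have FN_le: "FN x \<le> F x" for x by (auto simp: FN_def split: split_indicator)
        define m where "m = (\<integral>\<^sup>+x. epow (FN x) q \<partial>\<nu>)"
        obtain a s where as: "a \<in> dense_pts" "s \<in> \<rat>" "0 < s" "cball (0::'a) (real N + 1) \<subseteq> ball a s"
          by (rule qball_containing_cball[of "real N + 1" "0::'a"]) auto
        have "m \<le> (\<integral>\<^sup>+x. ennreal (real N powr q) * indicator (ball a s) x \<partial>\<nu>)"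
          unfolding m_def
        proof (rule nn_integral_mono)
          fix x
          show "epow (FN x) q \<le> ennreal (real N powr q) * indicator (ball a s) x"
          proof (cases "x \<in> ball 0 (real N)")
            case True
            then have "x \<in> ball a s" using as(4) by (auto simp: subset_iff)
            moreover have "epow (FN x) q \<le> epow (of_nat N) q"
              using q0 True by (intro epow_mono) (auto simp: FN_def)
            ultimately show ?thesis by (simp add: ennreal_of_nat_eq_real_of_nat epow_ennreal)
          qed (simp add: FN_def)
        qed
        also have "\<dots> < top"
          using doubling_qball(1,3)[OF d qballsI[OF as(1-3)]]
          by (simp add: nn_integral_cmult_indicator ennreal_mult_less_top)
        finally have mfin: "m < top" .
        show "(\<integral>\<^sup>+x. epow (min (F x) (of_nat N)) q * 1 * indicator (ball 0 (real N)) x \<partial>\<nu>) \<le> ennreal C * epow M (q / p)"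
          unfolding FNq m_def[symmetric]
        proof (cases "m = 0")
          case False
          define \<phi> where "\<phi> x = epow (FN x) (q - q1)" for x
          have [measurable]: "\<phi> \<in> borel_measurable \<nu>" "\<phi> \<in> borel_measurable lebesgue" unfolding \<phi>_def by measurable
          have \<phi>t: "epow (\<phi> x) t = epow (FN x) q" for x
            using qq by (simp add: \<phi>_def epow_epow t_def)
          have "\<exists>V. A1 K \<nu> V \<and> (AE x in \<nu>. \<phi> x \<le> ennreal (V x)) \<and>
             (\<integral>\<^sup>+x. ennreal (V x powr t) \<partial>\<nu>) \<le> ennreal (2 powr t) * (\<integral>\<^sup>+x. epow (\<phi> x) t \<partial>\<nu>)"
            unfolding K_def
          proof (rule Rubio_de_Francia_Lp[OF d t])
            show "(\<integral>\<^sup>+x. epow (\<phi> x) t \<partial>\<nu>) < top" using mfin by (simp add: \<phi>t m_def)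
            show "\<not> (AE x in \<nu>. \<phi> x = 0)"
            proof
              assume "AE x in \<nu>. \<phi> x = 0"
              then have "m = (\<integral>\<^sup>+x. 0 \<partial>\<nu>)"
                unfolding m_def by (intro nn_integral_cong_AE) (auto simp: \<phi>_def elim!: eventually_mono)
              with False show False by simp
            qed
          qed simp
          then obtain V where A: "A1 K \<nu> V" and V: "AE x in \<nu>. \<phi> x \<le> ennreal (V x)"
            and Vt: "(\<integral>\<^sup>+x. ennreal (V x powr t) \<partial>\<nu>) \<le> ennreal (2 powr t) * m"
            unfolding \<phi>t m_def by blast
          have [measurable]: "V \<in> borel_measurable \<nu>" using A1_D(3)[OF d A] .
          have Vpos: "0 < V x" for x using A1_D(4)[OF d A] .
          let ?H = "\<lambda>x. (\<Sum>j. epow (h j x) u)"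
          have "m \<le> (\<integral>\<^sup>+x. epow (F x) q1 * ennreal (V x) \<partial>\<nu>)"
            unfolding m_def
          proof (rule nn_integral_mono_AE, use V in eventually_elim)
            case (elim x)
            have "epow (FN x) q = epow (FN x) q1 * \<phi> x"
              using qq q1 unfolding \<phi>_def by (subst epow_add[symmetric]) auto
            also have "\<dots> \<le> epow (F x) q1 * ennreal (V x)"
              using elim q1 by (intro mult_mono epow_mono FN_le) auto
            finally show "epow (FN x) q \<le> epow (F x) q1 * ennreal (V x)" .
          qed
          also have "\<dots> \<le> ennreal (K powr ((1 - b) * q1)) * (ennreal C1 *
              epow (\<integral>\<^sup>+x. epow (?H x) (u / u) * ennreal (V x powr (1 - u * b)) \<partial>\<nu>) (q1 / u))"
            unfolding Fq[symmetric]
            using u b b1 q1 h by (intro mx_vector_weighted[OF d A] C1(2) A1_density(1)[OF d A]) auto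
          also have "(\<integral>\<^sup>+x. epow (?H x) (u / u) * ennreal (V x powr (1 - u * b)) \<partial>\<nu>)
             = (\<integral>\<^sup>+x. epow (epow (?H x) (p / u)) (u / p) * epow (ennreal (V x powr t)) (1 - u / p) \<partial>\<nu>)"
            using u p by (intro nn_integral_cong) (simp add: epow_epow epow_ennreal powr_powr t1)
          also have "epow \<dots> (q1 / u) \<le> epow (epow M (u / p) * epow (\<integral>\<^sup>+x. ennreal (V x powr t) \<partial>\<nu>) (1 - u / p)) (q1 / u)"
            unfolding M_def using up u q1 by (intro epow_mono nn_integral_Holder) auto
          also have "\<dots> \<le> epow (epow M (u / p) * epow (ennreal (2 powr t) * m) (1 - u / p)) (q1 / u)"
            using up u q1 by (intro epow_mono mult_left_mono Vt) auto
          also have "\<dots> = ennreal ((2 powr t) powr ((1 - u / p) * (q1 / u))) * (epow M (q1 / p) * epow m ((1 - u / p) * (q1 / u)))"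
            using up u q1 by (simp add: epow_mult epow_epow epow_ennreal powr_powr mult_ac)
          finally have "m \<le> ennreal (K powr ((1 - b) * q1)) * (ennreal C1 * (ennreal ((2 powr t) powr ((1 - u / p) * (q1 / u))) * (epow M (q1 / p) * epow m ((1 - u / p) * (q1 / u)))))"
            by (simp add: mult_left_mono)
          also have "\<dots> = ennreal C2 * (epow M (q1 / p) * epow m ((1 - u / p) * (q1 / u)))"
            using K C1 by (simp add: C2_def ennreal_mult mult_ac)
          also have "(1 - u / p) * (q1 / u) = 1 - q1 / q"
          proof -
            have "(1 - u / p) * (q1 / u) = q1 * (1 / u - 1 / p)" using u by (simp add: field_simps)
            also have "\<dots> = q1 * (1 / q1 - 1 / q)" using q1i qi by simp
            also have "\<dots> = 1 - q1 / q" using q1 by (simp add: right_diff_distrib)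
            finally show ?thesis .
          qed
          finally have mle: "m \<le> ennreal C2 * (epow M (q1 / p) * epow m (1 - q1 / q))" .
          \<comment> \<open>Dividing by m^{1 - q1/q} is legitimate: m is nonzero in this case and
            finite by truncation. What remains is m^{q1/q}, raised to the power q/q1.\<close>
          obtain m' where m': "m = ennreal m'" "0 < m'"
            using False mfin by (cases m) (auto simp: less_le)
          obtain M' where M': "M = ennreal M'" "0 \<le> M'"
            using Mfin by (cases M) auto
          have "m' \<le> C2 * (M' powr (q1 / p) * m' powr (1 - q1 / q))"
            using mle m' M' C2 by (simp add: epow_ennreal flip: ennreal_mult)
          moreover have "m' powr (1 - q1 / q) = m' / m' powr (q1 / q)"
            using m' by (simp add: powr_diff)
          ultimately have "m' powr (q1 / q) \<le> C2 * M' powr (q1 / p)"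
            using m' by (simp add: field_simps)
          then have "(m' powr (q1 / q)) powr (q / q1) \<le> (C2 * M' powr (q1 / p)) powr (q / q1)"
            using q0 q1 by (intro powr_mono2) auto
          also have "\<dots> = C * M' powr (q / p)"
            using C2 q1 by (simp add: powr_mult powr_powr C_def)
          finally have "m' \<le> C * M' powr (q / p)"
            using m' q0 q1 by (simp add: powr_powr)
          then show "m \<le> ennreal C * epow M (q / p)"
            using m' M' C2 by (simp add: epow_ennreal C_def flip: ennreal_mult)
        qed simp
      qed (use q0 in auto)
      then show "(\<integral>\<^sup>+x. epow (F x) q \<partial>\<nu>) \<le> ennreal C * epow M (q / p)" by simp
    qed
  qed
qed

lemma mx_vector_strong_type:
  assumes D: "0 < D" and u: "1 < u" and p: "1 < p" and b: "0 \<le> b" "p * b < 1" and q: "q = p / (1 - p * b)"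
  shows "\<exists>C>0. \<forall>\<nu> (h :: nat \<Rightarrow> 'a::euclidean_space \<Rightarrow> ennreal). doubling D \<nu> \<longrightarrow> (\<forall>j. h j \<in> borel_measurable lebesgue) \<longrightarrow>
     (\<integral>\<^sup>+x. epow (\<Sum>j. epow (mx \<nu> b (h j) x) u) (q / u) \<partial>\<nu>) \<le> ennreal C * epow (\<integral>\<^sup>+x. epow (\<Sum>j. epow (h j x) u) (p / u) \<partial>\<nu>) (q / p)"
  using mx_vector_strong_le[OF D p _ b q] mx_vector_strong_gt[OF D u _ b q] by (cases "p \<le> u") auto

section \<open>Lebesgue measure and variable exponents\<close>

lemma measure_lebesgue_ball:
  fixes a :: "'a::euclidean_space"
  shows "0 \<le> r \<Longrightarrow> measure lebesgue (ball a r) = unit_ball_vol (real DIM('a)) * r ^ DIM('a)"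
  using content_ball[of r a] by simp

lemma measure_lebesgue_cube:
  fixes a :: "'a::euclidean_space"
  assumes "0 < h"
  shows "measure lebesgue (cbox a (a + h *\<^sub>R One)) = h ^ DIM('a)"
proof -
  have "measure lborel (cbox a (a + h *\<^sub>R One)) = (\<Prod>i\<in>Basis. (a + h *\<^sub>R One) \<bullet> i - a \<bullet> i)"
    using assms by (subst content_cbox) (auto simp: inner_simps)
  also have "\<dots> = (\<Prod>i\<in>(Basis :: 'a set). h)"
    by (intro prod.cong) (auto simp: inner_simps)
  finally show ?thesis by simp
qed

lemma doubling_lebesgue: "doubling (5 ^ DIM('a)) (lebesgue :: 'a::euclidean_space measure)"
  unfolding doubling_def
proof (intro conjI ballI impI)
  fix a :: 'a and r :: real assume r: "0 < r"
  have em: "emeasure lebesgue (ball a s) = ennreal (unit_ball_vol (real DIM('a)) * s ^ DIM('a))" if "0 < s" for s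
    using emeasure_ball[of s a] that by simp
  show "0 < emeasure lebesgue (ball a r)" "emeasure lebesgue (ball a r) < top"
    unfolding em[OF r] using r by simp_all
  show "emeasure lebesgue (ball a (5 * r)) \<le> ennreal (5 ^ DIM('a)) * emeasure lebesgue (ball a r)"
    unfolding em[OF r] using r em[of "5 * r"]
    by (simp add: power_mult_distrib mult.left_commute flip: ennreal_mult)
qed auto

text \<open>A cube of side h through x lies in the ball of radius n h about x, since the Euclidean
  norm is at most the l^1 norm, and hence in a ball of \<open>qballs\<close> of radius below 3 n h.
  The constant \<open>c\<close> bounds the ratio of volumes; the negative exponent b - 1 reverses
  that comparison.\<close>

lemma frac_max_le_mx:
  fixes f :: "'a::euclidean_space \<Rightarrow> real"
  assumes b: "\<beta> / real DIM('a) < 1"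
  shows "\<exists>C>0. \<forall>(f :: 'a \<Rightarrow> real) x. frac_max \<beta> f x \<le> ennreal C * mx lebesgue (\<beta> / real DIM('a)) (\<lambda>y. ennreal \<bar>f y\<bar>) x"
proof -
  define n where "n = real DIM('a)"
  have n: "1 \<le> n" unfolding n_def by (simp add: Suc_leI)
  define c where "c = unit_ball_vol n * (3 * n) ^ DIM('a)"
  have c: "0 < c" using n by (simp add: c_def)
  define b where "b = \<beta> / real DIM('a)"
  show ?thesis
  proof (intro exI[of _ "c powr (1 - b)"] conjI allI)
    show "0 < c powr (1 - b)" using c by simp
    fix f :: "'a \<Rightarrow> real" and x
    show "frac_max \<beta> f x \<le> ennreal (c powr (1 - b)) * mx lebesgue (\<beta> / real DIM('a)) (\<lambda>y. ennreal \<bar>f y\<bar>) x"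
      unfolding frac_max_def b_def[symmetric]
    proof (rule SUP_least, clarify)
      fix Q :: "'a set" assume "is_cube Q" and x: "x \<in> Q"
      then obtain a h where Q: "0 < h" "Q = cbox a (a + h *\<^sub>R One)" by (auto simp: is_cube_def)
      have nh: "0 < n * h" using n Q by simp
      obtain a' r where B: "a' \<in> dense_pts" "r \<in> \<rat>" "0 < r" "cball x (n * h) \<subseteq> ball a' r" "r < 3 * (n * h)"
        by (rule qball_containing_cball[OF nh, of x]) auto
      have "Q \<subseteq> cball x (n * h)"
      proof
        fix y assume "y \<in> Q"
        have "norm (x - y) \<le> (\<Sum>i\<in>Basis. \<bar>(x - y) \<bullet> i\<bar>)" by (rule norm_le_l1)
        also have "\<dots> \<le> (\<Sum>i\<in>(Basis :: 'a set). h)"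
        proof (rule sum_mono)
          fix i :: 'a assume i: "i \<in> Basis"
          then have "a \<bullet> i \<le> x \<bullet> i" "x \<bullet> i \<le> a \<bullet> i + h" "a \<bullet> i \<le> y \<bullet> i" "y \<bullet> i \<le> a \<bullet> i + h"
            using x \<open>y \<in> Q\<close> unfolding Q(2) mem_box by (auto simp: inner_simps)
          then show "\<bar>(x - y) \<bullet> i\<bar> \<le> h" by (simp add: inner_simps)
        qed
        finally show "y \<in> cball x (n * h)" by (simp add: dist_norm n_def)
      qed
      then have QB: "Q \<subseteq> ball a' r" using B by blast
      let ?B = "ball a' r"
      have qB: "?B \<in> qballs" using B by (intro qballsI)
      have mQ: "measure lebesgue Q = h ^ DIM('a)" using measure_lebesgue_cube Q by simp
      have mB: "measure lebesgue ?B = unit_ball_vol n * r ^ DIM('a)" using measure_lebesgue_ball[of r a'] B by (simp add: n_def)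
      have "measure lebesgue ?B \<le> unit_ball_vol n * (3 * (n * h)) ^ DIM('a)"
        unfolding mB using B n by (intro mult_left_mono power_mono) auto
      also have "\<dots> = c * measure lebesgue Q" by (simp add: c_def mQ power_mult_distrib)
      finally have le: "measure lebesgue ?B / c \<le> measure lebesgue Q"
        using c by (simp add: field_simps)
      have pos: "0 < measure lebesgue ?B" unfolding mB using B n by simp
      have "measure lebesgue Q powr (b - 1) \<le> (measure lebesgue ?B / c) powr (b - 1)"
        using le pos c assms by (intro powr_mono2') (auto simp: b_def)
      also have "\<dots> = c powr (1 - b) * measure lebesgue ?B powr (b - 1)"
        using pos c powr_minus[of c "b - 1"] by (simp add: powr_divide field_simps)
      finally have "ennreal (measure lebesgue Q powr (b - 1)) * (\<integral>\<^sup>+y\<in>Q. ennreal \<bar>f y\<bar> \<partial>lebesgue)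
        \<le> ennreal (c powr (1 - b) * measure lebesgue ?B powr (b - 1)) * (\<integral>\<^sup>+y\<in>?B. ennreal \<bar>f y\<bar> \<partial>lebesgue)"
        using QB by (intro mult_mono ennreal_leI nn_integral_mono) (auto split: split_indicator)
      also have "\<dots> = ennreal (c powr (1 - b)) * (ennreal (measure lebesgue ?B powr (b - 1)) * (\<integral>\<^sup>+y\<in>?B. ennreal \<bar>f y\<bar> \<partial>lebesgue))"
        by (subst ennreal_mult) (simp_all only: mult.assoc powr_ge_zero)
      also have "\<dots> \<le> ennreal (c powr (1 - b)) * mx lebesgue b (\<lambda>y. ennreal \<bar>f y\<bar>) x"
        using QB x by (intro mult_left_mono mx_ge qB) auto
      finally show "ennreal (measure lebesgue Q powr (b - 1)) * (\<integral>\<^sup>+y\<in>Q. ennreal \<bar>f y\<bar> \<partial>lebesgue)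
        \<le> ennreal (c powr (1 - b)) * mx lebesgue b (\<lambda>y. ennreal \<bar>f y\<bar>) x" .
    qed
  qed
qed

text \<open>A ball of radius r lies in the concentric cube of side 2 r, and \<open>c\<close> is the
  ratio of their volumes.\<close>

lemma mx_le_hl_max:
  "\<exists>C>0. \<forall>(f :: 'a::euclidean_space \<Rightarrow> real) x. mx lebesgue 0 (\<lambda>y. ennreal \<bar>f y\<bar>) x \<le> ennreal C * hl_max f x"
proof -
  define c where "c = 2 ^ DIM('a) / unit_ball_vol (real DIM('a))"
  have c: "0 < c" by (simp add: c_def)
  show ?thesis
  proof (intro exI[of _ c] conjI allI c)
    fix f :: "'a \<Rightarrow> real" and x
    show "mx lebesgue 0 (\<lambda>y. ennreal \<bar>f y\<bar>) x \<le> ennreal c * hl_max f x"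
    proof (rule mx_le)
      fix B :: "'a set" assume "B \<in> qballs" and x: "x \<in> B"
      then obtain a r where B: "B = ball a r" "0 < r" by (auto simp: qballs_def)
      define Q where "Q = cbox (a - r *\<^sub>R One) (a - r *\<^sub>R One + (2 * r) *\<^sub>R (One :: 'a))"
      have BQ: "B \<subseteq> Q"
      proof
        fix y assume "y \<in> B"
        have "\<bar>(a - y) \<bullet> i\<bar> < r" if "i \<in> Basis" for i
          using Basis_le_norm[OF that, of "a - y"] \<open>y \<in> B\<close> B by (simp add: dist_norm)
        then show "y \<in> Q"
          unfolding Q_def mem_box by (force simp: inner_simps abs_less_iff)
      qed
      have Qc: "is_cube Q" unfolding is_cube_def Q_def using B by (intro exI[of _ "a - r *\<^sub>R One"] exI[of _ "2 * r"]) auto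
      have mQ: "measure lebesgue Q = (2 * r) ^ DIM('a)"
        unfolding Q_def using B by (intro measure_lebesgue_cube) auto
      have mB: "measure lebesgue B = unit_ball_vol (real DIM('a)) * r ^ DIM('a)"
        unfolding B(1) using B(2) by (intro measure_lebesgue_ball) simp
      have "measure lebesgue B powr (0 - 1) = c * measure lebesgue Q powr (0 - 1)"
        using B(2) by (simp add: powr_minus mB mQ c_def field_simps power_mult_distrib)
      then have "ennreal (measure lebesgue B powr (0 - 1)) * (\<integral>\<^sup>+y. ennreal \<bar>f y\<bar> * indicator B y \<partial>lebesgue)
         \<le> ennreal (c * measure lebesgue Q powr (0 - 1)) * (\<integral>\<^sup>+y\<in>Q. ennreal \<bar>f y\<bar> \<partial>lebesgue)"
        using BQ by (intro mult_mono nn_integral_mono) (auto split: split_indicator)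
      also have "\<dots> = ennreal c * (ennreal (measure lebesgue Q powr (0 - 1)) * (\<integral>\<^sup>+y\<in>Q. ennreal \<bar>f y\<bar> \<partial>lebesgue))"
        using c by (subst ennreal_mult) (simp_all only: mult.assoc powr_ge_zero less_imp_le)
      also have "\<dots> \<le> ennreal c * hl_max f x"
        unfolding hl_max_def frac_max_def using Qc x BQ by (intro mult_left_mono SUP_upper2[of Q]) auto
      finally show "ennreal (measure lebesgue B powr (0 - 1)) * (\<integral>\<^sup>+y. ennreal \<bar>f y\<bar> * indicator B y \<partial>lebesgue) \<le> ennreal c * hl_max f x" .
    qed
  qed
qed

text \<open>Converts the norm bound for M into the modular bound that the iteration needs: modular
  at most 1 means norm at most 1, so M f has norm at most C0, and scaling down by 2 C0 brings its
  modular to at most 1.\<close>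

lemma Rubio_de_Francia_variable:
  fixes w t :: "'a::euclidean_space \<Rightarrow> real"
  assumes w [measurable]: "w \<in> borel_measurable lebesgue" and w0: "AE x in lebesgue. 0 < w x"
    and t [measurable]: "t \<in> borel_measurable lebesgue" and t1: "AE x in lebesgue. 1 \<le> t x"
    and M: "M_bounded t w"
  shows "\<exists>K>0. \<forall>g\<in>borel_measurable lebesgue. \<not> (AE x in lebesgue. g x = 0) \<longrightarrow>
     (\<integral>\<^sup>+x. epow (g x * ennreal (w x)) (t x) \<partial>lebesgue) \<le> 1 \<longrightarrow>
     (\<exists>v. A1 K lebesgue v \<and> (AE x in lebesgue. g x \<le> ennreal (v x)) \<and>
       (\<integral>\<^sup>+x. epow (ennreal (v x) * ennreal (1 / 2) * ennreal (w x)) (t x) \<partial>lebesgue) \<le> 1)"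
proof -
  obtain C0 where C0: "0 < C0" "\<And>f. f \<in> borel_measurable lebesgue \<Longrightarrow>
      wvar_norm t w (hl_max f) \<le> ennreal C0 * wvar_norm t w (\<lambda>x. ennreal \<bar>f x\<bar>)"
    using M unfolding M_bounded_def by blast
  obtain C1 where C1: "0 < C1" "\<And>(f :: 'a \<Rightarrow> real) x. mx lebesgue 0 (\<lambda>y. ennreal \<bar>f y\<bar>) x \<le> ennreal C1 * hl_max f x"
    using mx_le_hl_max by blast
  \<comment> \<open>\<open>C1\<close> pays for passing from cubes to balls. The factor 2 gives a
    strict inequality for the norm, from which an admissible l below 2 C0 can be extracted although
    the infimum need not be attained.\<close>
  define C where "C = C1 * (2 * C0)"
  have C: "0 < C" using C0 C1 by (simp add: C_def)
  \<comment> \<open>\<open>M_bounded\<close> speaks of real functions and the iterates take values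
    in \<open>ennreal\<close>. A finite modular and w > 0 make them finite almost everywhere, so
    they agree with real functions off a null set.\<close>
  have fin: "AE x in lebesgue. h x < top"
    if [measurable]: "h \<in> borel_measurable lebesgue" and le: "(\<integral>\<^sup>+x. epow (h x * ennreal (c * w x)) (t x) \<partial>lebesgue) \<le> 1" "0 < c" for h c
  proof -
    have "(\<integral>\<^sup>+x. epow (h x * ennreal (c * w x)) (t x) \<partial>lebesgue) \<noteq> \<infinity>"
      using le by (metis ennreal_one_neq_top infinity_ennreal_def top_unique)
    then have "AE x in lebesgue. epow (h x * ennreal (c * w x)) (t x) \<noteq> \<infinity>"
      by (intro nn_integral_noteq_infinite) auto
    with w0 show ?thesis
    proof eventually_elim
      case (elim x)
      then show ?case using \<open>0 < c\<close> by (auto simp: ennreal_mult_eq_top_iff less_top)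
    qed
  qed
  show ?thesis
  proof (intro exI[of _ "2 * C"] conjI ballI impI)
    show "0 < 2 * C" using C by simp
    fix g :: "'a \<Rightarrow> ennreal"
    assume g: "g \<in> borel_measurable lebesgue" and nz: "\<not> (AE x in lebesgue. g x = 0)"
      and g1: "(\<integral>\<^sup>+x. epow (g x * ennreal (w x)) (t x) \<partial>lebesgue) \<le> 1"
    have "\<exists>G\<in>borel_measurable lebesgue. (\<forall>x. g x \<le> G x) \<and>
       (\<integral>\<^sup>+x. epow (G x * ennreal (1 / 2) * ennreal (w x)) (t x) \<partial>lebesgue) \<le> 1 \<and>
       (\<forall>x. mx lebesgue 0 G x \<le> ennreal (2 * C) * G x)"
    proof (rule Rubio_de_Francia[OF refl refl _ t t1 C _ g g1])
      fix h :: "'a \<Rightarrow> ennreal"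
      assume h [measurable]: "h \<in> borel_measurable lebesgue" and h1: "(\<integral>\<^sup>+x. epow (h x * ennreal (w x)) (t x) \<partial>lebesgue) \<le> 1"
      define f where "f x = enn2real (h x)" for x
      have f [measurable]: "f \<in> borel_measurable lebesgue" unfolding f_def by measurable
      have hf: "AE x in lebesgue. h x = ennreal \<bar>f x\<bar>"
        using fin[OF h, of 1] h1 by (auto simp: f_def elim!: eventually_mono)
      have "(\<integral>\<^sup>+x. epow (ennreal \<bar>f x\<bar> * ennreal (w x) / ennreal 1) (t x) \<partial>lebesgue) \<le> 1"
      proof -
        have "(\<integral>\<^sup>+x. epow (ennreal \<bar>f x\<bar> * ennreal (w x) / ennreal 1) (t x) \<partial>lebesgue)
          = (\<integral>\<^sup>+x. epow (h x * ennreal (w x)) (t x) \<partial>lebesgue)"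
          using hf by (intro nn_integral_cong_AE) (auto elim!: eventually_mono simp: divide_ennreal_def)
        then show ?thesis using h1 by simp
      qed
      then have "wvar_norm t w (\<lambda>x. ennreal \<bar>f x\<bar>) \<le> ennreal 1"
        unfolding wvar_norm_def var_norm_def by (intro Inf_lower) (auto intro!: exI[of _ 1])
      then have "wvar_norm t w (hl_max f) \<le> ennreal C0 * ennreal 1"
        using C0(2)[OF f] by (meson mult_left_mono order_trans zero_le)
      also have "\<dots> < ennreal (2 * C0)" using C0(1) by (simp add: ennreal_less_iff)
      finally obtain l where l: "0 < l" "ennreal l < ennreal (2 * C0)"
        "(\<integral>\<^sup>+x. epow (hl_max f x * ennreal (w x) / ennreal l) (t x) \<partial>lebesgue) \<le> 1"
        unfolding wvar_norm_def var_norm_def Inf_less_iff by auto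
      have l': "l \<le> 2 * C0" using l by (simp add: ennreal_less_iff)
      have "(\<integral>\<^sup>+x. epow (mx lebesgue 0 h x * ennreal (1 / C) * ennreal (w x)) (t x) \<partial>lebesgue)
        \<le> (\<integral>\<^sup>+x. epow (hl_max f x * ennreal (w x) / ennreal l) (t x) \<partial>lebesgue)"
      proof (rule nn_integral_mono_AE, use t1 in eventually_elim)
        case (elim x)
        have "mx lebesgue 0 h x * ennreal (1 / C) \<le> (ennreal C1 * hl_max f x) * ennreal (1 / C)"
          using C1(2)[of f x] mx_cong_AE[OF hf, of 0 x] by (intro mult_right_mono) auto
        also have "\<dots> = hl_max f x * (ennreal C1 * ennreal (1 / C))" by (simp only: mult_ac)
        also have "ennreal C1 * ennreal (1 / C) = ennreal (1 / (2 * C0))"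
          using C1 C0 by (subst ennreal_mult[symmetric]) (auto simp: C_def)
        also have "\<dots> \<le> ennreal (1 / l)"
          using l l' by (intro ennreal_leI) (auto simp: field_simps)
        finally have "mx lebesgue 0 h x * ennreal (1 / C) * ennreal (w x) \<le> hl_max f x * ennreal (1 / l) * ennreal (w x)"
          by (meson mult_left_mono mult_right_mono order_trans zero_le)
        also have "\<dots> = hl_max f x * ennreal (w x) / ennreal l"
          using l by (simp add: divide_ennreal_def inverse_ennreal mult_ac inverse_eq_divide)
        finally show ?case using elim by (intro epow_mono) auto
      qed
      then show "(\<integral>\<^sup>+x. epow (mx lebesgue 0 h x * ennreal (1 / C) * ennreal (w x)) (t x) \<partial>lebesgue) \<le> 1"
        using l(3) by (rule order_trans)
    qed simp
    then obtain G where G [measurable]: "G \<in> borel_measurable lebesgue" and gG: "\<And>x. g x \<le> G x"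
      and G1: "(\<integral>\<^sup>+x. epow (G x * ennreal (1 / 2) * ennreal (w x)) (t x) \<partial>lebesgue) \<le> 1"
      and GA: "\<And>x. mx lebesgue 0 G x \<le> ennreal (2 * C) * G x" by blast
    have "(\<integral>\<^sup>+x. epow (G x * ennreal (1 / 2 * w x)) (t x) \<partial>lebesgue) = (\<integral>\<^sup>+x. epow (G x * ennreal (1 / 2) * ennreal (w x)) (t x) \<partial>lebesgue)"
      by (subst ennreal_mult') (simp_all only: mult.assoc)
    then have Gfin: "AE x in lebesgue. G x < top"
      using fin[OF G, of "1 / 2"] G1 by simp
    have nzG: "\<not> (AE x in lebesgue. G x = 0)"
    proof
      assume "AE x in lebesgue. G x = 0"
      then have "AE x in lebesgue. g x = 0"
      proof eventually_elim
        case (elim x)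
        then show ?case using gG[of x] by simp
      qed
      with nz show False by simp
    qed
    obtain v where v: "A1 (2 * C) lebesgue v" "AE x in lebesgue. G x = ennreal (v x)"
      using A1_of_mx_bound[OF doubling_lebesgue G Gfin nzG _ GA] C by auto
    show "\<exists>v. A1 (2 * C) lebesgue v \<and> (AE x in lebesgue. g x \<le> ennreal (v x)) \<and>
       (\<integral>\<^sup>+x. epow (ennreal (v x) * ennreal (1 / 2) * ennreal (w x)) (t x) \<partial>lebesgue) \<le> 1"
    proof (intro exI[of _ v] conjI v(1))
      show "AE x in lebesgue. g x \<le> ennreal (v x)"
        using v(2)
      proof eventually_elim
        case (elim x)
        then show ?case using gG[of x] by simp
      qed
      have "(\<integral>\<^sup>+x. epow (ennreal (v x) * ennreal (1 / 2) * ennreal (w x)) (t x) \<partial>lebesgue)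
        = (\<integral>\<^sup>+x. epow (G x * ennreal (1 / 2) * ennreal (w x)) (t x) \<partial>lebesgue)"
        by (intro nn_integral_cong_AE) (use v(2) in eventually_elim, simp)
      then show "(\<integral>\<^sup>+x. epow (ennreal (v x) * ennreal (1 / 2) * ennreal (w x)) (t x) \<partial>lebesgue) \<le> 1"
        using G1 by simp
    qed
  qed
qed

section \<open>Reduction of the variable exponent to constant exponents\<close>

lemma mx_vector_A1:
  assumes K: "0 < K" and u: "1 < u" and p: "1 < p" and b: "0 \<le> b" "p * b < 1" and q: "q = p / (1 - p * b)"
  shows "\<exists>C>0. \<forall>(v :: 'a::euclidean_space \<Rightarrow> real) (h :: nat \<Rightarrow> 'a \<Rightarrow> ennreal). A1 K lebesgue v \<longrightarrow> (\<forall>j. h j \<in> borel_measurable lebesgue) \<longrightarrow>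
    (\<integral>\<^sup>+x. epow (\<Sum>j. epow (mx lebesgue b (h j) x) u) (q / u) * ennreal (v x) \<partial>lebesgue)
     \<le> ennreal C * epow (\<integral>\<^sup>+x. epow (\<Sum>j. epow (h j x) u) (p / u) * ennreal (v x powr (p / q)) \<partial>lebesgue) (q / p)"
proof -
  let ?D = "5 ^ DIM('a) :: real"
  have q0: "0 < q" using q p b by simp
  have b1: "b \<le> 1" using b p by (smt (verit) mult_le_cancel_right1)
  have pq: "p / q = 1 - p * b" using q p b by simp
  have KD: "0 < K * ?D" using K by simp
  obtain C where C: "0 < C" "\<And>\<nu> (h :: nat \<Rightarrow> 'a \<Rightarrow> ennreal). doubling (K * ?D) \<nu> \<Longrightarrow> (\<forall>j. h j \<in> borel_measurable lebesgue) \<Longrightarrow>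
     (\<integral>\<^sup>+x. epow (\<Sum>j. epow (mx \<nu> b (h j) x) u) (q / u) \<partial>\<nu>) \<le> ennreal C * epow (\<integral>\<^sup>+x. epow (\<Sum>j. epow (h j x) u) (p / u) \<partial>\<nu>) (q / p)"
    using mx_vector_strong_type[OF KD u p b q] by blast
  show ?thesis
  proof (intro exI[of _ "K powr ((1 - b) * q) * C"] conjI allI impI)
    show "0 < K powr ((1 - b) * q) * C" using C K by simp
    fix v :: "'a \<Rightarrow> real" and h :: "nat \<Rightarrow> 'a \<Rightarrow> ennreal"
    assume A: "A1 K lebesgue v" and h: "\<forall>j. h j \<in> borel_measurable lebesgue"
    have "(\<integral>\<^sup>+x. epow (\<Sum>j. epow (mx lebesgue b (h j) x) u) (q / u) * ennreal (v x) \<partial>lebesgue)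
      \<le> ennreal (K powr ((1 - b) * q)) * (ennreal C *
        epow (\<integral>\<^sup>+x. epow (\<Sum>j. epow (h j x) u) (p / u) * ennreal (v x powr (1 - p * b)) \<partial>lebesgue) (q / p))"
      using u p b b1 q0 h
      by (intro mx_vector_weighted[OF doubling_lebesgue A] C(2) A1_density(1)[OF doubling_lebesgue A]) auto
    also have "\<dots> = ennreal (K powr ((1 - b) * q) * C) * epow (\<integral>\<^sup>+x. epow (\<Sum>j. epow (h j x) u) (p / u) * ennreal (v x powr (p / q)) \<partial>lebesgue) (q / p)"
      using C by (simp add: pq ennreal_mult mult.assoc)
    finally show "(\<integral>\<^sup>+x. epow (\<Sum>j. epow (mx lebesgue b (h j) x) u) (q / u) * ennreal (v x) \<partial>lebesgue)
      \<le> ennreal (K powr ((1 - b) * q) * C) * epow (\<integral>\<^sup>+x. epow (\<Sum>j. epow (h j x) u) (p / u) * ennreal (v x powr (p / q)) \<partial>lebesgue) (q / p)" .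
  qed
qed

text \<open>Let m be the truncated modular of the left side. It is written as d times the integral
  of F^{q0} g, where g has modular at most 1 in the space on which M is bounded. An A_1 majorant v
  of g and the constant exponent inequality reduce m to the integral of H^{p0} v^{p0/q0}, which
  Young bounds by a constant. As d is a power of m less than 1, m itself is bounded.\<close>

lemma mx_vector_modular:
  fixes q \<omega> :: "'a::euclidean_space \<Rightarrow> real"
  assumes q [measurable]: "q \<in> borel_measurable lebesgue" and a: "0 < a"
    and qab: "AE x in lebesgue. a \<le> q x \<and> q x \<le> B"
    and w [measurable]: "\<omega> \<in> borel_measurable lebesgue" and w0: "AE x in lebesgue. 0 < \<omega> x"
    and s: "1 \<le> s" and sq: "AE x in lebesgue. s * q x > 1"
    and M: "M_bounded (conj_exp (\<lambda>y. s * q y)) (\<lambda>x. \<omega> x powr (- 1 / s))"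
    and u: "1 < u" and \<beta>: "0 \<le> \<beta>" and r: "s + \<beta> < r"
  shows "\<exists>C\<ge>1. \<forall>h :: nat \<Rightarrow> 'a \<Rightarrow> ennreal. (\<forall>j. h j \<in> borel_measurable lebesgue) \<longrightarrow>
     (\<integral>\<^sup>+x. epow (epow (\<Sum>j. epow (h j x) u) (1 / u) * ennreal (\<omega> x powr (1 / r))) (r * (1 / (1 / q x + \<beta>))) \<partial>lebesgue) \<le> 1 \<longrightarrow>
     (\<integral>\<^sup>+x. epow (epow (\<Sum>j. epow (mx lebesgue (\<beta> / r) (h j) x) u) (1 / u) * ennreal (\<omega> x powr (1 / r))) (r * q x) \<partial>lebesgue) \<le> ennreal C"
proof -
  have s0: "0 < s" and r0: "0 < r" using s r \<beta> by auto
  \<comment> \<open>The exponents satisfy 1/p0 - 1/q0 = \<beta>/r = b.\<close>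
  define b where "b = \<beta> / r"
  define p0 where "p0 = r / (s + \<beta>)"
  define q0 where "q0 = r / s"
  have p0: "1 < p0" using r s0 \<beta> by (simp add: p0_def)
  have q0: "0 < q0" using r0 s0 by (simp add: q0_def)
  have b: "0 \<le> b" using \<beta> r0 by (simp add: b_def)
  have pb: "p0 * b = \<beta> / (s + \<beta>)" using r0 by (simp add: p0_def b_def)
  then have pb1: "p0 * b < 1" using s0 \<beta> by simp
  have "1 - p0 * b = s / (s + \<beta>)" using s0 \<beta> unfolding pb by (simp add: field_simps)
  then have q0p0: "q0 = p0 / (1 - p0 * b)"
    using s0 \<beta> by (simp add: p0_def q0_def)
  define t where "t = conj_exp (\<lambda>y. s * q y)"
  have tx: "t x = s * q x / (s * q x - 1)" for x by (simp add: t_def conj_exp_def)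
  have t [measurable]: "t \<in> borel_measurable lebesgue"
    unfolding t_def conj_exp_def by measurable
  define wt where "wt x = \<omega> x powr (- 1 / s)" for x
  have wt [measurable]: "wt \<in> borel_measurable lebesgue" unfolding wt_def by measurable
  have wt0: "AE x in lebesgue. 0 < wt x" using w0 by eventually_elim (simp add: wt_def)
  \<comment> \<open>The map z / (z - 1) decreases, so its value \<open>c\<close> at the upper bound
    s B' of s q is a lower bound of \<open>t\<close>. The 2 guarantees s B' > 1, and the boundedness
    of q is what makes c > 1.\<close>
  define B' where "B' = max B 2"
  define c where "c = s * B' / (s * B' - 1)"
  have sB: "2 \<le> s * B'" using s mult_mono[of 1 s 2 B'] by (simp add: B'_def)
  have c1: "1 < c" using sB by (simp add: c_def field_simps)
  have tc: "AE x in lebesgue. c \<le> t x"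
    using sq qab
  proof eventually_elim
    case (elim x)
    have "s * q x \<le> s * B'" using elim s0 by (simp add: B'_def le_max_iff_disj)
    then show ?case using elim sB by (simp add: c_def tx divide_simps) (simp add: algebra_simps)
  qed
  then have t1: "AE x in lebesgue. 1 \<le> t x" using c1 by (auto elim!: eventually_mono)
  obtain K where K: "0 < K" and RdF: "\<And>g. g \<in> borel_measurable lebesgue \<Longrightarrow> \<not> (AE x in lebesgue. g x = 0) \<Longrightarrow>
     (\<integral>\<^sup>+x. epow (g x * ennreal (wt x)) (t x) \<partial>lebesgue) \<le> 1 \<Longrightarrow>
     (\<exists>v. A1 K lebesgue v \<and> (AE x in lebesgue. g x \<le> ennreal (v x)) \<and>
       (\<integral>\<^sup>+x. epow (ennreal (v x) * ennreal (1 / 2) * ennreal (wt x)) (t x) \<partial>lebesgue) \<le> 1)"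
    using Rubio_de_Francia_variable[OF wt wt0 t t1] M unfolding t_def wt_def by blast
  obtain C1 where C1: "0 < C1" and strong: "\<And>(v :: 'a \<Rightarrow> real) (h :: nat \<Rightarrow> 'a \<Rightarrow> ennreal). A1 K lebesgue v \<Longrightarrow> (\<forall>j. h j \<in> borel_measurable lebesgue) \<Longrightarrow>
    (\<integral>\<^sup>+x. epow (\<Sum>j. epow (mx lebesgue b (h j) x) u) (q0 / u) * ennreal (v x) \<partial>lebesgue)
     \<le> ennreal C1 * epow (\<integral>\<^sup>+x. epow (\<Sum>j. epow (h j x) u) (p0 / u) * ennreal (v x powr (p0 / q0)) \<partial>lebesgue) (q0 / p0)"
    using mx_vector_A1[OF K u p0 b pb1 q0p0] by blast
  define C2 where "C2 = C1 * (2 powr (p0 / q0) * 2) powr (q0 / p0)"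
  have C2: "0 < C2" using C1 by (simp add: C2_def)
  define C where "C = max 1 (C2 powr (c / (c - 1)))"
  show ?thesis
    unfolding b_def[symmetric]
  proof (intro exI[of _ C] conjI allI impI)
    show "1 \<le> C" by (simp add: C_def)
    fix h :: "nat \<Rightarrow> 'a \<Rightarrow> ennreal"
    assume h: "\<forall>j. h j \<in> borel_measurable lebesgue"
    have hm [measurable]: "h j \<in> borel_measurable lebesgue" for j using h by simp
    define H where "H x = epow (\<Sum>j. epow (h j x) u) (1 / u)" for x
    define F where "F x = epow (\<Sum>j. epow (mx lebesgue b (h j) x) u) (1 / u)" for x
    have H [measurable]: "H \<in> borel_measurable lebesgue" unfolding H_def by measurable
    have F [measurable]: "F \<in> borel_measurable lebesgue" unfolding F_def by measurable
    have Hq: "epow (\<Sum>j. epow (h j x) u) (z / u) = epow (H x) z" for z x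
      using u by (simp add: H_def epow_epow)
    have Fq: "epow (\<Sum>j. epow (mx lebesgue b (h j) x) u) (z / u) = epow (F x) z" for z x
      using u by (simp add: F_def epow_epow)
    assume "(\<integral>\<^sup>+x. epow (epow (\<Sum>j. epow (h j x) u) (1 / u) * ennreal (\<omega> x powr (1 / r))) (r * (1 / (1 / q x + \<beta>))) \<partial>lebesgue) \<le> 1"
    then have H1: "(\<integral>\<^sup>+x. epow (H x * ennreal (\<omega> x powr (1 / r))) (r * (1 / (1 / q x + \<beta>))) \<partial>lebesgue) \<le> 1"
      by (simp add: H_def)
    \<comment> \<open>On \<open>A N\<close> the truncated integrand is bounded and lives on a ball,
      so its integral is finite. The lower bound 1/N excludes negative values of \<omega>, which is
      known to be positive only almost everywhere.\<close>
    define A where "A N = {x \<in> ball 0 (real N). \<omega> x \<le> real N \<and> 1 / real N \<le> \<omega> x}" for N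
    have A [measurable]: "A N \<in> sets lebesgue" for N
    proof -
      have "{x \<in> space lebesgue. \<omega> x \<le> real N \<and> 1 / real N \<le> \<omega> x} \<in> sets lebesgue"
        by measurable
      then have "ball 0 (real N) \<inter> {x \<in> space lebesgue. \<omega> x \<le> real N \<and> 1 / real N \<le> \<omega> x} \<in> sets lebesgue"
        by (intro sets.Int) auto
      moreover have "A N = ball 0 (real N) \<inter> {x \<in> space lebesgue. \<omega> x \<le> real N \<and> 1 / real N \<le> \<omega> x}"
        by (auto simp: A_def)
      ultimately show ?thesis by simp
    qed
    have "(\<integral>\<^sup>+x. epow (F x * ennreal (\<omega> x powr (1 / r))) (r * q x) \<partial>lebesgue)
        = (\<integral>\<^sup>+x. epow (F x) (r * q x) * ennreal (\<omega> x powr q x) \<partial>lebesgue)"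
      by (intro nn_integral_cong_AE, use qab in eventually_elim)
        (use a r0 in \<open>simp add: epow_mult epow_ennreal powr_powr\<close>)
    also have "\<dots> \<le> ennreal C"
    proof (rule nn_integral_epow_le_truncation[where A = A])
      show "incseq A"
      proof (rule monoI, rule subsetI)
        fix m n :: nat and x :: 'a assume mn: "m \<le> n" and x: "x \<in> A m"
        have "0 < m" using x by (cases m) (auto simp: A_def)
        then have "1 / real n \<le> 1 / real m" using mn by (simp add: frac_le)
        then show "x \<in> A n" using x mn by (auto simp: A_def)
      qed
      show "AE x in lebesgue. \<exists>N. x \<in> A N"
        using w0
      proof eventually_elim
        case (elim x)
        obtain N :: nat where N: "max (max (norm x + 1) (\<omega> x)) (1 / \<omega> x) \<le> real N"
          using real_arch_simple by blast
        then have "norm x < real N" "\<omega> x \<le> real N" "1 / \<omega> x \<le> real N" by auto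
        moreover from this have "1 / real N \<le> \<omega> x"
          using elim norm_ge_zero[of x] by (auto simp: field_simps)
        ultimately show ?case by (auto simp: A_def)
      qed
      show "AE x in lebesgue. 0 < r * q x" using qab a r0 by (auto elim!: eventually_mono)
      fix N
      define Y where "Y x = enn2real (min (F x) (of_nat N))" for x
      have Y: "ennreal (Y x) = min (F x) (of_nat N)" "0 \<le> Y x" for x
        unfolding Y_def by (auto simp: min_less_iff_disj ennreal_of_nat_eq_real_of_nat)
      have YN: "Y x \<le> real N" for x
      proof -
        have "ennreal (Y x) \<le> ennreal (real N)"
          unfolding Y(1) by (simp add: ennreal_of_nat_eq_real_of_nat)
        then show ?thesis by simp
      qed
      define FN where "FN x = Y x * indicator (A N) x" for x
      have FN [measurable]: "FN \<in> borel_measurable lebesgue" unfolding FN_def Y_def by measurable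
      have FN0: "0 \<le> FN x" for x using Y(2) by (simp add: FN_def)
      have FNF: "ennreal (FN x) \<le> F x" for x
        by (simp add: FN_def Y(1) split: split_indicator)
      have FNN: "FN x \<le> real N * indicator (A N) x" for x
        using YN by (simp add: FN_def split: split_indicator)
      let ?f = "\<lambda>x. FN x powr (r * q x) * \<omega> x powr q x"
      define m where "m = (\<integral>\<^sup>+x. ennreal (?f x) \<partial>lebesgue)"
      have "(\<integral>\<^sup>+x. epow (min (F x) (of_nat N)) (r * q x) * ennreal (\<omega> x powr q x) * indicator (A N) x \<partial>lebesgue) = m"
        unfolding m_def
      proof (intro nn_integral_cong)
        fix x
        show "epow (min (F x) (of_nat N)) (r * q x) * ennreal (\<omega> x powr q x) * indicator (A N) x = ennreal (?f x)"
          unfolding Y(1)[symmetric] using Y(2)[of x]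
          by (cases "x \<in> A N") (simp_all add: FN_def epow_ennreal ennreal_mult)
      qed
      moreover have "m \<le> ennreal C"
      \<comment> \<open>The case m > 1 is the one that matters: there m^{t/c} \<ge> m because t
        \<ge> c, so dividing by d = m^{1/c} lowers the modular of g to at most 1 for every value of
        the variable exponent t.\<close>
      proof (cases "m \<le> 1")
        case True
        also have "1 \<le> ennreal C" by (simp add: C_def)
        finally show ?thesis .
      next
        case False
        have "m < top"
        proof -
          have "m \<le> (\<integral>\<^sup>+x. ennreal (real N powr (r * B') * real N powr B') * indicator (ball (0::'a) (real N)) x \<partial>lebesgue)"
            unfolding m_def
          proof (rule nn_integral_mono_AE)
            show "AE x in lebesgue. ennreal (?f x) \<le> ennreal (real N powr (r * B') * real N powr B') * indicator (ball (0::'a) (real N)) x"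
              using qab
            proof eventually_elim
              case (elim x)
              show ?case
              proof (cases "x \<in> A N")
                case True
                then have "0 < N" by (cases N) (auto simp: A_def)
                moreover have "0 \<le> 1 / real N" by simp
                ultimately have N: "1 \<le> real N" "x \<in> ball 0 (real N)" "0 \<le> \<omega> x" "\<omega> x \<le> real N"
                  using True unfolding A_def by (simp_all only: mem_Collect_eq) linarith+
                have q': "0 \<le> q x" "q x \<le> B'" using elim a by (auto simp: B'_def)
                have "FN x powr (r * q x) \<le> real N powr (r * q x)"
                  using FNN[of x] FN0[of x] r0 q' True by (intro powr_mono2) auto
                also have "\<dots> \<le> real N powr (r * B')"
                  using N q' r0 by (intro powr_mono) auto
                finally have 1: "FN x powr (r * q x) \<le> real N powr (r * B')" .
                have "\<omega> x powr q x \<le> real N powr q x"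
                  using N q' by (intro powr_mono2) auto
                also have "\<dots> \<le> real N powr B'"
                  using N q' by (intro powr_mono) auto
                finally have "?f x \<le> real N powr (r * B') * real N powr B'"
                  using 1 by (intro mult_mono) auto
                then show ?thesis using N by (simp add: ennreal_leI)
              qed (simp add: FN_def)
            qed
          qed
          also have "\<dots> < top"
            using emeasure_lborel_ball_finite[of "0::'a" "real N"]
            by (simp add: nn_integral_cmult_indicator ennreal_mult_less_top)
          finally show ?thesis .
        qed
        then obtain m' where m': "m = ennreal m'" "1 < m'"
          using False by (cases m) (auto simp flip: ennreal_1)
        define d where "d = m' powr (1 / c)"
        have d: "0 < d" using m' by (simp add: d_def)
        \<comment> \<open>The dual function: F^{q0} g is the integrand of m divided by d, while the
          modular of g against \<open>wt\<close> with exponent t is again the integral of that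
          integrand, now divided by d^t.\<close>
        define g where "g x = FN x powr (r * q x - q0) * \<omega> x powr q x / d" for x
        have g0: "0 \<le> g x" for x using d by (simp add: g_def)
        have gm [measurable]: "(\<lambda>x. ennreal (g x)) \<in> borel_measurable lebesgue" unfolding g_def by measurable
        have FNg: "FN x powr q0 * g x = ?f x / d" for x
          using FN0[of x] by (cases "FN x = 0") (auto simp: g_def powr_diff)
        have "\<exists>v. A1 K lebesgue v \<and> (AE x in lebesgue. ennreal (g x) \<le> ennreal (v x)) \<and>
          (\<integral>\<^sup>+x. epow (ennreal (v x) * ennreal (1 / 2) * ennreal (wt x)) (t x) \<partial>lebesgue) \<le> 1"
        proof (rule RdF[OF gm])
          show "\<not> (AE x in lebesgue. ennreal (g x) = 0)"
          proof
            assume "AE x in lebesgue. ennreal (g x) = 0"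
            then have "AE x in lebesgue. ennreal (?f x) = 0"
            proof eventually_elim
              case (elim x)
              then have "g x = 0" using g0[of x] by simp
              then have "?f x = 0" using FNg[of x] d by auto
              then show ?case by (simp only: ennreal_0)
            qed
            then have "m = (\<integral>\<^sup>+x. 0 \<partial>(lebesgue :: 'a measure))"
              unfolding m_def by (rule nn_integral_cong_AE)
            with m' show False by simp
          qed
          have "(\<integral>\<^sup>+x. epow (ennreal (g x) * ennreal (wt x)) (t x) \<partial>lebesgue) \<le> (\<integral>\<^sup>+x. ennreal (1 / m') * ennreal (?f x) \<partial>lebesgue)"
          proof (rule nn_integral_mono_AE, use tc sq w0 in eventually_elim)
            case (elim x)
            \<comment> \<open>The choice q0 = r/s gives r q - q0 = q0 (s q - 1), and t cancels s q -
              1; \<open>e2\<close> is the same computation for the power of \<omega>.\<close>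
            have e1: "(r * q x - q0) * t x = r * q x"
            proof -
              have "r * q x - q0 = q0 * (s * q x - 1)" using s0 by (simp add: q0_def field_simps)
              then have "(r * q x - q0) * t x = q0 * (s * q x)" using elim by (simp add: tx)
              then show ?thesis using s0 by (simp add: q0_def)
            qed
            have e2: "(q x - 1 / s) * t x = q x"
            proof -
              have "q x - 1 / s = (s * q x - 1) / s" using s0 by (simp add: field_simps)
              then show ?thesis using elim s0 by (simp add: tx)
            qed
            have "(g x * wt x) powr t x = (FN x powr (r * q x - q0) * (\<omega> x powr q x * \<omega> x powr (- 1 / s)) / d) powr t x"
              by (simp add: g_def wt_def mult.assoc)
            also have "\<dots> = ?f x / d powr t x"
              using d by (simp add: powr_mult powr_divide powr_powr e1 e2 flip: powr_add)
            also have "\<dots> \<le> ?f x / m'"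
            proof (intro divide_left_mono mult_nonneg_nonneg)
              have "m' powr 1 \<le> m' powr (1 / c * t x)"
                using m' c1 elim by (intro powr_mono) (auto simp: field_simps)
              then show "m' \<le> d powr t x" using m' by (simp add: d_def powr_powr)
              show "0 < d powr t x * m'" using d m' by simp
            qed auto
            finally have "(g x * wt x) powr t x \<le> 1 / m' * ?f x" by simp
            then have "ennreal ((g x * wt x) powr t x) \<le> ennreal (1 / m' * ?f x)"
              by (rule ennreal_leI)
            then show ?case
              using g0[of x] m' by (simp add: epow_ennreal wt_def ennreal_mult'[symmetric] flip: ennreal_mult)
          qed
          also have "\<dots> = ennreal (1 / m') * m"
            unfolding m_def by (rule nn_integral_cmult) measurable
          also have "\<dots> = 1" using m' by (simp flip: ennreal_mult)
          finally show "(\<integral>\<^sup>+x. epow (ennreal (g x) * ennreal (wt x)) (t x) \<partial>lebesgue) \<le> 1" .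
        qed
        then obtain v where v: "A1 K lebesgue v" "AE x in lebesgue. ennreal (g x) \<le> ennreal (v x)"
          and v1: "(\<integral>\<^sup>+x. epow (ennreal (v x) * ennreal (1 / 2) * ennreal (wt x)) (t x) \<partial>lebesgue) \<le> 1" by blast
        have [measurable]: "v \<in> borel_measurable lebesgue" and vpos: "0 < v x" for x
          using A1_D[OF doubling_lebesgue v(1)] by auto
        have Young: "(\<integral>\<^sup>+x. epow (H x) p0 * ennreal (v x powr (p0 / q0)) \<partial>lebesgue) \<le> ennreal (2 powr (p0 / q0) * 2)"
        proof -
          let ?X = "\<lambda>x. epow (H x * ennreal (\<omega> x powr (1 / r))) (r * (1 / (1 / q x + \<beta>)))"
          let ?Y = "\<lambda>x. epow (ennreal (v x) * ennreal (1 / 2) * ennreal (wt x)) (t x)"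
          have "(\<integral>\<^sup>+x. epow (H x) p0 * ennreal (v x powr (p0 / q0)) \<partial>lebesgue)
            \<le> (\<integral>\<^sup>+x. ennreal (2 powr (p0 / q0)) * (?X x + ?Y x) \<partial>lebesgue)"
          proof (rule nn_integral_mono_AE, use sq w0 qab in eventually_elim)
            case (elim x)
            have qx: "0 < q x" using elim a by auto
            \<comment> \<open>With 1/p = 1/q + \<beta> this is p0 / (r p), the power that turns the
              modular integrand of H into H^{p0} \<omega>^{p0/r}. Then 1 - \<theta> = (p0/q0) / t
              does the same for v, with \<omega>^{-p0/r}, so the weights cancel in the
              product.\<close>
            define \<theta> where "\<theta> = p0 / r * (1 / q x + \<beta>)"
            have \<theta>: "0 < \<theta>" using p0 r0 qx \<beta> unfolding \<theta>_def by (intro mult_pos_pos divide_pos_pos add_pos_nonneg) auto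
            have \<theta>1: "1 - \<theta> = p0 / q0 * (1 / t x)"
            proof -
              have "1 / t x = 1 - 1 / (s * q x)" using elim s0 qx by (simp add: tx diff_divide_distrib)
              then have "p0 / q0 * (1 / t x) = p0 / q0 * (1 - 1 / (s * q x))" by simp
              also have "\<dots> = p0 / r * (s - 1 / q x)"
                using s0 r0 qx by (simp add: q0_def right_diff_distrib)
              also have "\<dots> = p0 / r * (s + \<beta>) - \<theta>" by (simp only: \<theta>_def right_diff_distrib[symmetric]) simp
              also have "p0 / r * (s + \<beta>) = 1" using r0 s0 \<beta> by (simp add: p0_def)
              finally show ?thesis by simp
            qed
            have tpos: "0 < t x" using elim by (simp add: tx)
            have \<theta>2: "\<theta> < 1" using \<theta>1 p0 q0 tpos by (smt (verit) divide_pos_pos mult_pos_pos)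
            have X: "epow (?X x) \<theta> = epow (H x) p0 * ennreal (\<omega> x powr (p0 / r))"
            proof -
              have qb: "0 < 1 / q x + \<beta>" using qx \<beta> by (simp add: add_pos_nonneg)
              have "epow (?X x) \<theta> = epow (H x * ennreal (\<omega> x powr (1 / r))) (r * (1 / (1 / q x + \<beta>)) * \<theta>)"
                using qb r0 by (intro epow_epow) simp
              also have "r * (1 / (1 / q x + \<beta>)) * \<theta> = p0"
                using qb r0 unfolding \<theta>_def by simp
              also have "epow (H x * ennreal (\<omega> x powr (1 / r))) p0 = epow (H x) p0 * ennreal (\<omega> x powr (p0 / r))"
                using p0 by (simp add: epow_mult epow_ennreal powr_powr)
              finally show ?thesis .
            qed
            have Y: "epow (?Y x) (1 - \<theta>) = ennreal ((1 / 2) powr (p0 / q0) * v x powr (p0 / q0) * \<omega> x powr (- (p0 / r)))"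
            proof -
              have vw: "ennreal (v x) * ennreal (1 / 2) * ennreal (wt x) = ennreal (v x * (1 / 2) * wt x)"
                by (subst ennreal_mult'', simp add: wt_def, subst ennreal_mult'', simp, rule refl)
              have "epow (?Y x) (1 - \<theta>) = epow (ennreal (v x * (1 / 2) * wt x)) (t x * (1 - \<theta>))"
                unfolding vw using tpos by (rule epow_epow)
              also have "t x * (1 - \<theta>) = p0 / q0" using tpos by (simp add: \<theta>1)
              also have "epow (ennreal (v x * (1 / 2) * wt x)) (p0 / q0) = ennreal ((v x * (1 / 2) * wt x) powr (p0 / q0))"
                using vpos[of x] by (intro epow_ennreal mult_nonneg_nonneg) (auto simp: wt_def less_imp_le)
              also have "(v x * (1 / 2) * wt x) powr (p0 / q0) = (1 / 2) powr (p0 / q0) * v x powr (p0 / q0) * wt x powr (p0 / q0)"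
                by (simp only: powr_mult mult_ac)
              also have "wt x powr (p0 / q0) = \<omega> x powr (- (p0 / r))"
                unfolding wt_def powr_powr using s0 r0 by (simp add: q0_def)
              finally show ?thesis .
            qed
            have "epow (H x) p0 * ennreal (v x powr (p0 / q0)) = ennreal (2 powr (p0 / q0)) * (epow (?X x) \<theta> * epow (?Y x) (1 - \<theta>))"
            proof -
              have "2 powr (p0 / q0) * (\<omega> x powr (p0 / r) * ((1 / 2) powr (p0 / q0) * v x powr (p0 / q0) * \<omega> x powr (- (p0 / r)))) = v x powr (p0 / q0)"
                using elim by (simp add: powr_divide powr_minus field_simps)
              then have "ennreal (v x powr (p0 / q0)) = ennreal (2 powr (p0 / q0)) * (ennreal (\<omega> x powr (p0 / r)) * ennreal ((1 / 2) powr (p0 / q0) * v x powr (p0 / q0) * \<omega> x powr (- (p0 / r))))"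
                by (simp only: ennreal_mult[symmetric] powr_ge_zero mult_nonneg_nonneg)
              then show ?thesis unfolding X Y by (simp only: mult_ac)
            qed
            also have "\<dots> \<le> ennreal (2 powr (p0 / q0)) * (?X x + ?Y x)"
              by (intro mult_left_mono epow_young \<theta> \<theta>2) simp
            finally show ?case .
          qed
          also have "\<dots> = ennreal (2 powr (p0 / q0)) * ((\<integral>\<^sup>+x. ?X x \<partial>lebesgue) + (\<integral>\<^sup>+x. ?Y x \<partial>lebesgue))"
            by (subst nn_integral_cmult, measurable, subst nn_integral_add, measurable)
          also have "\<dots> \<le> ennreal (2 powr (p0 / q0)) * (1 + 1)"
            by (intro mult_left_mono add_mono H1 v1) simp
          also have "\<dots> = ennreal (2 powr (p0 / q0) * 2)"
            by (simp add: ennreal_mult)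
          finally show ?thesis .
        qed
        have "m = (\<integral>\<^sup>+x. ennreal d * (ennreal (FN x powr q0) * ennreal (g x)) \<partial>lebesgue)"
          unfolding m_def
        proof (intro nn_integral_cong)
          fix x
          have "?f x = d * (FN x powr q0 * g x)" using d by (simp add: FNg)
          then show "ennreal (?f x) = ennreal d * (ennreal (FN x powr q0) * ennreal (g x))"
            using d g0[of x] by (simp add: ennreal_mult)
        qed
        also have "\<dots> \<le> (\<integral>\<^sup>+x. ennreal d * (epow (F x) q0 * ennreal (v x)) \<partial>lebesgue)"
        proof (rule nn_integral_mono_AE, use v(2) in eventually_elim)
          case (elim x)
          have "ennreal (FN x powr q0) \<le> epow (F x) q0"
            using epow_mono[OF FNF, of q0 x] q0 FN0[of x] by (simp add: epow_ennreal)
          then show ?case using elim by (intro mult_left_mono mult_mono) auto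
        qed
        also have "\<dots> = ennreal d * (\<integral>\<^sup>+x. epow (F x) q0 * ennreal (v x) \<partial>lebesgue)"
          by (rule nn_integral_cmult) measurable
        also have "\<dots> \<le> ennreal d * (ennreal C1 * epow (\<integral>\<^sup>+x. epow (H x) p0 * ennreal (v x powr (p0 / q0)) \<partial>lebesgue) (q0 / p0))"
          using strong[OF v(1) h] unfolding Fq Hq by (intro mult_left_mono) auto
        also have "\<dots> \<le> ennreal d * (ennreal C1 * epow (ennreal (2 powr (p0 / q0) * 2)) (q0 / p0))"
          using p0 q0 by (intro mult_left_mono epow_mono Young) auto
        also have "\<dots> = ennreal (d * C2)"
        proof -
          have "epow (ennreal (2 powr (p0 / q0) * 2)) (q0 / p0) = ennreal ((2 powr (p0 / q0) * 2) powr (q0 / p0))"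
            by (rule epow_ennreal) simp
          then show ?thesis using d C1 by (simp only: C2_def) (simp add: ennreal_mult)
        qed
        finally have "m' \<le> d * C2" using m' d C2 by simp
        \<comment> \<open>From m \<le> m^{1/c} C2 with m finite; the conjugate exponent c / (c - 1)
          solves for m.\<close>
        then have "m' powr 1 / m' powr (1 / c) \<le> C2"
          using m' by (simp add: d_def field_simps)
        then have "m' powr (1 - 1 / c) \<le> C2" by (simp add: powr_diff)
        then have "(m' powr (1 - 1 / c)) powr (c / (c - 1)) \<le> C2 powr (c / (c - 1))"
          using c1 by (intro powr_mono2) auto
        moreover have "(1 - 1 / c) * (c / (c - 1)) = 1" using c1 by (simp add: field_simps)
        then have "(m' powr (1 - 1 / c)) powr (c / (c - 1)) = m'"
          using m' unfolding powr_powr by (simp only: powr_one)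
        ultimately have "m' \<le> C2 powr (c / (c - 1))" by (simp only:)
        then show ?thesis using m' by (simp add: C_def ennreal_leI)
      qed
      ultimately show "(\<integral>\<^sup>+x. epow (min (F x) (of_nat N)) (r * q x) * ennreal (\<omega> x powr q x) * indicator (A N) x \<partial>lebesgue) \<le> ennreal C"
        by simp
    qed measurable
    finally show "(\<integral>\<^sup>+x. epow (epow (\<Sum>j. epow (mx lebesgue b (h j) x) u) (1 / u) * ennreal (\<omega> x powr (1 / r))) (r * q x) \<partial>lebesgue) \<le> ennreal C"
      by (simp add: F_def)
  qed
qed

section \<open>From the modular inequality to the norms\<close>

theorem theorem4p1:
  fixes \<alpha> u r :: real and q \<omega> :: "'a::euclidean_space \<Rightarrow> real"
  assumes "0 \<le> \<alpha>" and "\<alpha> < real DIM('a)"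
    and "1 < u"
    and "q \<in> borel_measurable lebesgue" and "\<forall>x. 0 < q x"
    and "\<exists>a b. 0 < a \<and> (AE x in lebesgue. a \<le> q x \<and> q x \<le> b)"
    and "\<omega> \<in> W_class q"
    and "ereal r > s_index \<omega> q + ereal (\<alpha> / real DIM('a))"
  defines "p \<equiv> (\<lambda>x. 1 / (1 / q x + \<alpha> / real DIM('a)))"
  shows "\<exists>C::real. C > 0 \<and>
    (\<forall>f :: nat \<Rightarrow> 'a \<Rightarrow> real.
      (\<forall>j. f j \<in> borel_measurable lebesgue \<and> bounded (range (f j)) \<and>
           (\<exists>K. compact K \<and> (\<forall>x. x \<notin> K \<longrightarrow> f j x = 0))) \<longrightarrow>
      wvar_norm (\<lambda>x. r * q x) (\<lambda>x. \<omega> x powr (1 / r))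
        (\<lambda>x. epow (\<Sum>j. epow (frac_max (\<alpha> / r) (f j) x) u) (1 / u))
      \<le> ennreal C * wvar_norm (\<lambda>x. r * p x) (\<lambda>x. \<omega> x powr (1 / r))
        (\<lambda>x. epow (\<Sum>j. ennreal (\<bar>f j x\<bar> powr u)) (1 / u)))"
proof -
  define \<beta> where "\<beta> = \<alpha> / real DIM('a)"
  have \<beta>: "0 \<le> \<beta>" "\<beta> < 1" using assms by (auto simp: \<beta>_def)
  obtain a B where a: "0 < a" and qab: "AE x in lebesgue. a \<le> q x \<and> q x \<le> B" using assms by blast
  have w: "\<omega> \<in> borel_measurable lebesgue" "AE x in lebesgue. 0 < \<omega> x"
    using \<open>\<omega> \<in> W_class q\<close> by (auto simp: W_class_def is_weight_def)
  note [measurable] = \<open>q \<in> borel_measurable lebesgue\<close> w(1)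
  \<comment> \<open>The strict hypothesis on r leaves room for an admissible s with s + \<beta> < r,
    even if the infimum is not attained; it also excludes an empty set of candidates.\<close>
  have "s_index \<omega> q < ereal (r - \<beta>)"
    using assms(8) unfolding \<beta>_def[symmetric] by (cases "s_index \<omega> q") auto
  then obtain s where s: "1 \<le> s" "AE x in lebesgue. s * q x > 1"
      "M_bounded (conj_exp (\<lambda>y. s * q y)) (\<lambda>x. \<omega> x powr (- 1 / s))" "s < r - \<beta>"
    unfolding s_index_def Inf_less_iff by auto
  have r: "s + \<beta> < r" "0 < r" "1 < r" using s \<beta> by auto
  obtain C0 where C0: "1 \<le> C0" "\<And>h :: nat \<Rightarrow> 'a \<Rightarrow> ennreal. (\<forall>j. h j \<in> borel_measurable lebesgue) \<Longrightarrow>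
     (\<integral>\<^sup>+x. epow (epow (\<Sum>j. epow (h j x) u) (1 / u) * ennreal (\<omega> x powr (1 / r))) (r * (1 / (1 / q x + \<beta>))) \<partial>lebesgue) \<le> 1 \<Longrightarrow>
     (\<integral>\<^sup>+x. epow (epow (\<Sum>j. epow (mx lebesgue (\<beta> / r) (h j) x) u) (1 / u) * ennreal (\<omega> x powr (1 / r))) (r * q x) \<partial>lebesgue) \<le> ennreal C0"
    using mx_vector_modular[OF \<open>q \<in> _\<close> a qab w s(1-3) \<open>1 < u\<close> \<beta>(1) r(1)] by blast
  have br: "\<alpha> / r / real DIM('a) = \<beta> / r" by (simp add: \<beta>_def)
  have "\<alpha> / r / real DIM('a) < 1" unfolding br using \<beta> r by simp
  from frac_max_le_mx[OF this] obtain C1 where C1: "0 < C1"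
    "\<And>(f :: 'a \<Rightarrow> real) x. frac_max (\<alpha> / r) f x \<le> ennreal C1 * mx lebesgue (\<beta> / r) (\<lambda>y. ennreal \<bar>f y\<bar>) x"
    unfolding br by blast
  \<comment> \<open>Dividing a function by C2 \<ge> 1 divides its modular with exponent r q by at
    least C2^{r a} = C0, because q \<ge> a. Thus a modular at most C0 drops to at most 1.\<close>
  define C2 where "C2 = C0 powr (1 / (r * a))"
  have C2: "1 \<le> C2" using C0(1) a r by (simp add: C2_def ge_one_powr_ge_zero)
  define C where "C = C1 * C2"
  have C: "0 < C" using C1 C2 by (simp add: C_def)
  show ?thesis
  proof (intro exI[of _ C] conjI allI impI C)
    fix f :: "nat \<Rightarrow> 'a \<Rightarrow> real"
    assume "\<forall>j. f j \<in> borel_measurable lebesgue \<and> bounded (range (f j)) \<and>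
           (\<exists>K. compact K \<and> (\<forall>x. x \<notin> K \<longrightarrow> f j x = 0))"
    then have f [measurable]: "f j \<in> borel_measurable lebesgue" for j by blast
    let ?L = "wvar_norm (\<lambda>x. r * q x) (\<lambda>x. \<omega> x powr (1 / r))
        (\<lambda>x. epow (\<Sum>j. epow (frac_max (\<alpha> / r) (f j) x) u) (1 / u))"
    let ?R = "wvar_norm (\<lambda>x. r * p x) (\<lambda>x. \<omega> x powr (1 / r)) (\<lambda>x. epow (\<Sum>j. ennreal (\<bar>f j x\<bar> powr u)) (1 / u))"
    have key: "?L \<le> ennreal C * ennreal l" if l: "0 < l"
      and le: "(\<integral>\<^sup>+x. epow (epow (\<Sum>j. ennreal (\<bar>f j x\<bar> powr u)) (1 / u) * ennreal (\<omega> x powr (1 / r)) / ennreal l) (r * p x) \<partial>lebesgue) \<le> 1" for l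
    proof -
      \<comment> \<open>Dividing the data by an admissible l for the right side brings their modular
        to at most 1; C * l is then shown to be admissible for the left side.\<close>
      define h where "h j x = ennreal (1 / l) * ennreal \<bar>f j x\<bar>" for j x
      have h [measurable]: "h j \<in> borel_measurable lebesgue" for j unfolding h_def by measurable
      have div: "y / ennreal c = ennreal (1 / c) * y" if "0 < c" for y c
        using that by (simp add: divide_ennreal_def inverse_ennreal mult.commute inverse_eq_divide)
      have hH: "epow (\<Sum>j. epow (h j x) u) (1 / u) = ennreal (1 / l) * epow (\<Sum>j. ennreal (\<bar>f j x\<bar> powr u)) (1 / u)" for x
        using \<open>1 < u\<close> l by (simp add: h_def epow_mult epow_ennreal powr_powr)
      have "(\<integral>\<^sup>+x. epow (epow (\<Sum>j. epow (h j x) u) (1 / u) * ennreal (\<omega> x powr (1 / r))) (r * (1 / (1 / q x + \<beta>))) \<partial>lebesgue) \<le> 1"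
        using le unfolding hH div[OF l] p_def \<beta>_def by (simp only: mult.assoc)
      then have int: "(\<integral>\<^sup>+x. epow (epow (\<Sum>j. epow (mx lebesgue (\<beta> / r) (h j) x) u) (1 / u) * ennreal (\<omega> x powr (1 / r))) (r * q x) \<partial>lebesgue) \<le> ennreal C0"
        by (intro C0(2)) simp_all
      let ?G = "\<lambda>x. epow (\<Sum>j. epow (mx lebesgue (\<beta> / r) (h j) x) u) (1 / u) * ennreal (\<omega> x powr (1 / r))"
      have fl: "frac_max (\<alpha> / r) (f j) x \<le> ennreal (C1 * l) * mx lebesgue (\<beta> / r) (h j) x" for j x
      proof -
        have "mx lebesgue (\<beta> / r) (h j) x = ennreal (1 / l) * mx lebesgue (\<beta> / r) (\<lambda>y. ennreal \<bar>f j y\<bar>) x"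
          unfolding h_def by (rule mx_cmult) auto
        then have "ennreal (C1 * l) * mx lebesgue (\<beta> / r) (h j) x = (ennreal (C1 * l) * ennreal (1 / l)) * mx lebesgue (\<beta> / r) (\<lambda>y. ennreal \<bar>f j y\<bar>) x"
          by (simp only: mult.assoc)
        also have "ennreal (C1 * l) * ennreal (1 / l) = ennreal C1"
          using l C1 by (subst ennreal_mult[symmetric]) auto
        finally show ?thesis using C1(2)[of "f j" x] by simp
      qed
      have pt: "epow (\<Sum>j. epow (frac_max (\<alpha> / r) (f j) x) u) (1 / u) * ennreal (\<omega> x powr (1 / r)) / ennreal (C * l)
         \<le> ennreal (1 / C2) * ?G x" for x
      proof -
        have "(\<Sum>j. epow (frac_max (\<alpha> / r) (f j) x) u) \<le> (\<Sum>j. epow (ennreal (C1 * l) * mx lebesgue (\<beta> / r) (h j) x) u)"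
          using \<open>1 < u\<close> by (intro suminf_le epow_mono fl) auto
        also have "\<dots> = ennreal ((C1 * l) powr u) * (\<Sum>j. epow (mx lebesgue (\<beta> / r) (h j) x) u)"
          using \<open>1 < u\<close> C1 l by (simp add: epow_mult epow_ennreal)
        finally have "epow (\<Sum>j. epow (frac_max (\<alpha> / r) (f j) x) u) (1 / u)
           \<le> epow (ennreal ((C1 * l) powr u) * (\<Sum>j. epow (mx lebesgue (\<beta> / r) (h j) x) u)) (1 / u)"
          using \<open>1 < u\<close> by (intro epow_mono) auto
        also have "\<dots> = ennreal (C1 * l) * epow (\<Sum>j. epow (mx lebesgue (\<beta> / r) (h j) x) u) (1 / u)"
          using \<open>1 < u\<close> C1 l by (simp add: epow_mult epow_ennreal powr_powr)
        finally have "ennreal (1 / (C * l)) * (epow (\<Sum>j. epow (frac_max (\<alpha> / r) (f j) x) u) (1 / u) * ennreal (\<omega> x powr (1 / r)))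
           \<le> ennreal (1 / (C * l)) * (ennreal (C1 * l) * epow (\<Sum>j. epow (mx lebesgue (\<beta> / r) (h j) x) u) (1 / u) * ennreal (\<omega> x powr (1 / r)))"
          by (intro mult_left_mono mult_right_mono) auto
        also have "\<dots> = (ennreal (1 / (C * l)) * ennreal (C1 * l)) * ?G x" by (simp only: mult.assoc)
        also have "ennreal (1 / (C * l)) * ennreal (C1 * l) = ennreal (1 / C2)"
          using C C1 C2 l by (subst ennreal_mult[symmetric]) (auto simp: C_def)
        finally show ?thesis using C l by (subst div) auto
      qed
      have "(\<integral>\<^sup>+x. epow (epow (\<Sum>j. epow (frac_max (\<alpha> / r) (f j) x) u) (1 / u) * ennreal (\<omega> x powr (1 / r)) / ennreal (C * l)) (r * q x) \<partial>lebesgue)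
        \<le> (\<integral>\<^sup>+x. ennreal (1 / C0) * epow (?G x) (r * q x) \<partial>lebesgue)"
      proof (rule nn_integral_mono_AE, use qab in eventually_elim)
        case (elim x)
        have rq: "0 < r * q x" "r * a \<le> r * q x" using elim a r by auto
        have "epow (epow (\<Sum>j. epow (frac_max (\<alpha> / r) (f j) x) u) (1 / u) * ennreal (\<omega> x powr (1 / r)) / ennreal (C * l)) (r * q x)
          \<le> epow (ennreal (1 / C2) * ?G x) (r * q x)"
          using rq by (intro epow_mono pt) auto
        also have "\<dots> = ennreal ((1 / C2) powr (r * q x)) * epow (?G x) (r * q x)"
          using rq C2 by (subst epow_mult) (auto simp: epow_ennreal)
        also have "\<dots> \<le> ennreal (1 / C0) * epow (?G x) (r * q x)"
        proof (intro mult_right_mono ennreal_leI)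
          have "C0 = C2 powr (r * a)" using C0(1) a r by (simp add: C2_def powr_powr)
          also have "\<dots> \<le> C2 powr (r * q x)" using C2 rq by (intro powr_mono) auto
          finally show "(1 / C2) powr (r * q x) \<le> 1 / C0"
            using C0(1) C2 by (simp add: powr_divide frac_le)
        qed simp
        finally show ?case .
      qed
      also have "\<dots> = ennreal (1 / C0) * (\<integral>\<^sup>+x. epow (?G x) (r * q x) \<partial>lebesgue)"
        by (rule nn_integral_cmult) measurable
      also have "\<dots> \<le> ennreal (1 / C0) * ennreal C0"
        by (intro mult_left_mono int) simp
      also have "\<dots> = 1" using C0(1) by (simp flip: ennreal_mult)
      finally have "?L \<le> ennreal (C * l)"
        unfolding wvar_norm_def var_norm_def using C l by (intro Inf_lower) auto
      then show ?thesis using C l by (simp add: ennreal_mult)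
    qed
    \<comment> \<open>With C moved to the left, the right side is a bare infimum, so it is enough to
      compare with each admissible l by \<open>key\<close>. An infinite norm on the right is
      included as the infimum of the empty set.\<close>
    have "ennreal (1 / C) * ?L \<le> ?R"
      unfolding wvar_norm_def[of _ _ "\<lambda>x. epow (\<Sum>j. ennreal (\<bar>f j x\<bar> powr u)) (1 / u)"] var_norm_def[of "\<lambda>x. r * p x"]
    proof (rule Inf_greatest, clarify)
      fix l :: real assume "0 < l" "(\<integral>\<^sup>+x. epow (epow (\<Sum>j. ennreal (\<bar>f j x\<bar> powr u)) (1 / u) * ennreal (\<omega> x powr (1 / r)) / ennreal l) (r * p x) \<partial>lebesgue) \<le> 1"
      then have "ennreal (1 / C) * ?L \<le> ennreal (1 / C) * (ennreal C * ennreal l)"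
        by (intro mult_left_mono key) auto
      also have "\<dots> = ennreal l"
        using C by (simp add: mult.assoc[symmetric] flip: ennreal_mult)
      finally show "ennreal (1 / C) * ?L \<le> ennreal l" .
    qed
    then have "ennreal C * (ennreal (1 / C) * ?L) \<le> ennreal C * ?R"
      by (rule mult_left_mono) simp
    moreover have "ennreal C * (ennreal (1 / C) * ?L) = ?L"
      using C by (simp add: mult.assoc[symmetric] flip: ennreal_mult)
    ultimately show "?L \<le> ennreal C * ?R" by simp
  qed
qed

end
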